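(* Let $X$ be a real Hilbert space and $A$ a nonnegative self-adjoint operator with dense domain in $X$. Consider $$\tfrac{d}{dt}q=p,\qquad \tfrac{d}{dt}p=-c_-(q)^2Aq,\qquad c_-(q)=\frac1{1-\langle q,Aq\rangle},\qquad \langle q,Aq\rangle<1,\tag{K$_-$}$$ and let $H_-(q,p)=\frac12\bigl[\langle p,p\rangle+\frac{\langle q,Aq\rangle}{1-\langle q,Aq\rangle}\bigr]$. Let $s\ge\frac32$, $T>0$, and let $\Omega\subset\mathcal H^\infty$ (with $\langle q,Aq\rangle<1$ for all $(q,p)\in\Omega$) be bounded in $\mathcal H^s$ with $\sup_{(q,p)\in\Omega}H_-(q,p)<\infty$. Then the set of orbits $$\Omega_T=\bigl\{(q(t),p(t)) : (q,p)\text{ is a global }\mathcal H^\infty\text{ solution to (K}_-)\text{ with }(q(0),p(0))\in\Omega,\ |t|\le T\bigr\}$$ is bounded in $\mathcal H^s$. If $\Omega$ is also equicontinuous in $\mathcal H^s$, then so is $\Omega_T$.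
   Context: Functions of $A$ are defined by the spectral functional calculus. For $s\in\mathbb R$, $H^s$ is the completion of the domain of $(1+A)^{s/2}$ in the norm $\|\phi\|_{H^s}^2=\langle\phi,(1+A)^s\phi\rangle$. For $s\ge1$, $\mathcal H^s=\{(q,p)\in X\times X: A^{1/2}q\in H^{s-1},\ p\in H^{s-1}\}$ with $\|(q,p)\|_{\mathcal H^s}^2=\|A^{1/2}q\|_{H^{s-1}}^2+\|p\|_{H^{s-1}}^2$, and $\mathcal H^\infty=\bigcap_{s\ge1}\mathcal H^s$. The expression $\langle q,Aq\rangle$ means $\|A^{1/2}q\|^2$. For $s\ge1$ and an open interval $I$, an $\mathcal H^s$ solution to (K$_-$) on $I$ is a map $t\mapsto(q(t),p(t))\in\mathcal H^s$ such that $A^{1/2}q,p\in C(I;H^{s-1})$, $q\in C^1(I;X)$ with $\frac{d}{dt}q=p$, $p\in C^1(I;H^{s-2})$ with $\frac{d}{dt}p=-c_-(q)^2Aq$ in $H^{s-2}$, and $\langle q(t),Aq(t)\rangle<1$ for all $t\in I$. It is global if $I=\mathbb R$. An $\mathcal H^\infty$ solution is a map that is an $\mathcal H^s$ solution for every $s\ge1$. For $\kappa>0$ let $P_{\ge\kappa}=\chi_{[\kappa^2,\infty)}(A)$. A set that is bounded in $\mathcal H^s$ is equicontinuous in $\mathcal H^s$ if for every $\varepsilon>0$ there is $\kappa>0$ such that $\|(P_{\ge\kappa}q,P_{\ge\kappa}p)\|_{\mathcal H^s}\le\varepsilon$ for all its elements $(q,p)$. *)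

theory Defs
  imports "HOL-Analysis.Analysis"
begin

text \<open>
  A real Hilbert space is a type of sort \<open>{real_inner, complete_space}\<close>.  A possibly unbounded
  operator is a partial map \<open>T :: 'a \<rightharpoonup> 'a\<close> with domain \<open>dom T\<close>.
\<close>

subsection \<open>Nonnegative self-adjoint operators\<close>

definition op_app :: "('a \<rightharpoonup> 'a) \<Rightarrow> 'a \<Rightarrow> 'a" where
  "op_app T x = the (T x)"

definition linear_op :: "('a::real_inner \<rightharpoonup> 'a) \<Rightarrow> bool" where
  "linear_op T \<longleftrightarrow> subspace (dom T) \<and>
     (\<forall>x\<in>dom T. \<forall>y\<in>dom T. op_app T (x + y) = op_app T x + op_app T y) \<and>
     (\<forall>x\<in>dom T. \<forall>c. op_app T (c *\<^sub>R x) = c *\<^sub>R op_app T x)"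

definition adjoint_op :: "('a::real_inner \<rightharpoonup> 'a) \<Rightarrow> ('a \<rightharpoonup> 'a)" where
  "adjoint_op T = (\<lambda>y.
     if \<exists>z. \<forall>x\<in>dom T. inner (op_app T x) y = inner x z
     then Some (THE z. \<forall>x\<in>dom T. inner (op_app T x) y = inner x z)
     else None)"

definition selfadjoint_op :: "('a::real_inner \<rightharpoonup> 'a) \<Rightarrow> bool" where
  "selfadjoint_op T \<longleftrightarrow> linear_op T \<and> closure (dom T) = UNIV \<and> adjoint_op T = T"

definition nonneg_op :: "('a::real_inner \<rightharpoonup> 'a) \<Rightarrow> bool" where
  "nonneg_op T \<longleftrightarrow> (\<forall>x\<in>dom T. 0 \<le> inner x (op_app T x))"


subsection \<open>Spectral functional calculus\<close>

definition proj_valued_measure :: "(real set \<Rightarrow> 'a::real_inner \<Rightarrow> 'a) \<Rightarrow> bool" where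
  "proj_valued_measure E \<longleftrightarrow>
     (\<forall>S\<in>sets borel. bounded_linear (E S) \<and> (\<forall>x. E S (E S x) = E S x) \<and>
        (\<forall>x y. inner (E S x) y = inner x (E S y))) \<and>
     (\<forall>x. E UNIV x = x) \<and>
     (\<forall>S\<in>sets borel. \<forall>S'\<in>sets borel. \<forall>x. E (S \<inter> S') x = E S (E S' x)) \<and>
     (\<forall>F. range F \<subseteq> sets borel \<longrightarrow> disjoint_family F \<longrightarrow>
        (\<forall>x. (\<lambda>i::nat. E (F i) x) sums E (\<Union>i. F i) x))"

definition scalar_measure :: "(real set \<Rightarrow> 'a::real_inner \<Rightarrow> 'a) \<Rightarrow> 'a \<Rightarrow> real measure" where
  "scalar_measure E x = measure_of UNIV (sets borel) (\<lambda>S. ennreal (inner x (E S x)))"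

definition spectral_dom :: "(real set \<Rightarrow> 'a::real_inner \<Rightarrow> 'a) \<Rightarrow> (real \<Rightarrow> real) \<Rightarrow> 'a set" where
  "spectral_dom E f = {x. integrable (scalar_measure E x) (\<lambda>l. (f l)\<^sup>2)}"

text \<open>
  The operator \<open>\<integral> f dE\<close>: it sends \<open>x\<close> to the vector \<open>z\<close> with \<open>\<langle>y, z\<rangle> = \<integral> f d\<langle>y, E x\<rangle>\<close> for all \<open>y\<close> in
  the (dense) domain, the signed measure \<open>\<langle>y, E x\<rangle>\<close> being written by polarization as
  one quarter of the difference of the scalar measures of \<open>x + y\<close> and \<open>x - y\<close>.
\<close>

definition spectral_integral ::
    "(real set \<Rightarrow> 'a::real_inner \<Rightarrow> 'a) \<Rightarrow> (real \<Rightarrow> real) \<Rightarrow> ('a \<rightharpoonup> 'a)" where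
  "spectral_integral E f = (\<lambda>x.
     if x \<in> spectral_dom E f
     then Some (THE z. \<forall>y\<in>spectral_dom E f.
            inner y z = ((\<integral>l. f l \<partial>scalar_measure E (x + y)) -
                         (\<integral>l. f l \<partial>scalar_measure E (x - y))) / 4)
     else None)"

text \<open>
  The spectral measure of a self-adjoint operator exists and is unique by the spectral theorem,
  so the choice below is determined.
\<close>

definition spectral_measure :: "('a::real_inner \<rightharpoonup> 'a) \<Rightarrow> real set \<Rightarrow> 'a \<Rightarrow> 'a" where
  "spectral_measure A = (SOME E. proj_valued_measure E \<and> spectral_integral E (\<lambda>l. l) = A)"

definition fun_op :: "('a::real_inner \<rightharpoonup> 'a) \<Rightarrow> (real \<Rightarrow> real) \<Rightarrow> ('a \<rightharpoonup> 'a)" where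
  "fun_op A f = spectral_integral (spectral_measure A) f"

definition sqrt_op :: "('a::real_inner \<rightharpoonup> 'a) \<Rightarrow> ('a \<rightharpoonup> 'a)" where
  "sqrt_op A = fun_op A sqrt"

definition bessel_op :: "('a::real_inner \<rightharpoonup> 'a) \<Rightarrow> real \<Rightarrow> ('a \<rightharpoonup> 'a)" where
  "bessel_op A r = fun_op A (\<lambda>l. (1 + l) powr (r / 2))"

definition proj_ge :: "('a::real_inner \<rightharpoonup> 'a) \<Rightarrow> real \<Rightarrow> 'a \<Rightarrow> 'a" where
  "proj_ge A \<kappa> = op_app (fun_op A (indicator {\<kappa>\<^sup>2..}))"


subsection \<open>The spaces \<open>H\<^sup>r\<close>\<close>

text \<open>
  \<open>Hs A r\<close> is the domain of \<open>(1 + A)\<^bsup>r/2\<^esup>\<close>, and \<open>\<langle>\<phi>, (1 + A)\<^sup>r \<phi>\<rangle>\<close> is read as a quadratic form,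
  i.e. as the squared norm of \<open>(1 + A)\<^bsup>r/2\<^esup> \<phi>\<close>.  For \<open>r \<ge> 0\<close> the operator \<open>(1 + A)\<^bsup>r/2\<^esup>\<close> is closed and
  bounded below by 1, so \<open>Hs A r\<close> is already complete in this norm and is the space \<open>H\<^sup>r\<close> itself.
\<close>

definition Hs :: "('a::real_inner \<rightharpoonup> 'a) \<Rightarrow> real \<Rightarrow> 'a set" where
  "Hs A r = dom (bessel_op A r)"

definition Hs_norm :: "('a::real_inner \<rightharpoonup> 'a) \<Rightarrow> real \<Rightarrow> 'a \<Rightarrow> real" where
  "Hs_norm A r \<phi> = norm (op_app (bessel_op A r) \<phi>)"

text \<open>
  For \<open>r < 0\<close> one has to complete.  Elements of the completion are represented by Cauchy sequences
  in \<open>Hs A r\<close>; two sequences represent the same element iff their \<open>Hs_dist\<close> is 0, and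
  \<open>\<phi>\<close> in \<open>Hs A r\<close> is represented by the constant sequence.
\<close>

definition Hs_completion :: "('a::real_inner \<rightharpoonup> 'a) \<Rightarrow> real \<Rightarrow> (nat \<Rightarrow> 'a) set" where
  "Hs_completion A r = {u. (\<forall>n. u n \<in> Hs A r) \<and>
     (\<forall>\<epsilon>>0. \<exists>N. \<forall>m\<ge>N. \<forall>n\<ge>N. Hs_norm A r (u m - u n) < \<epsilon>)}"

definition Hs_dist :: "('a::real_inner \<rightharpoonup> 'a) \<Rightarrow> real \<Rightarrow> (nat \<Rightarrow> 'a) \<Rightarrow> (nat \<Rightarrow> 'a) \<Rightarrow> real" where
  "Hs_dist A r u v = lim (\<lambda>n. Hs_norm A r (u n - v n))"

text \<open>\<open>f \<in> C(I; H\<^sup>r)\<close>, for \<open>r \<ge> 0\<close>.\<close>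

definition continuous_Hs ::
    "('a::real_inner \<rightharpoonup> 'a) \<Rightarrow> real \<Rightarrow> real set \<Rightarrow> (real \<Rightarrow> 'a) \<Rightarrow> bool" where
  "continuous_Hs A r I f \<longleftrightarrow> (\<forall>t\<in>I. f t \<in> Hs A r) \<and>
     (\<forall>t\<in>I. ((\<lambda>\<tau>. Hs_norm A r (f \<tau> - f t)) \<longlongrightarrow> 0) (at t within I))"

text \<open>
  \<open>f \<in> C\<^sup>1(I; H\<^sup>r)\<close> with derivative \<open>w\<close>, for arbitrary real \<open>r\<close>; the values of \<open>f\<close> lie in \<open>Hs A r\<close>,
  those of \<open>w\<close> in the completion.
\<close>

definition C1_Hs ::
    "('a::real_inner \<rightharpoonup> 'a) \<Rightarrow> real \<Rightarrow> real set \<Rightarrow> (real \<Rightarrow> 'a) \<Rightarrow> (real \<Rightarrow> nat \<Rightarrow> 'a) \<Rightarrow> bool" where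
  "C1_Hs A r I f w \<longleftrightarrow>
     (\<forall>t\<in>I. f t \<in> Hs A r) \<and> (\<forall>t\<in>I. w t \<in> Hs_completion A r) \<and>
     (\<forall>t\<in>I. ((\<lambda>\<tau>. Hs_dist A r (\<lambda>n. (f \<tau> - f t) /\<^sub>R (\<tau> - t)) (w t)) \<longlongrightarrow> 0) (at t within I)) \<and>
     (\<forall>t\<in>I. ((\<lambda>\<tau>. Hs_dist A r (w \<tau>) (w t)) \<longlongrightarrow> 0) (at t within I))"

text \<open>
  If \<open>A\<^bsup>1/2\<^esup> q \<in> H\<^bsup>s-1\<^esup>\<close>, then \<open>A q \<in> H\<^bsup>s-2\<^esup>\<close> is obtained by extending \<open>A\<close> continuously; it is
  represented by the Cauchy sequence \<open>A q\<^sub>n\<close> with the spectral truncations \<open>q\<^sub>n\<close> of \<open>q\<close> to \<open>A \<le> n\<close>.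
\<close>

definition ext_op :: "('a::real_inner \<rightharpoonup> 'a) \<Rightarrow> 'a \<Rightarrow> nat \<Rightarrow> 'a" where
  "ext_op A q n = op_app A (op_app (fun_op A (indicator {..real n})) q)"


subsection \<open>Phase space\<close>

definition calH :: "('a::real_inner \<rightharpoonup> 'a) \<Rightarrow> real \<Rightarrow> ('a \<times> 'a) set" where
  "calH A s = {(q, p). q \<in> dom (sqrt_op A) \<and> op_app (sqrt_op A) q \<in> Hs A (s - 1) \<and> p \<in> Hs A (s - 1)}"

definition calH_norm :: "('a::real_inner \<rightharpoonup> 'a) \<Rightarrow> real \<Rightarrow> 'a \<times> 'a \<Rightarrow> real" where
  "calH_norm A s = (\<lambda>(q, p). sqrt ((Hs_norm A (s - 1) (op_app (sqrt_op A) q))\<^sup>2 + (Hs_norm A (s - 1) p)\<^sup>2))"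

definition calH_inf :: "('a::real_inner \<rightharpoonup> 'a) \<Rightarrow> ('a \<times> 'a) set" where
  "calH_inf A = (\<Inter>s\<in>{1..}. calH A s)"

definition bounded_calH :: "('a::real_inner \<rightharpoonup> 'a) \<Rightarrow> real \<Rightarrow> ('a \<times> 'a) set \<Rightarrow> bool" where
  "bounded_calH A s S \<longleftrightarrow> S \<subseteq> calH A s \<and> (\<exists>M. \<forall>z\<in>S. calH_norm A s z \<le> M)"

definition equicontinuous_calH :: "('a::real_inner \<rightharpoonup> 'a) \<Rightarrow> real \<Rightarrow> ('a \<times> 'a) set \<Rightarrow> bool" where
  "equicontinuous_calH A s S \<longleftrightarrow> bounded_calH A s S \<and>
     (\<forall>\<epsilon>>0. \<exists>\<kappa>>0. \<forall>(q, p)\<in>S. calH_norm A s (proj_ge A \<kappa> q, proj_ge A \<kappa> p) \<le> \<epsilon>)"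


subsection \<open>The equation\<close>

text \<open>\<open>qform A q\<close> is \<open>\<langle>q, A q\<rangle>\<close>, for \<open>q\<close> in the domain of \<open>A\<^bsup>1/2\<^esup>\<close>.\<close>

definition qform :: "('a::real_inner \<rightharpoonup> 'a) \<Rightarrow> 'a \<Rightarrow> real" where
  "qform A q = (norm (op_app (sqrt_op A) q))\<^sup>2"

definition c_minus :: "('a::real_inner \<rightharpoonup> 'a) \<Rightarrow> 'a \<Rightarrow> real" where
  "c_minus A q = 1 / (1 - qform A q)"

definition H_minus :: "('a::real_inner \<rightharpoonup> 'a) \<Rightarrow> 'a \<times> 'a \<Rightarrow> real" where
  "H_minus A = (\<lambda>(q, p). (inner p p + qform A q / (1 - qform A q)) / 2)"

definition solution_Km ::
    "('a::real_inner \<rightharpoonup> 'a) \<Rightarrow> real \<Rightarrow> real set \<Rightarrow> (real \<Rightarrow> 'a) \<Rightarrow> (real \<Rightarrow> 'a) \<Rightarrow> bool" where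
  "solution_Km A s I q p \<longleftrightarrow>
     open I \<and> is_interval I \<and>
     (\<forall>t\<in>I. (q t, p t) \<in> calH A s) \<and>
     continuous_Hs A (s - 1) I (\<lambda>t. op_app (sqrt_op A) (q t)) \<and>
     continuous_Hs A (s - 1) I p \<and>
     continuous_on I p \<and> (\<forall>t\<in>I. (q has_vector_derivative p t) (at t within I)) \<and>
     C1_Hs A (s - 2) I p (\<lambda>t n. - ((c_minus A (q t))\<^sup>2 *\<^sub>R ext_op A (q t) n)) \<and>
     (\<forall>t\<in>I. qform A (q t) < 1)"

definition solution_Km_inf ::
    "('a::real_inner \<rightharpoonup> 'a) \<Rightarrow> real set \<Rightarrow> (real \<Rightarrow> 'a) \<Rightarrow> (real \<Rightarrow> 'a) \<Rightarrow> bool" where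
  "solution_Km_inf A I q p \<longleftrightarrow> (\<forall>s\<ge>1. solution_Km A s I q p)"

definition orbit_set :: "('a::real_inner \<rightharpoonup> 'a) \<Rightarrow> ('a \<times> 'a) set \<Rightarrow> real \<Rightarrow> ('a \<times> 'a) set" where
  "orbit_set A \<Omega> T =
     {(q t, p t) | q p t. solution_Km_inf A UNIV q p \<and> (q 0, p 0) \<in> \<Omega> \<and> \<bar>t\<bar> \<le> T}"

end

theory Submission
  imports Defs "HOL-Probability.Probability" "HOL-Real_Asymp.Real_Asymp"
begin

text \<open>
  In an eigenbasis of \<open>A\<close> the flow has the integrals
  \<open>F\<^sub>k = p\<^sub>k\<^sup>2 + c \<lambda>\<^sub>k q\<^sub>k\<^sup>2 - \<lambda>\<^sub>k \<Sum>\<^sub>l\<^sub>\<noteq>\<^sub>k \<lambda>\<^sub>l (q\<^sub>k p\<^sub>l - q\<^sub>l p\<^sub>k)\<^sup>2 / (\<lambda>\<^sub>k - \<lambda>\<^sub>l)\<close>, \<open>c = c\<^sub>-(q)\<close>.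
  Weighted with \<open>\<lambda>\<^sub>k / (\<lambda>\<^sub>k + \<kappa>\<^sup>2)\<close> their sum is, for \<open>a = A (A + \<kappa>\<^sup>2)\<^sup>-\<^sup>1\<close>,
  \<open>\<langle>p, a p\<rangle> + c \<langle>q, A a q\<rangle> - \<kappa>\<^sup>2 (\<langle>p, a p\<rangle> \<langle>q, a q\<rangle> - \<langle>q, a p\<rangle>\<^sup>2)\<close>,
  which is conserved and, up to powers of \<open>c\<close>, comparable with \<open>\<langle>p, a p\<rangle> + \<langle>q, A a q\<rangle>\<close>; the energy
  \<open>H\<^sub>-\<close> bounds \<open>c\<close>. Integration over \<open>\<kappa>\<close> bounds \<open>\<langle>p, A\<^bsup>1/2\<^esup> p\<rangle> + \<langle>q, A\<^bsup>3/2\<^esup> q\<rangle>\<close>, hence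
  \<open>\<langle>A q, p\<rangle>\<close>, for all times by the \<open>H\<^bsup>3/2\<^esup>\<close> norm of the data. Since \<open>c' = 2 c\<^sup>2 \<langle>A q, p\<rangle>\<close>, Gronwall's
  inequality then controls \<open>\<langle>p, h(A) p\<rangle> + c\<^sup>2 \<langle>q, A h(A) q\<rangle>\<close> for every weight \<open>h \<ge> 0\<close> with a constant that does
  not depend on \<open>h\<close>, in particular for \<open>h = (1 + A)\<^bsup>s-1\<^esup> P\<^sub>\<ge>\<^sub>\<kappa>\<close>.

  The functional calculus rests on the spectral theorem. The moments \<open>\<langle>B\<^sup>k x, x\<rangle>\<close> of \<open>B = (1 + A)\<^sup>-\<^sup>1\<close> solve a
  Hausdorff moment problem on \<open>[0, 1]\<close>, and the resulting measures depend quadratically on \<open>x\<close>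
  because they are determined by their moments.
\<close>


subsection \<open>Hilbert spaces\<close>

text \<open>\<open>A\<close> may have continuous spectrum, so the integrals of the overview enter
  only through the bounded operator a = A (A + \<kappa>^2)^-1, whose quadratic forms can be
  differentiated along a solution with q(t) merely in \<open>dom A\<close>. Conservation rests on
  two properties of this particular nonlinearity: c' = 2 c^2 <A q, p> and c <q, A q> = c - 1.
  Coercivity rests on \<kappa>^2 <q, a q> \<le> <q, A q> < 1: the quartic term can remove at most
  the fraction <q, A q> of <p, a p>, which leaves 1/c of it.

  The exponent 3/2 comes from splitting <A q, p> as <A^(3/4) q, A^(1/4) p>; integrating l / (l +
  \<kappa>^2) over \<kappa> > 0 gives (pi/2) sqrt l, which is the weight that controls both factors.

  A constant independent of the weight allows one inequality for every Borel set of the spectrum: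
  the whole line yields boundedness, a half-line yields equicontinuity.

  The bounded functional calculus is developed once, for a family of measures that is known to be
  quadratic only on a set of test functions, and used twice: with polynomials of B to construct a
  spectral measure, and with indicators to compute with a given one.\<close>

lemma convergent_if_norm_diff_sq_le:
  fixes x :: "nat \<Rightarrow> 'a::{real_normed_vector, complete_space}"
  assumes le: "\<And>m n. (norm (x m - x n))\<^sup>2 \<le> a m + a n" and a: "a \<longlonglongrightarrow> 0"
  shows "convergent x"
proof -
  have "Cauchy x"
  proof (rule metric_CauchyI)
    fix e :: real assume "0 < e"
    then have "\<forall>\<^sub>F n in sequentially. a n < e\<^sup>2 / 2" 
      using order_tendstoD(2)[OF a, of "e\<^sup>2/2"] by simp
    then obtain N where N: "\<And>n. n \<ge> N \<Longrightarrow> a n < e\<^sup>2 / 2" by (auto simp: eventually_sequentially)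
    show "\<exists>M. \<forall>m\<ge>M. \<forall>n\<ge>M. dist (x m) (x n) < e"
    proof (intro exI allI impI)
      fix m n assume "m \<ge> N" "n \<ge> N"
      then have "(norm (x m - x n))\<^sup>2 < e\<^sup>2" using le[of m n] N[of m] N[of n] by simp
      then show "dist (x m) (x n) < e" using \<open>0 < e\<close> by (simp add: dist_norm power2_less_imp_less)
    qed
  qed
  then show ?thesis by (simp add: Cauchy_convergent_iff)
qed

text \<open>A minimising sequence for the distance to \<open>S\<close> is Cauchy by the
  parallelogram law, midpoints staying in \<open>S\<close>; orthogonality is the first-order
  condition at the minimiser.\<close>

lemma closed_subspace_projection:
  fixes S :: "'a::{real_inner, complete_space} set"
  assumes S: "subspace S" "closed S"
  obtains z where "z \<in> S" "\<And>s. s \<in> S \<Longrightarrow> inner (y - z) s = 0"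
proof -
  define D where "D = (\<lambda>s. (norm (y - s))\<^sup>2) ` S"
  define d where "d = Inf D"
  have ne: "D \<noteq> {}" using subspace_0[OF S(1)] by (auto simp: D_def)
  have bdd: "bdd_below D" by (auto simp: D_def intro!: bdd_belowI[of _ 0])
  have dle: "d \<le> (norm (y - s))\<^sup>2" if "s \<in> S" for s
    unfolding d_def by (rule cInf_lower[OF _ bdd]) (auto simp: D_def that)
  have "\<exists>s\<in>S. (norm (y - s))\<^sup>2 < d + 1 / Suc n" for n
  proof -
    have "\<exists>t\<in>D. t < d + 1 / Suc n"
      unfolding d_def using cInf_lessD[OF ne, of "Inf D + 1 / Suc n"] by simp
    then show ?thesis by (auto simp: D_def)
  qed
  then obtain x where x: "\<And>n. x n \<in> S" "\<And>n. (norm (y - x n))\<^sup>2 < d + 1 / Suc n" by metis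
  have "convergent x"
  proof (rule convergent_if_norm_diff_sq_le)
    show "(norm (x m - x n))\<^sup>2 \<le> 2 / Suc m + 2 / Suc n" for m n
    proof -
      have "(norm (x m - x n))\<^sup>2 = 2 * (norm (y - x m))\<^sup>2 + 2 * (norm (y - x n))\<^sup>2
          - 4 * (norm (y - (1/2) *\<^sub>R (x m + x n)))\<^sup>2"
        by (simp add: power2_norm_eq_inner inner_diff_left inner_diff_right inner_add_left
            inner_add_right inner_commute algebra_simps)
      moreover have "d \<le> (norm (y - (1/2) *\<^sub>R (x m + x n)))\<^sup>2"
        by (intro dle subspace_scale subspace_add S x)
      ultimately show ?thesis using x(2)[of m] x(2)[of n] by simp
    qed
    show "(\<lambda>n. 2 / Suc n) \<longlonglongrightarrow> 0" by real_asymp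
  qed
  then obtain z where z: "x \<longlonglongrightarrow> z" by (auto simp: convergent_def)
  have zS: "z \<in> S" using closed_sequentially[OF S(2) _ z] x(1) by blast
  have "(norm (y - z))\<^sup>2 \<le> d"
  proof (rule LIMSEQ_le)
    show "(\<lambda>n. (norm (y - x n))\<^sup>2) \<longlonglongrightarrow> (norm (y - z))\<^sup>2" by (intro tendsto_intros z)
    show "(\<lambda>n. d + 1 / Suc n) \<longlonglongrightarrow> d" by real_asymp
  qed (use x(2) less_imp_le in blast)
  then have min: "(norm (y - z))\<^sup>2 \<le> (norm (y - s))\<^sup>2" if "s \<in> S" for s
    using dle[OF that] by (rule order_trans)
  have "inner (y - z) s = 0" if s: "s \<in> S" for s
  proof (cases "s = 0")
    case False
    \<comment> \<open>The minimiser of the quadratic polynomial t \<mapsto> |y - z - t s|^2.\<close>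
    define t where "t = inner (y - z) s / (inner s s)"
    have "(norm (y - z))\<^sup>2 \<le> (norm (y - (z + t *\<^sub>R s)))\<^sup>2"
      by (intro min subspace_add subspace_scale S zS s)
    also have "\<dots> = (norm (y - z))\<^sup>2 - 2 * t * inner (y - z) s + t * t * inner s s"
      by (simp add: power2_norm_eq_inner inner_diff_left inner_diff_right inner_add_left
            inner_add_right inner_commute algebra_simps)
    also have "\<dots> = (norm (y - z))\<^sup>2 - (inner (y - z) s)\<^sup>2 / inner s s"
      using False by (simp add: t_def field_simps power2_eq_square)
    finally have "(inner (y - z) s)\<^sup>2 / inner s s \<le> 0" by simp
    moreover have "inner s s > 0" using False by simp
    ultimately show ?thesis by (simp add: divide_le_0_iff)
  qed simp
  with zS that show ?thesis by blast
qed

text \<open>The kernel has codimension one: the component \<open>w\<close> of any \<open>v\<close>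
  with \<phi> v \<noteq> 0 that is orthogonal to the kernel spans its complement, and a rescaling of
  \<open>w\<close> represents \<phi>.\<close>

lemma Riesz_representation:
  fixes \<phi> :: "'a::{real_inner, complete_space} \<Rightarrow> real"
  assumes "bounded_linear \<phi>"
  obtains z where "\<And>y. \<phi> y = inner z y"
proof (cases "\<forall>v. \<phi> v = 0")
  case True
  then show ?thesis using that[of 0] by simp
next
  case False
  interpret bounded_linear \<phi> by fact
  obtain v where v: "\<phi> v \<noteq> 0" using False by blast
  have S: "subspace {x. \<phi> x = 0}" by (auto simp: subspace_def add scaleR zero)
  have "closed {x. \<phi> x = 0}"
    by (intro closed_Collect_eq linear_continuous_on assms continuous_on_const)
  then obtain z where z: "\<phi> z = 0" "\<And>s. \<phi> s = 0 \<Longrightarrow> inner (v - z) s = 0"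
    using closed_subspace_projection[OF S, of v] by auto
  define w where "w = v - z"
  have \<phi>w: "\<phi> w \<noteq> 0" by (simp add: w_def diff z v)
  then have w0: "w \<noteq> 0" using zero by auto
  have "\<phi> y = inner ((\<phi> w / inner w w) *\<^sub>R w) y" for y
  proof -
    have "\<phi> (y - (\<phi> y / \<phi> w) *\<^sub>R w) = 0" using \<phi>w by (simp add: diff scaleR)
    then have "inner w (y - (\<phi> y / \<phi> w) *\<^sub>R w) = 0" using z(2) by (simp add: w_def)
    then have "inner w y = \<phi> y / \<phi> w * inner w w" by (simp add: inner_diff_right)
    then show ?thesis using w0 \<phi>w by (simp add: field_simps)
  qed
  then show ?thesis using that by blast
qed

lemma bounded_form_operator:
  fixes B :: "'a::{real_inner, complete_space} \<Rightarrow> 'a \<Rightarrow> real"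
  assumes B: "bounded_bilinear B"
  obtains T where "bounded_linear T" "\<And>x y. inner (T x) y = B x y"
proof -
  interpret bounded_bilinear B by fact
  have "\<exists>z. \<forall>y. B x y = inner z y" for x
    using Riesz_representation[OF bounded_linear_right[of x]] by metis
  then obtain T where T: "\<And>x y. B x y = inner (T x) y" by metis
  obtain K where K: "0 \<le> K" "\<And>x y. norm (B x y) \<le> norm x * norm y * K"
    using nonneg_bounded by blast
  have "bounded_linear T"
  proof (rule bounded_linear_intro)
    show "T (x + y) = T x + T y" for x y
    proof -
      have "inner (T (x + y) - (T x + T y)) z = 0" for z
        by (simp add: inner_diff_left inner_add_left flip: T) (simp add: add_left)
      then have "T (x + y) - (T x + T y) = 0" using inner_eq_zero_iff by blast
      then show ?thesis by simp
    qed
    show "T (r *\<^sub>R x) = r *\<^sub>R T x" for r x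
    proof -
      have "inner (T (r *\<^sub>R x) - r *\<^sub>R T x) z = 0" for z
        by (simp add: inner_diff_left flip: T) (simp add: scaleR_left)
      then have "T (r *\<^sub>R x) - r *\<^sub>R T x = 0" using inner_eq_zero_iff by blast
      then show ?thesis by simp
    qed
    show "norm (T x) \<le> norm x * K" for x
    proof (cases "T x = 0")
      case True
      then show ?thesis using K(1) by simp
    next
      case False
      have "norm (T x) * norm (T x) = B x (T x)" by (simp add: T dot_square_norm power2_eq_square)
      also have "\<dots> \<le> (norm x * K) * norm (T x)" using K(2)[of x "T x"] by (simp add: mult_ac)
      finally show ?thesis using False by (simp add: mult_le_cancel_right)
    qed
  qed
  then show ?thesis using that T by metis
qed

subsection \<open>Signed combinations of measures\<close>

text \<open>The bound is pointwise and not almost everywhere, so that one class of functions serves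
  all the measures \<mu> x at once.\<close>

definition bdd_borel :: "(real \<Rightarrow> real) \<Rightarrow> bool" where
  "bdd_borel f \<longleftrightarrow> f \<in> borel_measurable borel \<and> (\<exists>K. \<forall>x. \<bar>f x\<bar> \<le> K)"

lemma bdd_borelI: "f \<in> borel_measurable borel \<Longrightarrow> (\<And>x. \<bar>f x\<bar> \<le> K) \<Longrightarrow> bdd_borel f"
  by (auto simp: bdd_borel_def)

lemma bdd_borel_measurable: "bdd_borel f \<Longrightarrow> f \<in> borel_measurable borel"
  by (simp add: bdd_borel_def)

lemma bdd_borel_indicator [simp, intro]: "S \<in> sets borel \<Longrightarrow> bdd_borel (indicator S)"
  by (rule bdd_borelI[of _ 1]) (auto simp: indicator_def)

lemma bdd_borel_const [simp, intro]: "bdd_borel (\<lambda>x. c)"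
  by (rule bdd_borelI[of _ "\<bar>c\<bar>"]) auto

lemma bdd_borel_add [intro]:
  assumes "bdd_borel f" "bdd_borel g" shows "bdd_borel (\<lambda>x. f x + g x)"
proof -
  obtain K K' where "\<And>x. \<bar>f x\<bar> \<le> K" "\<And>x. \<bar>g x\<bar> \<le> K'" using assms by (auto simp: bdd_borel_def)
  then have "\<bar>f x + g x\<bar> \<le> K + K'" for x by (meson abs_triangle_ineq add_mono order_trans)
  then show ?thesis using assms by (intro bdd_borelI) (auto simp: bdd_borel_def)
qed

lemma bdd_borel_mult [intro]:
  assumes "bdd_borel f" "bdd_borel g" shows "bdd_borel (\<lambda>x. f x * g x)"
proof -
  obtain K K' where K: "\<And>x. \<bar>f x\<bar> \<le> K" "\<And>x. \<bar>g x\<bar> \<le> K'" using assms by (auto simp: bdd_borel_def)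
  have "0 \<le> K" using K(1)[of 0] by linarith
  then have "\<bar>f x * g x\<bar> \<le> K * K'" for x unfolding abs_mult by (intro mult_mono K) auto
  then show ?thesis using assms by (intro bdd_borelI) (auto simp: bdd_borel_def)
qed

lemma bdd_borel_minus [intro]: "bdd_borel f \<Longrightarrow> bdd_borel (\<lambda>x. - f x)"
  using bdd_borel_mult[of "\<lambda>x. -1" f] by simp

lemma bdd_borel_diff [intro]:
  "bdd_borel f \<Longrightarrow> bdd_borel g \<Longrightarrow> bdd_borel (\<lambda>x. f x - g x)"
  using bdd_borel_add[of f "\<lambda>x. - g x"] by auto

lemma bdd_borel_power2 [intro]: "bdd_borel f \<Longrightarrow> bdd_borel (\<lambda>x. (f x)\<^sup>2)"
  unfolding power2_eq_square by auto

text \<open>The list encodes the finite signed measure given by the sum of \<open>w dM\<close>. A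
  linear identity between measures, with coefficients of either sign, becomes the vanishing of a
  single list.\<close>

definition weighted_measures :: "(real measure \<times> (real \<Rightarrow> real)) list \<Rightarrow> bool" where
  "weighted_measures L \<longleftrightarrow> (\<forall>(M, w)\<in>set L. finite_measure M \<and> sets M = sets borel \<and> bdd_borel w)"

definition weighted_integral :: "(real measure \<times> (real \<Rightarrow> real)) list \<Rightarrow> (real \<Rightarrow> real) \<Rightarrow> real" where
  "weighted_integral L f = (\<Sum>(M, w)\<leftarrow>L. \<integral>x. w x * f x \<partial>M)"

lemma integrable_bdd_borel:
  assumes "finite_measure M" "sets M = sets borel" "bdd_borel f"
  shows "integrable M f"
proof -
  interpret finite_measure M by fact
  obtain K where "\<And>x. \<bar>f x\<bar> \<le> K" using assms(3) by (auto simp: bdd_borel_def)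
  moreover have "f \<in> borel_measurable M"
    using bdd_borel_measurable[OF assms(3)] assms(2) measurable_cong_sets by blast
  ultimately show ?thesis by (intro integrable_const_bound[of f K]) auto
qed

lemma integrable_weighted:
  assumes "weighted_measures L" "(M, w) \<in> set L" "bdd_borel f"
  shows "integrable M (\<lambda>x. w x * f x)"
  using assms by (intro integrable_bdd_borel bdd_borel_mult) (auto simp: weighted_measures_def)

lemma weighted_integral_add:
  assumes L: "weighted_measures L" and f: "bdd_borel f" and g: "bdd_borel g"
  shows "weighted_integral L (\<lambda>x. f x + g x) = weighted_integral L f + weighted_integral L g"
proof -
  have "(\<integral>x. w x * (f x + g x) \<partial>M) = (\<integral>x. w x * f x \<partial>M) + (\<integral>x. w x * g x \<partial>M)"
    if "(M, w) \<in> set L" for M w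
    using integrable_weighted[OF L that f] integrable_weighted[OF L that g]
    by (simp add: distrib_left)
  then have "weighted_integral L (\<lambda>x. f x + g x)
      = (\<Sum>(M, w)\<leftarrow>L. (\<integral>x. w x * f x \<partial>M) + (\<integral>x. w x * g x \<partial>M))"
    unfolding weighted_integral_def by (intro arg_cong[of _ _ sum_list] map_cong) auto
  then show ?thesis unfolding weighted_integral_def by (simp add: case_prod_unfold sum_list_addf)
qed

lemma weighted_integral_cmult:
  "weighted_integral L (\<lambda>x. c * f x) = c * weighted_integral L f"
  by (induction L) (auto simp: weighted_integral_def distrib_left mult.left_commute)

text \<open>Dominated convergence entry by entry. The set \<open>S\<close> carries all the measures,
  so that approximation by polynomials has to be controlled only on the unit interval.\<close>

lemma weighted_integral_tendsto:
  assumes L: "weighted_measures L" and f: "\<And>n. f n \<in> borel_measurable borel"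
    and g: "g \<in> borel_measurable borel"
    and N: "\<And>M w. (M, w) \<in> set L \<Longrightarrow> AE x in M. x \<in> S"
    and K: "\<And>n x. x \<in> S \<Longrightarrow> \<bar>f n x\<bar> \<le> K"
    and lim: "\<And>x. x \<in> S \<Longrightarrow> (\<lambda>n. f n x) \<longlonglongrightarrow> g x"
  shows "(\<lambda>n. weighted_integral L (f n)) \<longlonglongrightarrow> weighted_integral L g"
proof -
  have "(\<lambda>n. \<integral>x. w x * f n x \<partial>M) \<longlonglongrightarrow> (\<integral>x. w x * g x \<partial>M)" if Mw: "(M, w) \<in> set L" for M w
  proof -
    obtain W where W: "\<And>x. \<bar>w x\<bar> \<le> W" and M: "finite_measure M" "sets M = sets borel"
        and w: "w \<in> borel_measurable borel"
      using L Mw by (fastforce simp: weighted_measures_def bdd_borel_def)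
    interpret finite_measure M by fact
    have eq: "borel_measurable M = borel_measurable borel" using M(2) measurable_cong_sets by blast
    show ?thesis
    proof (rule integral_dominated_convergence)
      show "(\<lambda>x. w x * g x) \<in> borel_measurable M" "(\<lambda>x. w x * f n x) \<in> borel_measurable M" for n
        unfolding eq using w f g by auto
      show "integrable M (\<lambda>x. W * K)" by simp
      show "AE x in M. (\<lambda>n. w x * f n x) \<longlonglongrightarrow> w x * g x"
        using N[OF Mw] by eventually_elim (intro tendsto_intros lim)
      show "AE x in M. norm (w x * f n x) \<le> W * K" for n
        using N[OF Mw]
      proof eventually_elim
        case (elim x)
        then show ?case unfolding real_norm_def abs_mult
          by (intro mult_mono W K) (use W[of 0] in auto)
      qed
    qed
  qed
  then show ?thesis unfolding weighted_integral_def
  proof (induction L)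
    case (Cons a L)
    then show ?case by (cases a) (auto intro!: tendsto_add)
  qed simp
qed

lemma weighted_integral_eq_0:
  assumes L: "weighted_measures L"
    and S: "\<And>S. S \<in> sets borel \<Longrightarrow> weighted_integral L (indicator S) = 0"
    and f: "bdd_borel f"
  shows "weighted_integral L f = 0"
proof -
  \<comment> \<open>Boundedness is a premise inside the induction predicate: additivity and passage
    to the limit need integrability, and the summands and approximants inherit the bound from
    \<open>g\<close>.\<close>
  have nn: "(\<exists>K. \<forall>x. g x \<le> K) \<longrightarrow> weighted_integral L g = 0" (is "?P g")
    if g: "g \<in> borel_measurable borel" "\<And>x. 0 \<le> g x" for g
    using g
  proof (induction rule: borel_measurable_induct_real)
    case (set A)
    then show ?case using S by simp
  next
    case (mult u c)
    show ?case
    proof (intro impI)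
      assume "\<exists>K. \<forall>x. c * u x \<le> K"
      then obtain K where K: "\<And>x. c * u x \<le> K" by blast
      show "weighted_integral L (\<lambda>x. c * u x) = 0"
      proof (cases "c = 0")
        case False
        then have "\<forall>x. u x \<le> K / c" using K mult.hyps(1) by (auto simp: field_simps)
        then show ?thesis using mult.IH by (auto simp: weighted_integral_cmult)
      qed (simp add: weighted_integral_def case_prod_unfold)
    qed
  next
    case (add u v)
    show ?case
    proof (intro impI)
      assume "\<exists>K. \<forall>x. v x + u x \<le> K"
      then obtain K where K: "\<And>x. v x + u x \<le> K" by blast
      have u: "u x \<le> K" and v: "v x \<le> K" for x
        using K[of x] add.hyps(2)[of x] add.hyps(4)[of x] by linarith+
      have "weighted_integral L u = 0" "weighted_integral L v = 0" using u v add.IH by auto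
      moreover have "weighted_integral L (\<lambda>x. v x + u x) = weighted_integral L v + weighted_integral L u"
        using add u v by (intro weighted_integral_add[OF L] bdd_borelI[of _ K]) auto
      ultimately show "weighted_integral L (\<lambda>x. v x + u x) = 0" by simp
    qed
  next
    case (seq U)
    show ?case
    proof (intro impI)
      assume "\<exists>K. \<forall>x. g x \<le> K"
      then obtain K where K: "\<And>x. g x \<le> K" by blast
      have Ug: "U i x \<le> g x" for i x
        using seq by (intro incseq_le) (auto simp: incseq_def le_fun_def)
      have "weighted_integral L (U i) = 0" for i
        using seq.IH[of i] Ug[of i] K order_trans by blast
      moreover have "(\<lambda>n. weighted_integral L (U n)) \<longlonglongrightarrow> weighted_integral L g"
      proof (rule weighted_integral_tendsto[OF L, where S = UNIV and K = K])
        show "\<bar>U n x\<bar> \<le> K" for n x using seq(2)[of n x] Ug[of n x] K[of x] by linarith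
      qed (use seq g in auto)
      ultimately show "weighted_integral L g = 0" by (simp add: LIMSEQ_const_iff)
    qed
  qed
  obtain K where K: "\<And>x. \<bar>f x\<bar> \<le> K" using f by (auto simp: bdd_borel_def)
  have "weighted_integral L (\<lambda>x. f x + K) = 0"
  proof (rule nn[rule_format])
    show "0 \<le> f x + K" for x using K[of x] by linarith
    have "f x + K \<le> 2 * K" for x using K[of x] by linarith
    then show "\<exists>K'. \<forall>x. f x + K \<le> K'" by blast
  qed (use f bdd_borel_measurable in auto)
  moreover have "weighted_integral L (\<lambda>x. f x + K) = weighted_integral L f + weighted_integral L (\<lambda>x. K)"
    by (intro weighted_integral_add[OF L f] bdd_borel_const)
  moreover have "weighted_integral L (\<lambda>x. K) = 0"
    using S[of UNIV] weighted_integral_cmult[of L K "indicator UNIV"] by (simp add: indicator_def)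
  ultimately show ?thesis by simp
qed

lemma indicator_UN_Suc:
  assumes "disjoint_family F"
  shows "indicator (\<Union>i<Suc n. F i) = (\<lambda>x. indicator (\<Union>i<n. F i) x + indicator (F n) x :: real)"
proof -
  have "F i \<inter> F n = {}" if "i < n" for i
    using disjoint_family_onD[OF assms, of i n] that by simp
  then have "(\<Union>i<n. F i) \<inter> F n = {}" by blast
  then show ?thesis by (intro ext) (auto simp: indicator_def lessThan_Suc)
qed

text \<open>Determinacy of the moment problem on the unit interval, for signed measures: Bernstein
  polynomials reach the continuous functions, ramps reach the half-lines, and the pi-lambda argument
  reaches all Borel sets.\<close>

lemma weighted_integral_eq_0_if_poly:
  assumes L: "weighted_measures L"
    and supp: "\<And>M w. (M, w) \<in> set L \<Longrightarrow> AE x in M. x \<in> {0..1}"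
    and P: "\<And>p. weighted_integral L (poly p) = 0"
    and f: "bdd_borel f"
  shows "weighted_integral L f = 0"
proof (rule weighted_integral_eq_0[OF L _ f])
  have cont: "weighted_integral L f = 0" if f: "continuous_on UNIV f" for f
  proof -
    define p where "p n = (\<Sum>k\<le>n. smult (f (k / n) * (n choose k)) ([:0, 1:] ^ k * [:1, -1:] ^ (n - k)))" for n
    have p: "poly (p n) x = (\<Sum>k\<le>n. f (k / n) * Bernstein n k x)" for n x
      by (simp add: p_def poly_sum Bernstein_def mult_ac)
    have meas: "poly (p n) \<in> borel_measurable borel" for n
      by (intro borel_measurable_continuous_onI) (simp add: continuous_on_poly)
    have f01: "continuous_on {0..1} f" using f continuous_on_subset by blast
    have ul: "\<exists>N. \<forall>n x. N \<le> n \<and> x \<in> {0..1} \<longrightarrow> \<bar>f x - poly (p n) x\<bar> < e" if "0 < e" for e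
      unfolding p by (rule Bernstein_Weierstrass[OF f01 that])
    have lim: "(\<lambda>n. poly (p n) x) \<longlonglongrightarrow> f x" if x: "x \<in> {0..1}" for x
    proof (rule LIMSEQ_I)
      fix e :: real assume "0 < e"
      from ul[OF this] show "\<exists>N. \<forall>n\<ge>N. norm (poly (p n) x - f x) < e"
        using x by (metis abs_minus_commute real_norm_def)
    qed
    obtain C where C: "\<And>x. x \<in> {0..1} \<Longrightarrow> \<bar>f x\<bar> \<le> C"
      using compact_continuous_image[OF f01 compact_Icc] compact_imp_bounded
      by (metis bounded_iff imageI real_norm_def)
    \<comment> \<open>On the unit interval the Bernstein polynomials are nonnegative and sum to 1,
      so the approximant is an average of values of \<open>f\<close>.\<close>
    have bd: "\<bar>poly (p n) x\<bar> \<le> C" if x: "x \<in> {0..1}" for n x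
    proof -
      have "\<bar>poly (p n) x\<bar> \<le> (\<Sum>k\<le>n. C * Bernstein n k x)"
        unfolding p
      proof (rule order_trans[OF sum_abs], rule sum_mono)
        fix k assume "k \<in> {..n}"
        then have "real k / real n \<in> {0..1}" by (auto simp: divide_le_eq_1)
        then show "\<bar>f (real k / real n) * Bernstein n k x\<bar> \<le> C * Bernstein n k x"
          using x C by (simp add: abs_mult Bernstein_nonneg mult_right_mono)
      qed
      also have "\<dots> = C" by (simp flip: sum_distrib_left)
      finally show ?thesis .
    qed
    have "(\<lambda>n. weighted_integral L (poly (p n))) \<longlonglongrightarrow> weighted_integral L f"
      by (rule weighted_integral_tendsto[OF L _ _ supp bd lim])
        (auto intro: borel_measurable_continuous_onI f meas)
    then show ?thesis by (simp add: P LIMSEQ_const_iff)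
  qed
  have half: "weighted_integral L (indicator {..a}) = 0" for a
  proof -
    \<comment> \<open>Continuous ramps equal to 1 up to \<open>a\<close> and falling to 0 with slope
      \<open>-n\<close>; they converge pointwise to the indicator, with value 1 at \<open>a\<close>
      itself.\<close>
    have "(\<lambda>n. weighted_integral L (\<lambda>x. max 0 (min 1 (1 - real n * (x - a))))) \<longlonglongrightarrow> weighted_integral L (indicator {..a})"
    proof (rule weighted_integral_tendsto[OF L, where S = UNIV and K = 1])
      show "(\<lambda>n. max 0 (min 1 (1 - real n * (x - a)))) \<longlonglongrightarrow> indicator {..a} x" for x
      proof (cases "x \<le> a")
        case True
        then have "max 0 (min 1 (1 - real n * (x - a))) = 1" for n
          by (simp add: mult_nonneg_nonpos)
        then show ?thesis using True by simp
      next
        case False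
        then have "0 < x - a" by simp
        then obtain N where N: "1 < real N * (x - a)" using ex_less_of_nat_mult by blast
        have "max 0 (min 1 (1 - real n * (x - a))) = 0" if "n \<ge> N" for n
        proof -
          have "real N * (x - a) \<le> real n * (x - a)" using that False by (intro mult_right_mono) auto
          then show ?thesis using N by auto
        qed
        then have "\<forall>\<^sub>F n in sequentially. max 0 (min 1 (1 - real n * (x - a))) = indicator {..a} x"
          using False unfolding eventually_sequentially by (intro exI[of _ N]) auto
        then show ?thesis by (rule tendsto_eventually)
      qed
    qed auto
    moreover have "weighted_integral L (\<lambda>x. max 0 (min 1 (1 - real n * (x - a)))) = 0" for n
      by (intro cont continuous_intros)
    ultimately show ?thesis by (simp add: LIMSEQ_const_iff)
  qed
  have one: "weighted_integral L (\<lambda>x. 1) = 0" by (intro cont continuous_intros)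
  have bs: "sets borel = sigma_sets UNIV (range (atMost :: real \<Rightarrow> _))"
    by (subst borel_eq_atMost) (simp add: sets_measure_of_conv)
  fix S :: "real set" assume "S \<in> sets borel"
  then have "S \<in> sigma_sets UNIV (range atMost)" by (simp only: bs)
  have "Int_stable (range (atMost :: real \<Rightarrow> _))" by (auto simp: Int_stable_def)
  moreover have "range atMost \<subseteq> Pow (UNIV :: real set)" by simp
  ultimately show "weighted_integral L (indicator S) = 0"
    using \<open>S \<in> sigma_sets UNIV (range atMost)\<close>
  proof (induction rule: sigma_sets_induct_disjoint)
    case (basic A)
    then show ?case using half by auto
  next
    case empty
    show ?case by (simp add: weighted_integral_def indicator_def case_prod_unfold)
  next
    case (compl A)
    then have A: "A \<in> sets borel" by (simp only: bs)
    have "weighted_integral L (\<lambda>x. indicator A x + indicator (UNIV - A) x)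
        = weighted_integral L (indicator A) + weighted_integral L (indicator (UNIV - A))"
      using A by (intro weighted_integral_add[OF L] bdd_borel_indicator) auto
    moreover have "(\<lambda>x. indicator A x + indicator (UNIV - A) x) = (\<lambda>x. 1::real)"
      by (auto simp: indicator_def)
    ultimately show ?case using one compl by simp
  next
    case (union A)
    then have A: "A i \<in> sets borel" for i unfolding bs by blast
    have fin: "weighted_integral L (indicator (\<Union>i<n. A i)) = 0" for n
    proof (induction n)
      case 0
      show ?case by (simp add: weighted_integral_def indicator_def case_prod_unfold)
    next
      case (Suc n)
      have "weighted_integral L (\<lambda>x. indicator (\<Union>i<n. A i) x + indicator (A n) x)
        = weighted_integral L (indicator (\<Union>i<n. A i)) + weighted_integral L (indicator (A n))"
        using A by (intro weighted_integral_add[OF L] bdd_borel_indicator) auto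
      then show ?case using Suc union(3) by (simp only: indicator_UN_Suc[OF union(1)])
    qed
    have "(\<lambda>n. weighted_integral L (indicator (\<Union>i<n. A i))) \<longlonglongrightarrow> weighted_integral L (indicator (\<Union>i. A i))"
    proof (rule weighted_integral_tendsto[OF L, where S = UNIV and K = 1])
      show "(\<lambda>n. indicator (\<Union>i<n. A i) x :: real) \<longlonglongrightarrow> indicator (\<Union>i. A i) x" for x
        by (rule LIMSEQ_indicator_UN)
      show "\<bar>indicator (\<Union>i<n. A i) x :: real\<bar> \<le> 1" for n x by (simp add: indicator_def)
      show "indicator (\<Union>i<n. A i) \<in> borel_measurable borel" for n using A by measurable
      show "indicator (\<Union>i. A i) \<in> borel_measurable borel" using A by measurable
    qed simp
    then show ?case by (simp add: fin LIMSEQ_const_iff)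
  qed
qed

subsection \<open>Functional calculus of a projection-valued measure\<close>

lemma tendsto_if_norm_sq: "(\<lambda>n. (norm (f n - l))\<^sup>2) \<longlonglongrightarrow> 0 \<Longrightarrow> f \<longlonglongrightarrow> l"
proof -
  assume "(\<lambda>n. (norm (f n - l))\<^sup>2) \<longlonglongrightarrow> 0"
  then have "(\<lambda>n. sqrt ((norm (f n - l))\<^sup>2)) \<longlonglongrightarrow> sqrt 0" by (rule tendsto_real_sqrt)
  then have "(\<lambda>n. norm (f n - l)) \<longlonglongrightarrow> 0" by simp
  then show "f \<longlonglongrightarrow> l" by (simp add: Lim_null[of f] tendsto_norm_zero_iff)
qed

lemma tendsto_diff_sq_0: "(f \<longlongrightarrow> l) F \<Longrightarrow> ((\<lambda>n. (f n - l)\<^sup>2) \<longlongrightarrow> 0) F"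
  for l :: real
  using tendsto_power[of "\<lambda>n. f n - l" 0 F 2] by (simp add: LIM_zero)

lemma eq_if_inner_eq: "(\<And>y. inner u y = inner v y) \<Longrightarrow> u = v"
  for u v :: "'a::real_inner"
  using inner_eq_zero_iff[of "u - v"] by (simp add: inner_diff_left)

abbreviation cutoff :: "(real \<Rightarrow> real) \<Rightarrow> nat \<Rightarrow> real \<Rightarrow> real" where
  "cutoff f n \<equiv> indicator {l. \<bar>f l\<bar> \<le> real n}"

text \<open>Large values are replaced by 0 and not by \<open>n\<close>, so that truncation is
  multiplication by \<open>cutoff f n\<close> and corresponds to a spectral projection.\<close>

definition trunc :: "(real \<Rightarrow> real) \<Rightarrow> nat \<Rightarrow> real \<Rightarrow> real" where
  "trunc f n l = cutoff f n l * f l"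

lemma bdd_borel_cutoff: "f \<in> borel_measurable borel \<Longrightarrow> bdd_borel (cutoff f n)"
  by (intro bdd_borel_indicator) measurable

lemma bdd_borel_truncate:
  assumes f: "f \<in> borel_measurable borel" shows "bdd_borel (trunc f n)"
proof (rule bdd_borelI)
  show "trunc f n \<in> borel_measurable borel" unfolding trunc_def using f by measurable
  show "\<bar>trunc f n x\<bar> \<le> real n" for x by (auto simp: trunc_def indicator_def)
qed

lemma tendsto_indicator_abs_le: "(\<lambda>n. cutoff f n x :: real) \<longlonglongrightarrow> 1"
proof -
  obtain N where "\<bar>f x\<bar> \<le> real N" using real_arch_simple by blast
  then have "\<forall>\<^sub>F n in sequentially. cutoff f n x = (1 :: real)"
    unfolding eventually_sequentially by (intro exI[of _ N]) auto
  then show ?thesis by (rule tendsto_eventually)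
qed

lemma truncate_tendsto: "(\<lambda>n. trunc f n x) \<longlonglongrightarrow> f x"
  using tendsto_mult[OF tendsto_indicator_abs_le[of f x] tendsto_const[of "f x"]]
  by (simp add: trunc_def)

lemma weighted_integral_append:
  "weighted_integral (L @ L') f = weighted_integral L f + weighted_integral L' f"
  by (simp add: weighted_integral_def)

lemma weighted_measures_append:
  "weighted_measures (L @ L') \<longleftrightarrow> weighted_measures L \<and> weighted_measures L'"
  by (simp add: weighted_measures_def ball_Un)

text \<open>
  A family of measures \<open>\<mu> x\<close> that behaves like a quadratic form in \<open>x\<close> when tested against
  sufficiently many functions \<open>t i\<close>, for which the operators \<open>T i = t i(A)\<close> are already known.
\<close>
locale spectral_form =
  fixes \<mu> :: "'a::{real_inner, complete_space} \<Rightarrow> real measure"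
    and t :: "'i \<Rightarrow> real \<Rightarrow> real" and T :: "'i \<Rightarrow> 'a \<Rightarrow> 'a" and I :: "'i set"
  assumes finite_measure_\<mu>: "finite_measure (\<mu> x)"
    and sets_\<mu> [simp, measurable_cong]: "sets (\<mu> x) = sets borel"
    and bdd_borel_test: "i \<in> I \<Longrightarrow> bdd_borel (t i)"
    and bounded_linear_test: "i \<in> I \<Longrightarrow> bounded_linear (T i)"
    and sym_test: "i \<in> I \<Longrightarrow> inner (T i x) y = inner x (T i y)"
    and integral_test: "i \<in> I \<Longrightarrow> integral\<^sup>L (\<mu> x) (t i) = inner (T i x) x"
    and mult_test: "i \<in> I \<Longrightarrow> j \<in> I \<Longrightarrow> \<exists>k\<in>I. t k = (\<lambda>l. t i l * t j l) \<and> T k = (\<lambda>x. T i (T j x))"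
    and one_test: "\<exists>i\<in>I. t i = (\<lambda>l. 1) \<and> T i = (\<lambda>x. x)"
    and test_determines: "weighted_measures L \<Longrightarrow> fst ` set L \<subseteq> range \<mu> \<Longrightarrow>
      (\<And>i. i \<in> I \<Longrightarrow> weighted_integral L (t i) = 0) \<Longrightarrow> bdd_borel f \<Longrightarrow> weighted_integral L f = 0"
begin

lemma space_\<mu> [simp]: "space (\<mu> x) = UNIV"
  using sets_eq_imp_space_eq[OF sets_\<mu>] by simp

lemma borel_measurable_\<mu> [simp]: "borel_measurable (\<mu> x) = borel_measurable borel"
  by (rule measurable_cong_sets) auto

lemma measure_UNIV_\<mu> [simp]: "measure (\<mu> x) UNIV = (norm x)\<^sup>2"
proof -
  obtain i where "i \<in> I" "t i = (\<lambda>l. 1)" "T i = (\<lambda>x. x)" using one_test by blast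
  with integral_test[of i x] show ?thesis by (simp add: power2_norm_eq_inner)
qed

lemma integrable_\<mu>: "bdd_borel f \<Longrightarrow> integrable (\<mu> x) f"
  by (intro integrable_bdd_borel finite_measure_\<mu>) auto

definition polar :: "(real \<Rightarrow> real) \<Rightarrow> 'a \<Rightarrow> 'a \<Rightarrow> real" where
  "polar f x y = (integral\<^sup>L (\<mu> (x + y)) f - integral\<^sup>L (\<mu> (x - y)) f) / 4"

lemma polar_test: assumes i: "i \<in> I" shows "polar (t i) x y = inner (T i x) y"
proof -
  interpret bounded_linear "T i" using i by (rule bounded_linear_test)
  have "inner (T i y) x = inner (T i x) y" using sym_test[OF i, of y x] by (simp add: inner_commute)
  then show ?thesis unfolding polar_def integral_test[OF i]
    by (simp add: add diff inner_add_left inner_add_right inner_diff_left inner_diff_right)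
qed

text \<open>The signed measure \<open>c w \<langle>x, E y\<rangle>\<close>.\<close>
definition polar_list :: "real \<Rightarrow> (real \<Rightarrow> real) \<Rightarrow> 'a \<Rightarrow> 'a \<Rightarrow> (real measure \<times> (real \<Rightarrow> real)) list" where
  "polar_list c w x y = [(\<mu> (x + y), \<lambda>l. c / 4 * w l), (\<mu> (x - y), \<lambda>l. - c / 4 * w l)]"

lemma set_polar_list: "fst ` set (polar_list c w x y) \<subseteq> range \<mu>"
  by (simp add: polar_list_def)

lemma weighted_integral_polar_list:
  "weighted_integral (polar_list c w x y) f = c * polar (\<lambda>l. w l * f l) x y"
proof -
  have "(\<integral>l. c / 4 * w l * f l \<partial>M) = c / 4 * (\<integral>l. w l * f l \<partial>M)"
    "(\<integral>l. - (c * w l * f l) / 4 \<partial>M) = - c / 4 * (\<integral>l. w l * f l \<partial>M)" for M :: "real measure"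
    using integral_mult_right_zero[of M "c/4" "\<lambda>l. w l * f l"]
      integral_mult_right_zero[of M "- c/4" "\<lambda>l. w l * f l"] by (simp_all add: mult.assoc)
  then show ?thesis by (simp add: weighted_integral_def polar_list_def polar_def field_simps)
qed

lemma weighted_measures_polar_list:
  assumes "bdd_borel w" shows "weighted_measures (polar_list c w x y)"
proof -
  have "bdd_borel (\<lambda>l. c / 4 * w l)" for c
    by (rule bdd_borel_mult[OF bdd_borel_const assms])
  from this[of c] this[of "-c"] show ?thesis
    unfolding weighted_measures_def polar_list_def
    by (simp add: finite_measure_\<mu> del: times_divide_eq_left)
qed

lemmas polar_list_integral = weighted_integral_append weighted_integral_polar_list
lemmas polar_list_wf = weighted_measures_append weighted_measures_polar_list set_polar_list image_Un

text \<open>The pattern of this and the following identities: the difference of both sides is the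
  integral of \<open>f\<close> against a list of measures. On the test functions it vanishes by the
  known algebra of the operators \<open>T i\<close>, and \<open>test_determines\<close> extends this
  to every bounded Borel \<open>f\<close>.\<close>

lemma polar_commute: assumes f: "bdd_borel f" shows "polar f x y = polar f y x"
proof -
  let ?L = "polar_list 1 (\<lambda>x. 1) x y @ polar_list (-1) (\<lambda>x. 1) y x"
  have "weighted_integral ?L f = 0"
  proof (rule test_determines[OF _ _ _ f])
    fix i assume i: "i \<in> I"
    show "weighted_integral ?L (t i) = 0"
      using sym_test[OF i, of x y]
      by (simp add: polar_list_integral polar_test i inner_commute)
  qed (auto simp: polar_list_wf)
  then show ?thesis by (simp add: polar_list_integral)
qed

lemma polar_add_left: 
  assumes f: "bdd_borel f" shows "polar f (x + x') y = polar f x y + polar f x' y"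
proof -
  let ?L = "polar_list 1 (\<lambda>x. 1) (x + x') y @ polar_list (-1) (\<lambda>x. 1) x y @ polar_list (-1) (\<lambda>x. 1) x' y"
  have "weighted_integral ?L f = 0"
  proof (rule test_determines[OF _ _ _ f])
    fix i assume i: "i \<in> I"
    interpret bounded_linear "T i" using i by (rule bounded_linear_test)
    show "weighted_integral ?L (t i) = 0"
      using i by (simp add: polar_list_integral polar_test
          add inner_add_left)
  qed (auto simp: polar_list_wf)
  then show ?thesis by (simp add: polar_list_integral)
qed

lemma polar_scaleR_left:
  assumes f: "bdd_borel f" shows "polar f (c *\<^sub>R x) y = c * polar f x y"
proof -
  let ?L = "polar_list 1 (\<lambda>x. 1) (c *\<^sub>R x) y @ polar_list (-c) (\<lambda>x. 1) x y"
  have "weighted_integral ?L f = 0"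
  proof (rule test_determines[OF _ _ _ f])
    fix i assume i: "i \<in> I"
    interpret bounded_linear "T i" using i by (rule bounded_linear_test)
    show "weighted_integral ?L (t i) = 0"
      using i by (simp add: polar_list_integral polar_test
          scaleR)
  qed (auto simp: polar_list_wf)
  then show ?thesis by (simp add: polar_list_integral)
qed

text \<open>By definition \<open>polar f x x\<close> involves \<mu> at \<open>x + x\<close> and at
  0. Homogeneity of \<mu> is not among the locale assumptions and has to be read off from the test
  functions.\<close>

lemma polar_self: assumes f: "bdd_borel f" shows "polar f x x = integral\<^sup>L (\<mu> x) f"
proof -
  let ?L = "polar_list 1 (\<lambda>x. 1) x x @ [(\<mu> x, \<lambda>x. -1)]"
  have "weighted_integral ?L f = 0"
  proof (rule test_determines[OF _ _ _ f])
    fix i assume i: "i \<in> I"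
    have "weighted_integral [(\<mu> x, \<lambda>x. -1)] (t i) = - integral\<^sup>L (\<mu> x) (t i)"
      by (simp add: weighted_integral_def)
    then show "weighted_integral ?L (t i) = 0"
      using i by (simp add: polar_list_integral polar_test integral_test)
  next
    have "weighted_measures [(\<mu> x, \<lambda>x. -1)]" 
      by (auto simp: weighted_measures_def finite_measure_\<mu>)
    then show "weighted_measures ?L"
      by (simp add: polar_list_wf)
  qed (simp add: set_polar_list image_Un)
  then show ?thesis
    by (simp add: polar_list_integral)
      (simp add: weighted_integral_def)
qed

lemma abs_integral_\<mu>_le:
  assumes f: "bdd_borel f" "\<And>l. \<bar>f l\<bar> \<le> K" shows "\<bar>integral\<^sup>L (\<mu> x) f\<bar> \<le> K * (norm x)\<^sup>2"
proof -
  interpret finite_measure "\<mu> x" by (rule finite_measure_\<mu>)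
  have "\<bar>integral\<^sup>L (\<mu> x) f\<bar> \<le> integral\<^sup>L (\<mu> x) (\<lambda>l. \<bar>f l\<bar>)" by (rule integral_abs_bound)
  also have "\<dots> \<le> integral\<^sup>L (\<mu> x) (\<lambda>_. K)"
    by (rule integral_mono) (use f integrable_\<mu> in auto)
  finally have "\<bar>integral\<^sup>L (\<mu> x) f\<bar> \<le> integral\<^sup>L (\<mu> x) (\<lambda>_. K)" .
  then show ?thesis by (simp add: mult.commute)
qed

lemma bounded_bilinear_polar:
  assumes f: "bdd_borel f" shows "bounded_bilinear (polar f)"
proof
  show add: "polar f (a + a') b = polar f a b + polar f a' b"
    and scale: "polar f (r *\<^sub>R a) b = r *\<^sub>R polar f a b" for a a' b r
    using polar_add_left[OF f] polar_scaleR_left[OF f] by simp_all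
  show add': "polar f a (b + b') = polar f a b + polar f a b'"
    and scale': "polar f a (r *\<^sub>R b) = r *\<^sub>R polar f a b" for a b' b r
    unfolding polar_commute[OF f, of a] by (rule add, rule scale)
  obtain K where K: "\<And>l. \<bar>f l\<bar> \<le> K" using f by (auto simp: bdd_borel_def)
  have "norm (polar f a b) \<le> norm a * norm b * K" for a b
  proof (cases "a = 0 \<or> b = 0")
    case True
    then show ?thesis using scale[of 0 a b] scale'[of a 0 b] by auto
  next
    case False
    \<comment> \<open>Polarization bounds the form only by K (|a|^2 + |b|^2) / 2. Rescaling to unit
      vectors turns this into the product bound with the same \<open>K\<close>.\<close>
    define a' b' where "a' = (1 / norm a) *\<^sub>R a" and "b' = (1 / norm b) *\<^sub>R b"
    have n: "norm a' = 1" "norm b' = 1" using False by (auto simp: a'_def b'_def)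
    have a: "a = norm a *\<^sub>R a'" and b: "b = norm b *\<^sub>R b'" using False by (auto simp: a'_def b'_def)
    have "\<bar>polar f a' b'\<bar> \<le> (\<bar>integral\<^sup>L (\<mu> (a' + b')) f\<bar> + \<bar>integral\<^sup>L (\<mu> (a' - b')) f\<bar>) / 4"
      unfolding polar_def by (simp add: abs_triangle_ineq4)
    also have "\<dots> \<le> (K * (norm (a' + b'))\<^sup>2 + K * (norm (a' - b'))\<^sup>2) / 4"
      using abs_integral_\<mu>_le[OF f K, of "a' + b'"] abs_integral_\<mu>_le[OF f K, of "a' - b'"] by simp
    also have "\<dots> = K * ((norm (a' + b'))\<^sup>2 + (norm (a' - b'))\<^sup>2) / 4" by (simp add: distrib_left)
    also have "(norm (a' + b'))\<^sup>2 + (norm (a' - b'))\<^sup>2 = 2 * (norm a')\<^sup>2 + 2 * (norm b')\<^sup>2"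
      by (simp add: power2_norm_eq_inner inner_add_left inner_add_right inner_diff_left inner_diff_right)
    finally have "\<bar>polar f a' b'\<bar> \<le> K" by (simp add: n)
    moreover have "polar f a b = norm a * norm b * polar f a' b'"
      by (subst a, subst b) (simp add: scale scale' del: scaleR_eq_0_iff)
    ultimately show ?thesis by (simp add: abs_mult mult_left_mono)
  qed
  then show "\<exists>K. \<forall>a b. norm (polar f a b) \<le> norm a * norm b * K" by blast
qed

definition bfun :: "(real \<Rightarrow> real) \<Rightarrow> 'a \<Rightarrow> 'a" where
  "bfun f = (SOME T. bounded_linear T \<and> (\<forall>x y. inner (T x) y = polar f x y))"

lemma bfun: assumes "bdd_borel f"
  shows bounded_linear_bfun: "bounded_linear (bfun f)" and inner_bfun: "inner (bfun f x) y = polar f x y"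
proof -
  have "\<exists>T. bounded_linear T \<and> (\<forall>x y. inner (T x) y = polar f x y)"
    using bounded_form_operator[OF bounded_bilinear_polar[OF assms]] by metis
  from someI_ex[OF this] show "bounded_linear (bfun f)" "inner (bfun f x) y = polar f x y"
    unfolding bfun_def by blast+
qed

lemma bfun_sym: "bdd_borel f \<Longrightarrow> inner (bfun f x) y = inner x (bfun f y)"
  using inner_bfun[of f x y] inner_bfun[of f y x] polar_commute[of f x y] by (simp add: inner_commute)

lemma inner_bfun_self: "bdd_borel f \<Longrightarrow> inner (bfun f x) x = integral\<^sup>L (\<mu> x) f"
  by (simp add: inner_bfun polar_self)

lemma bfun_test: "i \<in> I \<Longrightarrow> bfun (t i) x = T i x"
  by (rule eq_if_inner_eq) (simp add: inner_bfun polar_test bdd_borel_test)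

lemma bfun_one [simp]: "bfun (\<lambda>l. 1) x = x"
  using bfun_test one_test by fastforce

text \<open>Multiplicativity is bootstrapped: here one factor is a test function, and in
  \<open>bfun_bfun\<close> this case verifies the general identity on test functions.\<close>

lemma polar_test_left:
  assumes f: "bdd_borel f" and j: "j \<in> I"
  shows "polar f (T j x) y = polar (\<lambda>l. t j l * f l) x y"
proof -
  let ?L = "polar_list 1 (\<lambda>x. 1) (T j x) y @ polar_list (-1) (t j) x y"
  have "weighted_integral ?L f = 0"
  proof (rule test_determines[OF _ _ _ f])
    fix i assume i: "i \<in> I"
    obtain k where k: "k \<in> I" "t k = (\<lambda>l. t i l * t j l)" "T k = (\<lambda>x. T i (T j x))"
      using mult_test[OF i j] by blast
    have "(\<lambda>l. t j l * t i l) = t k" by (simp add: k(2) mult.commute)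
    then show "weighted_integral ?L (t i) = 0"
      using i k by (simp add: polar_list_integral polar_test)
        (simp add: polar_test[OF k(1), unfolded k(2,3)])
  qed (use j bdd_borel_test in \<open>auto simp: polar_list_wf\<close>)
  then show ?thesis by (simp add: polar_list_integral)
qed

lemma bfun_add: "bdd_borel f \<Longrightarrow> bdd_borel g \<Longrightarrow> bfun (\<lambda>l. f l + g l) x = bfun f x + bfun g x"
  by (rule eq_if_inner_eq)
    (simp add: inner_bfun bdd_borel_add inner_add_left polar_def integrable_\<mu> add_divide_distrib
       diff_divide_distrib)

lemma bfun_cmult: "bdd_borel f \<Longrightarrow> bfun (\<lambda>l. c * f l) x = c *\<^sub>R bfun f x"
  by (rule eq_if_inner_eq)
    (simp add: inner_bfun bdd_borel_mult polar_def integrable_\<mu> right_diff_distrib)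

lemma bfun_diff:
  assumes f: "bdd_borel f" and g: "bdd_borel g"
  shows "bfun (\<lambda>l. f l - g l) x = bfun f x - bfun g x"
proof -
  have "bfun (\<lambda>l. f l + (-1) * g l) x = bfun f x + bfun (\<lambda>l. (-1) * g l) x"
    by (rule bfun_add[OF f bdd_borel_mult[OF bdd_borel_const g]])
  then show ?thesis unfolding bfun_cmult[OF g] by simp
qed

lemma bfun_bfun:
  assumes f: "bdd_borel f" and g: "bdd_borel g"
  shows "bfun f (bfun g x) = bfun (\<lambda>l. f l * g l) x"
proof (rule eq_if_inner_eq)
  fix y
  let ?L = "polar_list 1 (\<lambda>x. 1) (bfun g x) y @ polar_list (-1) g x y"
  have "weighted_integral ?L f = 0"
  proof (rule test_determines[OF _ _ _ f])
    fix i assume i: "i \<in> I"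
    have "inner (T i (bfun g x)) y = inner (bfun g x) (T i y)" using i by (rule sym_test)
    also have "\<dots> = inner x (bfun g (T i y))" using g by (rule bfun_sym)
    also have "\<dots> = inner (bfun g (T i y)) x" by (rule inner_commute)
    also have "\<dots> = polar (\<lambda>l. t i l * g l) y x"
      using g i by (simp add: inner_bfun polar_test_left)
    also have "\<dots> = polar (\<lambda>l. g l * t i l) x y"
      using polar_commute[of "\<lambda>l. t i l * g l"] g i bdd_borel_test by (auto simp: mult.commute)
    finally show "weighted_integral ?L (t i) = 0"
      using i by (simp add: polar_list_integral polar_test)
  qed (use g in \<open>auto simp: polar_list_wf\<close>)
  then show "inner (bfun f (bfun g x)) y = inner (bfun (\<lambda>l. f l * g l) x) y"
    using f g by (simp add: polar_list_integral inner_bfun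
        bdd_borel_mult mult.commute)
qed

lemma norm_bfun_sq: 
  assumes f: "bdd_borel f" shows "(norm (bfun f x))\<^sup>2 = (\<integral>l. (f l)\<^sup>2 \<partial>\<mu> x)"
proof -
  have "(norm (bfun f x))\<^sup>2 = inner (bfun f (bfun f x)) x"
    using f by (simp add: power2_norm_eq_inner bfun_sym)
  also have "\<dots> = (\<integral>l. (f l)\<^sup>2 \<partial>\<mu> x)"
    using f by (simp add: bfun_bfun inner_bfun_self bdd_borel_mult power2_eq_square)
  finally show ?thesis .
qed

text \<open>Strong convergence, since the squared norm of the difference is the integral of
  \<open>(f n l - g l)^2\<close> against \<mu> x, where dominated convergence applies.\<close>

lemma bfun_tendsto:
  assumes f: "\<And>n. f n \<in> borel_measurable borel" "\<And>n l. \<bar>f n l\<bar> \<le> K" and g: "g \<in> borel_measurable borel"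
    and lim: "\<And>l. (\<lambda>n. f n l) \<longlonglongrightarrow> g l"
  shows "(\<lambda>n. bfun (f n) x) \<longlonglongrightarrow> bfun g x"
proof (rule tendsto_if_norm_sq)
  have gK: "\<bar>g l\<bar> \<le> K" for l
    by (rule LIMSEQ_le_const2[OF tendsto_rabs[OF lim]]) (use f in auto)
  have bf: "bdd_borel (f n)" for n by (rule bdd_borelI[OF f])
  have bg: "bdd_borel g" by (rule bdd_borelI[OF g gK])
  interpret finite_measure "\<mu> x" by (rule finite_measure_\<mu>)
  have "(\<lambda>n. \<integral>l. (f n l - g l)\<^sup>2 \<partial>\<mu> x) \<longlonglongrightarrow> (\<integral>l. 0 \<partial>\<mu> x)"
  proof (rule integral_dominated_convergence)
    show "integrable (\<mu> x) (\<lambda>l. (K + K)\<^sup>2)" by simp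
    show "AE l in \<mu> x. norm ((f n l - g l)\<^sup>2) \<le> (K + K)\<^sup>2" for n
    proof (rule AE_I2)
      fix l
      have "\<bar>f n l - g l\<bar> \<le> K + K" using f(2)[of n l] gK[of l] by linarith
      then have "\<bar>f n l - g l\<bar>\<^sup>2 \<le> (K + K)\<^sup>2" by (intro power_mono) auto
      then show "norm ((f n l - g l)\<^sup>2) \<le> (K + K)\<^sup>2" by simp
    qed
    show "AE l in \<mu> x. (\<lambda>n. (f n l - g l)\<^sup>2) \<longlonglongrightarrow> 0"
      by (intro always_eventually allI tendsto_diff_sq_0 lim)
  qed (use f g in auto)
  moreover have "(norm (bfun (f n) x - bfun g x))\<^sup>2 = (\<integral>l. (f n l - g l)\<^sup>2 \<partial>\<mu> x)" for n
    using bf bg by (simp add: bfun_diff[symmetric] norm_bfun_sq bdd_borel_diff)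
  ultimately show "(\<lambda>n. (norm (bfun (f n) x - bfun g x))\<^sup>2) \<longlonglongrightarrow> 0" by simp
qed


lemma bfun_bounded_linear_simps:
  assumes "bdd_borel f"
  shows bfun_vadd: "bfun f (x + y) = bfun f x + bfun f y"
    and bfun_vdiff: "bfun f (x - y) = bfun f x - bfun f y"
    and bfun_scaleR: "bfun f (c *\<^sub>R x) = c *\<^sub>R bfun f x"
proof -
  interpret bounded_linear "bfun f" using assms by (rule bounded_linear_bfun)
  show "bfun f (x + y) = bfun f x + bfun f y" "bfun f (x - y) = bfun f x - bfun f y"
    "bfun f (c *\<^sub>R x) = c *\<^sub>R bfun f x"
    by (simp_all add: add diff scaleR)
qed

end

section \<open>Projection-valued measures and unbounded functions\<close>

locale pvm =
  fixes E :: "real set \<Rightarrow> 'a::{real_inner, complete_space} \<Rightarrow> 'a"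
  assumes pvm: "proj_valued_measure E"
begin

lemma bounded_linear_E: "S \<in> sets borel \<Longrightarrow> bounded_linear (E S)"
  and E_idem: "S \<in> sets borel \<Longrightarrow> E S (E S x) = E S x"
  and E_sym: "S \<in> sets borel \<Longrightarrow> inner (E S x) y = inner x (E S y)"
  and E_UNIV [simp]: "E UNIV x = x"
  and E_Int: "S \<in> sets borel \<Longrightarrow> S' \<in> sets borel \<Longrightarrow> E (S \<inter> S') x = E S (E S' x)"
  and E_sums: "range F \<subseteq> sets borel \<Longrightarrow> disjoint_family F \<Longrightarrow> (\<lambda>i::nat. E (F i) x) sums E (\<Union>i. F i) x"
  using pvm unfolding proj_valued_measure_def by blast+

lemma inner_E: "S \<in> sets borel \<Longrightarrow> inner x (E S x) = (norm (E S x))\<^sup>2"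
  by (metis E_idem E_sym power2_norm_eq_inner)

lemma E_empty [simp]: "E {} x = 0"
proof -
  have "(\<lambda>i::nat. E {} x) sums E {} x"
    using E_sums[of "\<lambda>i. {}" x] by (simp add: disjoint_family_on_def)
  then have "(\<lambda>i::nat. E {} x) \<longlonglongrightarrow> 0" by (intro summable_LIMSEQ_zero) (auto simp: summable_def)
  then show ?thesis by (simp add: LIMSEQ_const_iff)
qed

lemma sets_scalar [simp]: "sets (scalar_measure E x) = sets borel"
  using sets.sigma_sets_eq[of borel] by (simp add: scalar_measure_def)

lemma space_scalar [simp]: "space (scalar_measure E x) = UNIV"
  by (simp add: scalar_measure_def)

lemma emeasure_scalar: assumes "S \<in> sets borel" shows "emeasure (scalar_measure E x) S = ennreal ((norm (E S x))\<^sup>2)"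
proof -
  have "emeasure (scalar_measure E x) S = ennreal (inner x (E S x))"
  proof (rule emeasure_measure_of[OF scalar_measure_def])
    show "positive (sets (scalar_measure E x)) (\<lambda>S. ennreal (inner x (E S x)))" by (simp add: positive_def)
    show "countably_additive (sets (scalar_measure E x)) (\<lambda>S. ennreal (inner x (E S x)))"
    proof (rule countably_additiveI)
      fix F :: "nat \<Rightarrow> real set"
      assume F: "range F \<subseteq> sets (scalar_measure E x)" "disjoint_family F"
      then have "(\<lambda>i. E (F i) x) sums E (\<Union>i. F i) x" by (intro E_sums) auto
      then have "(\<lambda>i. inner x (E (F i) x)) sums inner x (E (\<Union>i. F i) x)"
        by (rule bounded_linear.sums[OF bounded_linear_inner_right])
      then show "(\<Sum>i. ennreal (inner x (E (F i) x))) = ennreal (inner x (E (\<Union>i. F i) x))"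
        by (intro suminf_ennreal_eq) (use F inner_E in auto)
    qed
  qed (use assms in auto)
  then show ?thesis using assms by (simp add: inner_E)
qed

lemma finite_measure_scalar: "finite_measure (scalar_measure E x)"
  by (rule finite_measureI) (simp add: emeasure_scalar)

text \<open>First instance of the calculus: the tests are indicators, their operators the
  projections themselves, and a signed measure vanishing on all Borel sets integrates every bounded
  function to 0.\<close>

sublocale spectral_form "scalar_measure E" indicator E "sets borel"
proof (rule spectral_form.intro)
  show "\<And>x. finite_measure (scalar_measure E x)" by (rule finite_measure_scalar)
  show "\<And>x. sets (scalar_measure E x) = sets borel" by (rule sets_scalar)
  show "bounded_linear (E S)" if "S \<in> sets borel" for S using that by (rule bounded_linear_E)
  show "inner (E S x) y = inner x (E S y)" if "S \<in> sets borel" for S x y using that by (rule E_sym)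
  show "integral\<^sup>L (scalar_measure E x) (indicator S) = inner (E S x) x" if S: "S \<in> sets borel" for S x
    using S inner_E[OF S, of x] finite_measure_scalar
    by (simp add: sets_scalar space_scalar measure_def emeasure_scalar inner_commute)
  show "\<exists>k\<in>sets borel. indicator k = (\<lambda>l. indicator S l * indicator S' l :: real) \<and> E k = (\<lambda>x. E S (E S' x))"
    if "S \<in> sets borel" "S' \<in> sets borel" for S S'
    using that by (intro bexI[of _ "S \<inter> S'"] conjI ext E_Int) (auto simp: indicator_def)
  show "\<exists>k\<in>sets borel. indicator k = (\<lambda>l. 1 :: real) \<and> E k = (\<lambda>x. x)"
    by (intro bexI[of _ UNIV]) auto
qed (auto intro: weighted_integral_eq_0)

abbreviation \<mu> :: "'a \<Rightarrow> real measure" where "\<mu> \<equiv> scalar_measure E"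

lemmas bfun_indicator = bfun_test

lemmas emeasure_\<mu> = emeasure_scalar

abbreviation sdom :: "(real \<Rightarrow> real) \<Rightarrow> 'a set" where "sdom \<equiv> spectral_dom E"

lemma E_abs_le_tendsto:
  assumes "f \<in> borel_measurable borel"
  shows "(\<lambda>n. bfun (cutoff f n) x) \<longlonglongrightarrow> x"
proof -
  have "(\<lambda>n. bfun (cutoff f n) x) \<longlonglongrightarrow> bfun (\<lambda>l. 1) x"
    using assms by (intro bfun_tendsto[where K = 1] tendsto_indicator_abs_le) (auto simp: indicator_def)
  then show ?thesis by simp
qed

text \<open>The unbounded operator f(A), made total; its value is meaningful on
  \<open>sdom f\<close>, where the limit exists.\<close>

definition ufun :: "(real \<Rightarrow> real) \<Rightarrow> 'a \<Rightarrow> 'a" where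
  "ufun f x = lim (\<lambda>n. bfun (trunc f n) x)"

text \<open>Norms of differences of truncations are L^2 distances under \<mu> x, and the truncations
  converge to \<open>f\<close> in L^2 by dominated convergence with majorant f^2.\<close>

lemma ufun_tendsto:
  assumes f: "f \<in> borel_measurable borel" and x: "x \<in> sdom f"
  shows "(\<lambda>n. bfun (trunc f n) x) \<longlonglongrightarrow> ufun f x"
proof -
  let ?d = "\<lambda>n l. trunc f n l - f l"
  have int: "integrable (\<mu> x) (\<lambda>l. (f l)\<^sup>2)" using x by (simp add: spectral_dom_def)
  note bb = bdd_borel_truncate[OF f]
  have le: "(?d n l)\<^sup>2 \<le> (f l)\<^sup>2" for n l
    by (auto simp: trunc_def indicator_def)
  have inti: "integrable (\<mu> x) (\<lambda>l. (?d n l)\<^sup>2)" for n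
    by (rule Bochner_Integration.integrable_bound[OF int])
      (use le f bb bdd_borel_measurable in auto)
  have "convergent (\<lambda>n. bfun (trunc f n) x)"
  proof (rule convergent_if_norm_diff_sq_le)
    fix m n
    have "(norm (bfun (trunc f m) x - bfun (trunc f n) x))\<^sup>2
      = (\<integral>l. (trunc f m l - trunc f n l)\<^sup>2 \<partial>\<mu> x)"
      by (simp add: bfun_diff[symmetric] bb norm_bfun_sq bdd_borel_diff)
    also have "\<dots> \<le> (\<integral>l. 2 * (?d m l)\<^sup>2 + 2 * (?d n l)\<^sup>2 \<partial>\<mu> x)"
    proof (rule integral_mono)
      show "integrable (\<mu> x) (\<lambda>l. (trunc f m l - trunc f n l)\<^sup>2)"
        by (intro integrable_\<mu> bdd_borel_power2 bdd_borel_diff bb)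
      show "integrable (\<mu> x) (\<lambda>l. 2 * (?d m l)\<^sup>2 + 2 * (?d n l)\<^sup>2)"
        using inti by simp
      fix l
      have "0 \<le> ((?d m l) + (?d n l))\<^sup>2" by simp
      then show "(trunc f m l - trunc f n l)\<^sup>2
          \<le> 2 * (?d m l)\<^sup>2 + 2 * (?d n l)\<^sup>2"
        by (simp add: power2_eq_square algebra_simps)
    qed
    also have "\<dots> = 2 * (\<integral>l. (?d m l)\<^sup>2 \<partial>\<mu> x) + 2 * (\<integral>l. (?d n l)\<^sup>2 \<partial>\<mu> x)"
      using inti by simp
    finally show "(norm (bfun (trunc f m) x - bfun (trunc f n) x))\<^sup>2
      \<le> 2 * (\<integral>l. (?d m l)\<^sup>2 \<partial>\<mu> x) + 2 * (\<integral>l. (?d n l)\<^sup>2 \<partial>\<mu> x)" .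
  next
    have "(\<lambda>n. \<integral>l. (?d n l)\<^sup>2 \<partial>\<mu> x) \<longlonglongrightarrow> (\<integral>l. 0 \<partial>\<mu> x)"
    proof (rule integral_dominated_convergence[OF _ _ int])
      show "AE l in \<mu> x. (\<lambda>n. (?d n l)\<^sup>2) \<longlonglongrightarrow> 0"
        by (intro always_eventually allI tendsto_diff_sq_0 truncate_tendsto)
    qed (use le f bb bdd_borel_measurable in auto)
    then show "(\<lambda>n. 2 * (\<integral>l. (?d n l)\<^sup>2 \<partial>\<mu> x)) \<longlonglongrightarrow> 0"
      using tendsto_mult[OF tendsto_const[of 2]] by fastforce
  qed
  then show ?thesis unfolding ufun_def by (rule convergent_LIMSEQ_iff[THEN iffD1])
qed

lemma bfun_ufun:
  assumes f: "f \<in> borel_measurable borel" and x: "x \<in> sdom f"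
    and h: "bdd_borel h" and hf: "bdd_borel (\<lambda>l. h l * f l)"
  shows "bfun h (ufun f x) = bfun (\<lambda>l. h l * f l) x"
proof -
  obtain K where K: "\<And>l. \<bar>h l * f l\<bar> \<le> K" using hf by (auto simp: bdd_borel_def)
  note bb = bdd_borel_truncate[OF f]
  interpret bounded_linear "bfun h" using h by (rule bounded_linear_bfun)
  have "(\<lambda>n. bfun h (bfun (trunc f n) x)) \<longlonglongrightarrow> bfun h (ufun f x)"
    by (rule tendsto[OF ufun_tendsto[OF f x]])
  moreover have "(\<lambda>n. bfun (\<lambda>l. h l * trunc f n l) x) \<longlonglongrightarrow> bfun (\<lambda>l. h l * f l) x"
  proof (rule bfun_tendsto)
    show "\<bar>h l * trunc f n l\<bar> \<le> K" for n l
      using K[of l] by (auto simp: trunc_def indicator_def)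
    show "(\<lambda>n. h l * trunc f n l) \<longlonglongrightarrow> h l * f l" for l
      by (intro tendsto_intros truncate_tendsto)
  qed (use h hf bb bdd_borel_measurable bdd_borel_mult in auto)
  ultimately show ?thesis by (auto simp: bfun_bfun[OF h bb] intro: LIMSEQ_unique)
qed

lemma bfun_truncate:
  assumes f: "f \<in> borel_measurable borel" and x: "x \<in> sdom f"
  shows "bfun (trunc f n) x = bfun (cutoff f n) (ufun f x)"
proof -
  have "bdd_borel (\<lambda>l. cutoff f n l * f l)"
    using bdd_borel_truncate[OF f, of n] by (simp add: trunc_def[abs_def])
  then show ?thesis
    using bfun_ufun[OF f x bdd_borel_cutoff[OF f]] by (simp add: trunc_def[abs_def])
qed

text \<open>The tool for domain questions: if \<open>z\<close> agrees with the would-be value f(A) x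
  on every band where |f| \<le> n, then the integrals of f^2 over these bands converge to |z|^2, and
  monotone convergence puts \<open>x\<close> into the domain.\<close>

lemma sdom_ufunI:
  assumes f: "f \<in> borel_measurable borel"
    and z: "\<And>n. bfun (trunc f n) x = bfun (cutoff f n) z"
  shows "x \<in> sdom f" "ufun f x = z"
proof -
  note bb = bdd_borel_truncate[OF f]
  have lim: "(\<lambda>n. bfun (trunc f n) x) \<longlonglongrightarrow> z" unfolding z by (rule E_abs_le_tendsto[OF f])
  then have "(\<lambda>n. (norm (bfun (trunc f n) x))\<^sup>2) \<longlonglongrightarrow> (norm z)\<^sup>2" by (intro tendsto_intros)
  then have "(\<lambda>n. \<integral>l. (trunc f n l)\<^sup>2 \<partial>\<mu> x) \<longlonglongrightarrow> (norm z)\<^sup>2" by (simp add: norm_bfun_sq bb)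
  then have "integrable (\<mu> x) (\<lambda>l. (f l)\<^sup>2)"
  proof (rule integrable_monotone_convergence[rotated 3])
    show "integrable (\<mu> x) (\<lambda>l. (trunc f n l)\<^sup>2)" for n
      by (intro integrable_\<mu> bdd_borel_power2 bb)
    show "AE l in \<mu> x. mono (\<lambda>n. (trunc f n l)\<^sup>2)"
      by (auto simp: trunc_def indicator_def mono_def)
    show "AE l in \<mu> x. (\<lambda>n. (trunc f n l)\<^sup>2) \<longlonglongrightarrow> (f l)\<^sup>2"
      using tendsto_power[OF truncate_tendsto, of f _ 2] by simp
  qed (use f in auto)
  then show x: "x \<in> sdom f" by (simp add: spectral_dom_def)
  show "ufun f x = z" using LIMSEQ_unique[OF ufun_tendsto[OF f x] lim] .
qed

lemma sdom_linear:
  assumes f: "f \<in> borel_measurable borel" and x: "x \<in> sdom f" and y: "y \<in> sdom f"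
  shows "x + y \<in> sdom f" "ufun f (x + y) = ufun f x + ufun f y"
    "x - y \<in> sdom f" "ufun f (x - y) = ufun f x - ufun f y"
    "c *\<^sub>R x \<in> sdom f" "ufun f (c *\<^sub>R x) = c *\<^sub>R ufun f x"
proof -
  note bb = bdd_borel_truncate[OF f]
  note bi = bdd_borel_cutoff[OF f]
  note tr = bfun_truncate[OF f x] bfun_truncate[OF f y]
  show "x + y \<in> sdom f" "ufun f (x + y) = ufun f x + ufun f y"
    using sdom_ufunI[OF f, of "x + y" "ufun f x + ufun f y"] by (simp_all add: tr bfun_vadd bb bi)
  show "x - y \<in> sdom f" "ufun f (x - y) = ufun f x - ufun f y"
    using sdom_ufunI[OF f, of "x - y" "ufun f x - ufun f y"] by (simp_all add: tr bfun_vdiff bb bi)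
  show "c *\<^sub>R x \<in> sdom f" "ufun f (c *\<^sub>R x) = c *\<^sub>R ufun f x"
    using sdom_ufunI[OF f, of "c *\<^sub>R x" "c *\<^sub>R ufun f x"] by (simp_all add: tr bfun_scaleR bb bi)
qed

lemma bfun_in_sdom:
  assumes f: "f \<in> borel_measurable borel" and h: "bdd_borel h" "bdd_borel (\<lambda>l. h l * f l)"
  shows "bfun h x \<in> sdom f" "ufun f (bfun h x) = bfun (\<lambda>l. h l * f l) x"
proof -
  note bb = bdd_borel_truncate[OF f]
  note bi = bdd_borel_cutoff[OF f]
  have "bfun (trunc f n) (bfun h x) = bfun (cutoff f n) (bfun (\<lambda>l. h l * f l) x)" for n
    unfolding bfun_bfun[OF bb h(1)] bfun_bfun[OF bi h(2)]
    by (simp add: trunc_def mult_ac)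
  then show "bfun h x \<in> sdom f" "ufun f (bfun h x) = bfun (\<lambda>l. h l * f l) x"
    using sdom_ufunI[OF f] by blast+
qed

lemma ufun_sym:
  assumes f: "f \<in> borel_measurable borel" and x: "x \<in> sdom f" and y: "y \<in> sdom f"
  shows "inner (ufun f x) y = inner x (ufun f y)"
proof (rule LIMSEQ_unique)
  show "(\<lambda>n. inner (bfun (trunc f n) x) y) \<longlonglongrightarrow> inner (ufun f x) y"
    by (intro tendsto_intros ufun_tendsto f x)
  show "(\<lambda>n. inner (bfun (trunc f n) x) y) \<longlonglongrightarrow> inner x (ufun f y)"
    unfolding bfun_sym[OF bdd_borel_truncate[OF f]] by (intro tendsto_intros ufun_tendsto f y)
qed

lemma inner_ufun_self:
  assumes f: "f \<in> borel_measurable borel" and x: "x \<in> sdom f"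
  shows "integrable (\<mu> x) f" "inner (ufun f x) x = integral\<^sup>L (\<mu> x) f"
proof -
  interpret finite_measure "\<mu> x" by (rule finite_measure_\<mu>)
  note bb = bdd_borel_truncate[OF f]
  have int: "integrable (\<mu> x) (\<lambda>l. 1 + (f l)\<^sup>2)" using x by (simp add: spectral_dom_def)
  have le: "\<bar>f l\<bar> \<le> 1 + (f l)\<^sup>2" for l
  proof -
    have "0 \<le> (\<bar>f l\<bar> - 1)\<^sup>2" by simp
    then show ?thesis by (simp add: power2_diff)
  qed
  show "integrable (\<mu> x) f" by (rule Bochner_Integration.integrable_bound[OF int]) (use le f in auto)
  have "(\<lambda>n. integral\<^sup>L (\<mu> x) (trunc f n)) \<longlonglongrightarrow> integral\<^sup>L (\<mu> x) f"
  proof (rule integral_dominated_convergence[OF _ _ int])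
    show "AE l in \<mu> x. norm (trunc f n l) \<le> 1 + (f l)\<^sup>2" for n
      using le by (auto simp: trunc_def indicator_def)
  qed (use f truncate_tendsto bb bdd_borel_measurable in auto)
  moreover have "(\<lambda>n. inner (bfun (trunc f n) x) x) \<longlonglongrightarrow> inner (ufun f x) x"
    by (intro tendsto_intros ufun_tendsto f x)
  ultimately show "inner (ufun f x) x = integral\<^sup>L (\<mu> x) f"
    unfolding inner_bfun_self[OF bb] using LIMSEQ_unique by blast
qed

text \<open>Identifies the definite description in \<open>spectral_integral\<close> with the limit
  of truncations. The form identity is polarization of \<open>inner_ufun_self\<close>; uniqueness
  holds because vectors cut off to |f| \<le> n lie in the domain and are dense.\<close>

theorem spectral_integral_eq:
  assumes f: "f \<in> borel_measurable borel" and x: "x \<in> sdom f"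
  shows "spectral_integral E f x = Some (ufun f x)"
proof -
  have form: "inner y (ufun f x) = (integral\<^sup>L (\<mu> (x + y)) f - integral\<^sup>L (\<mu> (x - y)) f) / 4"
    if y: "y \<in> sdom f" for y
  proof -
    have "inner (ufun f y) x = inner (ufun f x) y" using ufun_sym[OF f x y] by (simp add: inner_commute)
    then show ?thesis using sdom_linear[OF f x y]
      by (simp add: inner_ufun_self(2)[OF f, symmetric] inner_add_left inner_add_right inner_diff_left
          inner_diff_right inner_commute[of y])
  qed
  have "(THE z. \<forall>y\<in>sdom f. inner y z = (integral\<^sup>L (\<mu> (x + y)) f - integral\<^sup>L (\<mu> (x - y)) f) / 4) = ufun f x"
  proof (rule the_equality)
    fix z assume z: "\<forall>y\<in>sdom f. inner y z = (integral\<^sup>L (\<mu> (x + y)) f - integral\<^sup>L (\<mu> (x - y)) f) / 4"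
    show "z = ufun f x"
    proof (rule eq_if_inner_eq, rule LIMSEQ_unique)
      fix v
      let ?v = "\<lambda>n. bfun (cutoff f n) v"
      have v: "?v n \<in> sdom f" for n
        using bfun_in_sdom(1)[OF f] bdd_borel_truncate[OF f, of n] f
        by (simp add: trunc_def[abs_def])
      show "(\<lambda>n. inner (?v n) z) \<longlonglongrightarrow> inner z v"
        by (subst inner_commute[of z]) (intro tendsto_intros E_abs_le_tendsto f)
      have "(\<lambda>n. inner (?v n) (ufun f x)) \<longlonglongrightarrow> inner (ufun f x) v"
        by (subst inner_commute[of _ v]) (intro tendsto_intros E_abs_le_tendsto f)
      moreover have "inner (?v n) (ufun f x) = inner (?v n) z" for n
        using z form[OF v[of n]] v[of n] by metis
      ultimately show "(\<lambda>n. inner (?v n) z) \<longlonglongrightarrow> inner (ufun f x) v" by (simp only:)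
    qed
  qed (use form in blast)
  then show ?thesis using x by (simp add: spectral_integral_def)
qed

lemma dom_spectral_integral: "dom (spectral_integral E f) = sdom f"
  by (auto simp: spectral_integral_def dom_def)

lemma op_app_spectral_integral:
  "f \<in> borel_measurable borel \<Longrightarrow> x \<in> sdom f \<Longrightarrow> op_app (spectral_integral E f) x = ufun f x"
  by (simp add: op_app_def spectral_integral_eq)

text \<open>Applying f(A) multiplies the spectral measure by f^2. All Sobolev norms of compositions
  reduce through this to integrals against \<mu> x.\<close>

lemma \<mu>_ufun:
  assumes f: "f \<in> borel_measurable borel" and x: "x \<in> sdom f"
  shows "\<mu> (ufun f x) = density (\<mu> x) (\<lambda>l. ennreal ((f l)\<^sup>2))"
proof (rule measure_eqI)
  fix S assume "S \<in> sets (\<mu> (ufun f x))"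
  then have S: "S \<in> sets borel" by simp
  note bb = bdd_borel_truncate[OF f]
  have bS: "bdd_borel (\<lambda>l. indicator S l * trunc f n l)" for n
    using S bb by (intro bdd_borel_mult) auto
  have int: "integrable (\<mu> x) (\<lambda>l. (f l)\<^sup>2)" using x by (simp add: spectral_dom_def)
  have intS: "integrable (\<mu> x) (\<lambda>l. (indicator S l * f l)\<^sup>2)"
    by (rule Bochner_Integration.integrable_bound[OF int]) (use S f in \<open>auto simp: indicator_def\<close>)
  interpret bounded_linear "bfun (indicator S)" using S by (intro bounded_linear_bfun) auto
  have "(\<lambda>n. (norm (bfun (indicator S) (bfun (trunc f n) x)))\<^sup>2) \<longlonglongrightarrow> (norm (bfun (indicator S) (ufun f x)))\<^sup>2"
    by (intro tendsto_intros tendsto ufun_tendsto f x)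
  then have "(\<lambda>n. \<integral>l. (indicator S l * trunc f n l)\<^sup>2 \<partial>\<mu> x) \<longlonglongrightarrow> (norm (E S (ufun f x)))\<^sup>2"
    using S by (simp add: bfun_bfun bb norm_bfun_sq bS bfun_indicator)
  moreover have "(\<lambda>n. \<integral>l. (indicator S l * trunc f n l)\<^sup>2 \<partial>\<mu> x) \<longlonglongrightarrow> (\<integral>l. (indicator S l * f l)\<^sup>2 \<partial>\<mu> x)"
  proof (rule integral_dominated_convergence[OF _ _ int])
    show "AE l in \<mu> x. (\<lambda>n. (indicator S l * trunc f n l)\<^sup>2) \<longlonglongrightarrow> (indicator S l * f l)\<^sup>2"
      by (intro always_eventually allI tendsto_intros truncate_tendsto)
    show "AE l in \<mu> x. norm ((indicator S l * trunc f n l)\<^sup>2) \<le> (f l)\<^sup>2" for n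
      by (auto simp: trunc_def indicator_def)
  qed (use S f bS bdd_borel_measurable in auto)
  ultimately have "(norm (E S (ufun f x)))\<^sup>2 = (\<integral>l. (indicator S l * f l)\<^sup>2 \<partial>\<mu> x)"
    by (rule LIMSEQ_unique)
  then have "emeasure (\<mu> (ufun f x)) S = (\<integral>\<^sup>+ l. ennreal ((indicator S l * f l)\<^sup>2) \<partial>\<mu> x)"
    using S intS by (simp add: emeasure_\<mu> nn_integral_eq_integral)
  also have "\<dots> = (\<integral>\<^sup>+ l. ennreal ((f l)\<^sup>2) * indicator S l \<partial>\<mu> x)"
    by (intro nn_integral_cong) (auto simp: indicator_def)
  also have "\<dots> = emeasure (density (\<mu> x) (\<lambda>l. ennreal ((f l)\<^sup>2))) S"
    using S f by (simp add: emeasure_density)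
  finally show "emeasure (\<mu> (ufun f x)) S = emeasure (density (\<mu> x) (\<lambda>l. ennreal ((f l)\<^sup>2))) S" .
qed simp

lemma norm_sq_eq_emeasure: "ennreal ((norm x)\<^sup>2) = emeasure (\<mu> x) UNIV"
  by (simp add: emeasure_\<mu>)

lemma norm_ufun_sq:
  assumes f: "f \<in> borel_measurable borel" and x: "x \<in> sdom f"
  shows "ennreal ((norm (ufun f x))\<^sup>2) = (\<integral>\<^sup>+ l. ennreal ((f l)\<^sup>2) \<partial>\<mu> x)"
  using f by (simp add: norm_sq_eq_emeasure \<mu>_ufun[OF f x] emeasure_density)

lemma sdom_iff:
  assumes f: "f \<in> borel_measurable borel"
  shows "x \<in> sdom f \<longleftrightarrow> (\<integral>\<^sup>+ l. ennreal ((f l)\<^sup>2) \<partial>\<mu> x) < \<infinity>"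
  using f by (simp add: spectral_dom_def integrable_iff_bounded)

end

subsection \<open>The Hausdorff moment problem\<close>

definition Bernstein_poly :: "nat \<Rightarrow> nat \<Rightarrow> real poly" where
  "Bernstein_poly n k = smult (of_nat (n choose k)) ([:0, 1:] ^ k * [:1, -1:] ^ (n - k))"

lemma poly_Bernstein_poly: "poly (Bernstein_poly n k) x = Bernstein n k x"
  by (simp add: Bernstein_poly_def Bernstein_def)

text \<open>The expansion of x^j in the Bernstein basis of degree \<open>n\<close>. Its coefficients
  are close to (k/n)^j, which links a functional on polynomials to the discrete measure with masses
  \<Lambda>(\<open>Bernstein_poly n k\<close>) at k/n.\<close>

lemma sum_choose_Bernstein_poly:
  assumes "j \<le> n"
  shows "(\<Sum>k\<le>n. smult (of_nat (k choose j) / of_nat (n choose j)) (Bernstein_poly n k)) = [:0, 1:] ^ j"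
proof -
  have nz: "real (n choose j) \<noteq> 0" using assms by simp
  have "(\<Sum>k\<le>n. (k choose j) * ((n choose k) * (x ^ k * (1 - x) ^ (n - k)))) = (n choose j) * x ^ j" for x :: real
  proof -
    have "(\<Sum>k\<le>n. (k choose j) * ((n choose k) * (x ^ k * (1 - x) ^ (n - k))))
      = (\<Sum>k\<in>{j..n}. (k choose j) * ((n choose k) * (x ^ k * (1 - x) ^ (n - k))))"
      by (rule sum.mono_neutral_right) (auto simp: binomial_eq_0)
    also have "\<dots> = (\<Sum>i\<in>{..n - j}. (j + i choose j) * ((n choose (j + i)) * (x ^ (j + i) * (1 - x) ^ (n - (j + i)))))"
      by (rule sum.reindex_bij_witness[of _ "\<lambda>i. j + i" "\<lambda>k. k - j"]) (use assms in auto)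
    also have "\<dots> = (\<Sum>i\<le>n - j. (n choose j) * x ^ j * (((n - j) choose i) * x ^ i * (1 - x) ^ (n - j - i)))"
    proof (rule sum.cong[OF refl])
      fix i assume "i \<in> {..n - j}"
      then have "(n choose (j + i)) * (j + i choose j) = (n choose j) * ((n - j) choose i)"
        using choose_mult[of j "j + i" n] assms by simp
      then have "real (n choose (j + i)) * real (j + i choose j) = real (n choose j) * real ((n - j) choose i)"
        by (metis of_nat_mult)
      then have "real (j + i choose j) * real (n choose (j + i)) = real (n choose j) * real ((n - j) choose i)"
        by (simp add: mult.commute)
      then show "(j + i choose j) * ((n choose (j + i)) * (x ^ (j + i) * (1 - x) ^ (n - (j + i))))
        = (n choose j) * x ^ j * (((n - j) choose i) * x ^ i * (1 - x) ^ (n - j - i))"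
        by (simp add: power_add mult.assoc[symmetric])
    qed
    also have "\<dots> = (n choose j) * x ^ j * (x + (1 - x)) ^ (n - j)"
      by (simp only: binomial_ring[of x "1 - x" "n - j"] sum_distrib_left of_nat_id)
    finally show ?thesis by simp
  qed
  note id = this
  have "poly (\<Sum>k\<le>n. smult (of_nat (k choose j) / of_nat (n choose j)) (Bernstein_poly n k)) x
      = poly ([:0, 1:] ^ j) x" for x
  proof -
    have "poly (\<Sum>k\<le>n. smult (of_nat (k choose j) / of_nat (n choose j)) (Bernstein_poly n k)) x
        = (\<Sum>k\<le>n. (k choose j) * ((n choose k) * (x ^ k * (1 - x) ^ (n - k)))) / (n choose j)"
      by (simp add: poly_sum poly_Bernstein_poly Bernstein_def sum_divide_distrib mult_ac)
    then show ?thesis unfolding id using nz by simp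
  qed
  then show ?thesis by (simp add: poly_eq_poly_eq_iff[symmetric] fun_eq_iff)
qed

text \<open>Both sides are products of \<open>j\<close> factors of modulus at most 1, so their
  difference is at most the sum of the differences of the factors, each at most j / (n - j).\<close>

lemma binomial_ratio_power_le:
  assumes "k \<le> n" and "2 * j < n"
  shows "\<bar>(real k / n) ^ j - real (k choose j) / (n choose j)\<bar> \<le> real (j * j) / (n - j)"
proof -
  let ?a = "\<lambda>i. (real k - real i) / (real n - real i)"
  have nz: "(\<Prod>i = 0..<j. real n - real i) \<noteq> 0" using assms by auto
  have "real (k choose j) / (n choose j) = (\<Prod>i = 0..<j. ?a i)"
    using nz by (simp add: binomial_gbinomial gbinomial_prod_rev prod_dividef)
  moreover have "(real k / n) ^ j = (\<Prod>i = 0..<j. real k / n)" by simp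
  ultimately have "\<bar>(real k / n) ^ j - real (k choose j) / (n choose j)\<bar>
      = norm ((\<Prod>i = 0..<j. real k / n) - (\<Prod>i = 0..<j. ?a i))" by simp
  also have "\<dots> \<le> (\<Sum>i = 0..<j. norm (real k / n - ?a i))"
  proof (rule norm_prod_diff)
    fix i assume i: "i \<in> {0..<j}"
    show "norm (real k / real n) \<le> 1" using assms by (simp add: divide_le_eq_1)
    \<comment> \<open>For k < i the factor is negative; then i - k \<le> i \<le> n - i by
      \<open>2 * j < n\<close>.\<close>
    have "\<bar>real k - real i\<bar> \<le> real n - real i" using assms i by auto
    then show "norm (?a i) \<le> 1" using assms i by (simp add: divide_le_eq_1)
  qed
  also have "\<dots> \<le> (\<Sum>i = 0..<j. real j / (n - j))"
  proof (rule sum_mono)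
    fix i assume i: "i \<in> {0..<j}"
    have ni: "real n - real i > 0" "real n > 0" using assms i by auto
    have "real k / n - ?a i = real i * (real n - real k) / (n * (real n - real i))"
      using ni by (simp add: field_simps)
    also have "norm \<dots> = (real i * ((real n - real k) / n)) / (real n - real i)"
      using ni assms by (simp add: abs_mult)
    also have "\<dots> \<le> real j / (n - j)"
    proof (rule frac_le)
      have "real i * ((real n - real k) / n) \<le> real j * 1"
        by (rule mult_mono) (use i assms ni in \<open>auto simp: divide_le_eq_1\<close>)
      then show "real i * ((real n - real k) / n) \<le> real j" by simp
      show "real (n - j) \<le> real n - real i" using assms i by auto
    qed (use assms in auto)
    finally show "norm (real k / n - ?a i) \<le> real j / (n - j)" .
  qed
  also have "\<dots> = real (j * j) / (n - j)" by simp
  finally show ?thesis .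
qed

lemma borel_measurable_poly [measurable]: "poly p \<in> borel_measurable borel" for p :: "real poly"
  by (intro borel_measurable_continuous_onI continuous_on_poly continuous_on_id)

lemma bounded_poly_clamp: "\<exists>B. \<forall>x. \<bar>poly p (max 0 (min 1 x))\<bar> \<le> B" for p :: "real poly"
proof -
  have "bounded (poly p ` {0..1})"
    by (intro compact_imp_bounded compact_continuous_image continuous_on_poly continuous_on_id compact_Icc)
  then obtain B where "\<forall>x\<in>{0..1}. \<bar>poly p x\<bar> \<le> B" by (auto simp: bounded_iff)
  then show ?thesis by (intro exI[of _ B]) auto
qed

text \<open>Hausdorff's complete monotonicity of the moments. Positivity is demanded only on the
  products x^k (1 - x)^m, for which it can be verified directly in the operator setting.\<close>

locale moment_functional =
  fixes \<Lambda> :: "real poly \<Rightarrow> real"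
  assumes add: "\<Lambda> (p + q) = \<Lambda> p + \<Lambda> q"
    and smult: "\<Lambda> (smult c p) = c * \<Lambda> p"
    and nonneg: "0 \<le> \<Lambda> ([:0, 1:] ^ k * [:1, -1:] ^ m)"
begin

lemma zero: "\<Lambda> 0 = 0" using smult[of 0 0] by simp

lemma sum: "\<Lambda> (\<Sum>i\<in>A. f i) = (\<Sum>i\<in>A. \<Lambda> (f i))"
  by (induction A rule: infinite_finite_induct) (auto simp: zero add)

lemma Bernstein_nonneg: "0 \<le> \<Lambda> (Bernstein_poly n k)"
  unfolding Bernstein_poly_def smult by (intro mult_nonneg_nonneg nonneg) auto

lemma sum_Bernstein: "(\<Sum>k\<le>n. \<Lambda> (Bernstein_poly n k)) = \<Lambda> 1"
  using sum_choose_Bernstein_poly[of 0 n] by (simp add: sum[symmetric])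

lemma poly_eq_sum: "\<Lambda> p = (\<Sum>i\<le>degree p. coeff p i * \<Lambda> ([:0, 1:] ^ i))"
proof -
  have "p = (\<Sum>i\<le>degree p. smult (coeff p i) ([:0, 1:] ^ i))"
    by (simp flip: monom_altdef poly_as_sum_of_monoms)
  then have "\<Lambda> p = \<Lambda> (\<Sum>i\<le>degree p. smult (coeff p i) ([:0, 1:] ^ i))" by simp
  then show ?thesis by (simp add: sum smult)
qed

text \<open>With total mass 0 all the nonnegative Bernstein weights vanish, and x^n is the Bernstein
  polynomial with k = n.\<close>

lemma bound_0:
  assumes "\<Lambda> 1 = 0" shows "\<Lambda> p = 0"
proof -
  have "\<Lambda> ([:0, 1:] ^ n) = 0" for n
  proof -
    have "\<forall>k\<in>{..n}. \<Lambda> (Bernstein_poly n k) = 0"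
      using sum_Bernstein[of n] assms sum_nonneg_eq_0_iff[of "{..n}" "\<lambda>k. \<Lambda> (Bernstein_poly n k)"] Bernstein_nonneg
      by simp
    then have "\<Lambda> (Bernstein_poly n n) = 0" by blast
    then show ?thesis by (simp add: Bernstein_poly_def smult)
  qed
  then show ?thesis by (simp add: poly_eq_sum[of p])
qed

text \<open>Helly's selection principle for the laws with mass
  \<Lambda>(\<open>Bernstein_poly n k\<close>) at k/n. Their j-th moments differ from that of
  \<Lambda> by at most j^2 / (n - j), hence the limit law has the right moments.\<close>

lemma Hausdorff_normalized:
  assumes one: "\<Lambda> 1 = 1"
  obtains M where "real_distribution M" "AE x in M. x \<in> {0..1}"
    "\<And>p. integrable M (poly p)" "\<And>p. \<Lambda> p = integral\<^sup>L M (poly p)"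
proof -
  define w where "w n k = (if k \<le> n then \<Lambda> (Bernstein_poly n k) else 0)" for n k
  have w0: "0 \<le> w n k" for n k by (simp add: w_def Bernstein_nonneg)
  have "(\<integral>\<^sup>+ k. ennreal (w n k) \<partial>count_space UNIV) = 1" for n
  proof -
    have "(\<integral>\<^sup>+ k. ennreal (w n k) \<partial>count_space UNIV) = (\<Sum>k\<le>n. ennreal (w n k))"
      by (subst nn_integral_count_space'[of "{..n}"]) (auto simp: w_def)
    also have "\<dots> = ennreal (\<Sum>k\<le>n. w n k)" by (rule sum_ennreal) (rule w0)
    also have "(\<Sum>k\<le>n. w n k) = 1" using sum_Bernstein[of n] one by (simp add: w_def)
    finally show ?thesis by simp
  qed
  then have pmf: "pmf (embed_pmf (w n)) k = w n k" for n k by (intro pmf_embed_pmf w0)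
  define N where "N n = distr (measure_pmf (embed_pmf (w n))) borel (\<lambda>k. real k / real n)" for n
  have sp: "set_pmf (embed_pmf (w n)) \<subseteq> {..n}" for n by (auto simp: set_pmf_eq pmf w_def)
  have rd: "real_distribution (N n)" for n
    unfolding N_def by (rule prob_space.real_distribution_distr[OF prob_space_measure_pmf]) simp
  have intN: "integral\<^sup>L (N n) f = (\<Sum>k\<le>n. \<Lambda> (Bernstein_poly n k) * f (k / n))"
    if "f \<in> borel_measurable borel" for f :: "real \<Rightarrow> real" and n
  proof -
    have "integral\<^sup>L (N n) f = (\<integral>k. f (k / n) \<partial>measure_pmf (embed_pmf (w n)))"
      unfolding N_def by (rule integral_distr) (use that in auto)
    also have "\<dots> = (\<Sum>k\<le>n. pmf (embed_pmf (w n)) k *\<^sub>R f (k / n))"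
      by (rule integral_measure_pmf) (use sp in auto)
    finally show ?thesis by (simp add: pmf w_def)
  qed
  have "tight N"
    unfolding tight_def
  proof (intro conjI allI impI rd)
    fix e :: real assume "0 < e"
    \<comment> \<open>Tightness is phrased with half-open intervals; the left end -1 keeps the grid
      point 0 inside.\<close>
    have "measure (N n) {-1<..1} = 1" for n
    proof -
      have "measure (N n) {-1<..1} = measure (embed_pmf (w n)) {k. real k / real n \<in> {-1<..1}}"
        unfolding N_def by (subst measure_distr) (auto simp: vimage_def)
      also have "\<dots> = 1"
      proof -
        have "real k / real n \<in> {-1<..1}" if "k \<le> n" for k
          using that by (auto simp: divide_le_eq_1 intro: less_le_trans[of _ 0])
        then show ?thesis using sp[of n]
          by (intro measure_pmf.prob_eq_1[THEN iffD2]) (auto simp: AE_measure_pmf_iff)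
      qed
      finally show ?thesis .
    qed
    then show "\<exists>a b. a < b \<and> (\<forall>n. 1 - e < measure (N n) {a<..b})"
      using \<open>0 < e\<close> by (intro exI[of _ "-1"] exI[of _ 1]) auto
  qed
  from tight_imp_convergent_subsubsequence[OF this strict_mono_id] obtain r M
    where r: "strict_mono r" and M: "real_distribution M" and wc: "weak_conv_m (N \<circ> r) M"
    by (auto simp: comp_def)
  interpret M: real_distribution M by (rule M)
  \<comment> \<open>Clamping turns a polynomial into a bounded continuous function on the line, as
    weak convergence requires, without changing it on the grid.\<close>
  let ?c = "\<lambda>x::real. max 0 (min 1 x)"
  have conv: "(\<lambda>n. integral\<^sup>L (N (r n)) f) \<longlonglongrightarrow> integral\<^sup>L M f"
    if "continuous_on UNIV f" "\<And>x. \<bar>f x\<bar> \<le> B" for f :: "real \<Rightarrow> real" and B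
    using weak_conv_imp_integral_bdd_continuous_conv[of "N \<circ> r" M f B] rd M wc that
    by (simp add: continuous_on_eq_continuous_at)
  \<comment> \<open>For \<open>n = 0\<close> the quotient is 0 by convention, which still lies in
    the unit interval.\<close>
  have grid: "?c (real k / real n) = real k / real n" if "k \<le> n" for k n
  proof -
    have "real k / real n \<le> 1" using that by (cases "n = 0") (auto simp: divide_le_eq_1)
    then show ?thesis by simp
  qed
  have AE: "AE x in M. x \<in> {0..1}"
  proof -
    \<comment> \<open>A bounded continuous function that vanishes exactly on the unit interval, so
      that its integral detects mass outside.\<close>
    let ?f = "\<lambda>x. min 1 \<bar>x - ?c x\<bar>"
    have cont: "continuous_on UNIV ?f" by (intro continuous_intros)
    have "?f (real k / real n) = 0" if "k \<le> n" for k n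
      by (simp only: grid[OF that])
    then have "integral\<^sup>L (N n) ?f = 0" for n
      by (subst intN) (auto intro!: borel_measurable_continuous_onI cont)
    then have "integral\<^sup>L M ?f = 0" using conv[OF cont, of 1] by (simp add: LIMSEQ_const_iff)
    moreover have "integrable M ?f"
      by (rule M.integrable_const_bound[of _ 1]) (auto intro!: borel_measurable_continuous_onI cont)
    ultimately have "AE x in M. ?f x = 0" by (subst (asm) integral_nonneg_eq_0_iff_AE) auto
    then show ?thesis by eventually_elim (auto simp: min_def max_def split: if_splits)
  qed
  have clamp: "poly p (?c x) = poly p x" if "x \<in> {0..1}" for p x using that by simp
  have cont: "continuous_on UNIV (\<lambda>x. poly p (?c x))" for p by (intro continuous_intros)
  have bdd: "\<exists>B. \<forall>x. \<bar>poly p (?c x)\<bar> \<le> B" for p by (rule bounded_poly_clamp)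
  have int: "integrable M (poly p)" for p
  proof -
    obtain B where "\<And>x. \<bar>poly p (?c x)\<bar> \<le> B" using bdd by blast
    moreover have "AE x in M. norm (poly p x) \<le> B"
      using AE by eventually_elim (use clamp calculation in \<open>metis real_norm_def\<close>)
    ultimately show ?thesis
      by (intro M.integrable_const_bound[of _ B]) 
        auto
  qed
  have moment: "\<Lambda> ([:0, 1:] ^ j) = integral\<^sup>L M (poly ([:0, 1:] ^ j))" for j
  proof (rule LIMSEQ_unique)
    let ?p = "[:0, 1:] ^ j :: real poly"
    obtain B where B: "\<And>x. \<bar>poly ?p (?c x)\<bar> \<le> B" using bdd by blast
    have "integral\<^sup>L M (\<lambda>x. poly ?p (?c x)) = integral\<^sup>L M (poly ?p)"
    proof (rule integral_cong_AE)
      show "AE x in M. poly ?p (?c x) = poly ?p x" using AE by eventually_elim (rule clamp)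
    qed (auto intro!: borel_measurable_continuous_onI cont)
    then show lim: "(\<lambda>n. integral\<^sup>L (N (r n)) (\<lambda>x. poly ?p (?c x))) \<longlonglongrightarrow> integral\<^sup>L M (poly ?p)"
      using conv[OF cont B] by simp
    have N: "integral\<^sup>L (N n) (\<lambda>x. poly ?p (?c x)) = (\<Sum>k\<le>n. \<Lambda> (Bernstein_poly n k) * (k / n) ^ j)" for n
    proof (subst intN)
      show "(\<lambda>x. poly ?p (?c x)) \<in> borel_measurable borel"
        by (intro borel_measurable_continuous_onI cont)
      show "(\<Sum>k\<le>n. \<Lambda> (Bernstein_poly n k) * poly ?p (?c (k / n)))
          = (\<Sum>k\<le>n. \<Lambda> (Bernstein_poly n k) * (k / n) ^ j)"
        by (rule sum.cong[OF refl]) (simp only: atMost_iff grid, simp)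
    qed
    have est: "\<bar>integral\<^sup>L (N n) (\<lambda>x. poly ?p (?c x)) - \<Lambda> ?p\<bar> \<le> real (j * j) / (n - j)" if n: "2 * j < n" for n
    proof -
      have "\<Lambda> ?p = (\<Sum>k\<le>n. \<Lambda> (Bernstein_poly n k) * ((k choose j) / (n choose j)))"
        using n by (subst sum_choose_Bernstein_poly[of j n, symmetric])
          (simp_all add: sum smult mult.commute)
      then have "integral\<^sup>L (N n) (\<lambda>x. poly ?p (?c x)) - \<Lambda> ?p
        = (\<Sum>k\<le>n. \<Lambda> (Bernstein_poly n k) * ((real k / n) ^ j - (k choose j) / (n choose j)))"
        unfolding N by (simp add: right_diff_distrib sum_subtractf)
      also have "\<bar>\<dots>\<bar> \<le> (\<Sum>k\<le>n. \<Lambda> (Bernstein_poly n k) * (real (j * j) / (n - j)))"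
        unfolding abs_mult abs_of_nonneg[OF Bernstein_nonneg]
        by (intro order_trans[OF sum_abs] sum_mono)
          (unfold abs_mult abs_of_nonneg[OF Bernstein_nonneg],
            intro mult_left_mono Bernstein_nonneg binomial_ratio_power_le, use n in auto)
      also have "\<dots> = real (j * j) / (n - j)"
        unfolding sum_distrib_right[symmetric] using sum_Bernstein[of n] one by simp
      finally show ?thesis .
    qed
    have "(\<lambda>n. integral\<^sup>L (N n) (\<lambda>x. poly ?p (?c x))) \<longlonglongrightarrow> \<Lambda> ?p"
    proof (rule LIM_zero_cancel, rule Lim_null_comparison)
      show "\<forall>\<^sub>F n in sequentially. norm (integral\<^sup>L (N n) (\<lambda>x. poly ?p (?c x)) - \<Lambda> ?p) \<le> real (j * j) / (n - j)"
        using eventually_gt_at_top[of "2 * j"] by eventually_elim (use est in simp)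
      have "(\<lambda>n. real (j * j) / (real n - j)) \<longlonglongrightarrow> 0" by real_asymp
      then show "(\<lambda>n. real (j * j) / (n - j)) \<longlonglongrightarrow> 0"
        by (rule Lim_transform_eventually)
          (use eventually_ge_at_top[of j] in eventually_elim, simp add: of_nat_diff)
    qed
    from LIMSEQ_subseq_LIMSEQ[OF this r]
    show "(\<lambda>n. integral\<^sup>L (N (r n)) (\<lambda>x. poly ?p (?c x))) \<longlonglongrightarrow> \<Lambda> ?p" by (simp add: comp_def)
  qed
  have "\<Lambda> p = integral\<^sup>L M (poly p)" for p
  proof -
    have "poly p = (\<lambda>x. \<Sum>i\<le>degree p. coeff p i * poly ([:0, 1:] ^ i) x)"
      by (rule ext) (simp add: poly_altdef[of p])
    then have "integral\<^sup>L M (poly p) = (\<Sum>i\<le>degree p. coeff p i * integral\<^sup>L M (poly ([:0, 1:] ^ i)))"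
      using int by (simp del: poly_power poly_pCons)
    then show ?thesis by (simp add: poly_eq_sum[of p] moment)
  qed
  with M AE int show ?thesis using that by blast
qed

theorem Hausdorff:
  obtains M where "finite_measure M" "sets M = sets borel" "AE x in M. x \<in> {0..1}"
    "\<And>p. \<Lambda> p = integral\<^sup>L M (poly p)"
proof (cases "\<Lambda> 1 = 0")
  case True
  show ?thesis
  proof (rule that[of "null_measure borel"])
    show "finite_measure (null_measure borel)" by (rule finite_measureI) simp
    show "AE x in null_measure borel. x \<in> {0..1 :: real}" 
      by (rule AE_I[of _ _ UNIV]) auto
  qed (auto simp: bound_0[OF True])
next
  case False
  define c where "c = \<Lambda> 1"
  have c: "0 < c" using False nonneg[of 0 0] by (simp add: c_def)
  have "moment_functional (\<lambda>p. \<Lambda> p / c)"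
    by standard (use c nonneg in \<open>auto simp: add smult add_divide_distrib\<close>)
  then interpret n: moment_functional "\<lambda>p. \<Lambda> p / c" .
  obtain M where M: "real_distribution M" "AE x in M. x \<in> {0..1}"
      and p: "\<And>p. integrable M (poly p)" "\<And>p. \<Lambda> p / c = integral\<^sup>L M (poly p)"
    using n.Hausdorff_normalized c by (auto simp: c_def)
  interpret M: real_distribution M by (rule M)
  show ?thesis
  proof (rule that[of "density M (\<lambda>x. ennreal c)"])
    show "finite_measure (density M (\<lambda>x. ennreal c))"
      by (rule finite_measureI) (simp add: emeasure_density_const ennreal_mult_eq_top_iff M.emeasure_space_1)
    show "AE x in density M (\<lambda>x. ennreal c). x \<in> {0..1}" using M(2) by (simp add: AE_density)
    show "\<Lambda> q = integral\<^sup>L (density M (\<lambda>x. ennreal c)) (poly q)" for q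
      using c p[of q] by (subst integral_density) (auto simp: field_simps)
  qed simp
qed

end

subsection \<open>The spectral theorem\<close>

context pvm
begin

lemma E_Compl: "S \<in> sets borel \<Longrightarrow> E (- S) x = x - E S x"
proof -
  assume S: "S \<in> sets borel"
  have "(\<lambda>l. 1 - indicator S l) = (indicator (- S) :: real \<Rightarrow> real)" by (auto simp: indicator_def)
  then have "bfun (indicator (- S)) x = bfun (\<lambda>l. 1 - indicator S l) x" by simp
  also have "\<dots> = bfun (\<lambda>l. 1) x - bfun (indicator S) x"
    using S by (intro bfun_diff) auto
  finally show ?thesis using S by (simp add: bfun_indicator)
qed

lemma AE_\<mu>_in: "S \<in> sets borel \<Longrightarrow> E S x = x \<Longrightarrow> AE l in \<mu> x. l \<in> S"
  by (rule AE_I[of _ _ "- S"]) (auto simp: emeasure_\<mu> E_Compl)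

lemma bfun_cong_AE:
  assumes f: "bdd_borel f" and g: "bdd_borel g" and AE: "AE l in \<mu> x. f l = g l"
  shows "bfun f x = bfun g x"
proof -
  have "(norm (bfun f x - bfun g x))\<^sup>2 = (\<integral>l. (f l - g l)\<^sup>2 \<partial>\<mu> x)"
    using f g by (simp add: bfun_diff[symmetric] norm_bfun_sq bdd_borel_diff)
  also have "\<dots> = 0" by (rule integral_eq_zero_AE) (use AE in eventually_elim, simp)
  finally show ?thesis by simp
qed

end

section \<open>Spectral measure of a positive contraction\<close>

locale positive_contraction =
  fixes B :: "'a::{real_inner, complete_space} \<Rightarrow> 'a"
  assumes bounded_linear_B: "bounded_linear B"
    and B_sym: "inner (B x) y = inner x (B y)"
    and norm_B_sq_le: "(norm (B x))\<^sup>2 \<le> inner (B x) x"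
begin

sublocale B: bounded_linear B by (rule bounded_linear_B)

lemma B_minus: "B (- x) = - B x"
  using B.scaleR[of "-1" x] by simp

definition op_poly :: "real poly \<Rightarrow> 'a \<Rightarrow> 'a" where
  "op_poly p = fold_coeffs (\<lambda>a f x. a *\<^sub>R x + B (f x)) p (\<lambda>_. 0)"

lemma op_poly_0 [simp]: "op_poly 0 x = 0"
  by (simp add: op_poly_def)

lemma op_poly_pCons [simp]: "op_poly (pCons a p) x = a *\<^sub>R x + B (op_poly p x)"
  by (cases "a = 0"; cases "p = 0") (simp_all add: op_poly_def B.zero)

lemma op_poly_add: "op_poly (p + q) x = op_poly p x + op_poly q x"
  by (induction p q rule: poly_induct2) (simp_all add: B.add algebra_simps)

lemma op_poly_smult: "op_poly (smult c p) x = c *\<^sub>R op_poly p x"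
  by (induction p) (simp_all add: B.scaleR scaleR_right_distrib)

lemma op_poly_mult: "op_poly (p * q) x = op_poly p (op_poly q x)"
  by (induction p) (simp_all add: op_poly_add op_poly_smult)

lemma op_poly_1 [simp]: "op_poly 1 x = x"
  by (simp add: one_pCons B.zero)

lemma bounded_linear_op_poly: "bounded_linear (\<lambda>x. op_poly p x)"
proof (induction p)
  case 0
  then show ?case by simp
next
  case (pCons a p)
  have "bounded_linear (\<lambda>x. a *\<^sub>R x + B (op_poly p x))"
    by (intro bounded_linear_add bounded_linear_scaleR_right
        bounded_linear_compose[OF bounded_linear_B pCons.IH])
  then show ?case by simp
qed

lemma B_op_poly: "B (op_poly p x) = op_poly p (B x)"
  by (induction p) (simp_all add: B.zero B.add B.scaleR)

lemma op_poly_sym: "inner (op_poly p x) y = inner x (op_poly p y)"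
  by (induction p arbitrary: x y) (simp_all add: inner_add_left inner_add_right B_sym flip: B_op_poly)

text \<open>Splitting off even powers writes x^k (1 - x)^m as q r q, where q(B) is symmetric and
  \<open>r\<close> is one of 1, x, 1 - x, x (1 - x). Positivity of the last case is
  \<open>norm_B_sq_le\<close>, that is B^2 \<le> B, and it implies the others.\<close>

lemma op_poly_Bernstein_nonneg: "0 \<le> inner (op_poly ([:0, 1:] ^ k * [:1, -1:] ^ m) x) x"
proof -
  let ?X = "[:0, 1:] :: real poly" and ?Y = "[:1, -1:] :: real poly"
  define q where "q = ?X ^ (k div 2) * ?Y ^ (m div 2)"
  define r where "r = ?X ^ (k mod 2) * ?Y ^ (m mod 2)"
  define y where "y = op_poly q x"
  have "?X ^ k = ?X ^ (2 * (k div 2) + k mod 2)" "?Y ^ m = ?Y ^ (2 * (m div 2) + m mod 2)" by simp_all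
  then have "?X ^ k * ?Y ^ m = q * (r * q)"
    unfolding q_def r_def power_add power_mult power2_eq_square power_mult_distrib by (simp only: mult_ac)
  then have "inner (op_poly (?X ^ k * ?Y ^ m) x) x = inner (op_poly r y) y"
    by (simp add: op_poly_mult op_poly_sym y_def)
  moreover have "0 \<le> inner (op_poly r y) y"
  proof -
    have pos: "0 \<le> inner (B y) y" for y using norm_B_sq_le[of y] zero_le_power2[of "norm (B y)"] by linarith
    have "(norm (B y))\<^sup>2 \<le> norm (B y) * norm y" 
      using norm_B_sq_le[of y] norm_cauchy_schwarz[of "B y" y] by linarith
    then have "norm (B y) \<le> norm y" by (cases "B y = 0") (auto simp: power2_eq_square)
    then have "inner (B y) y \<le> norm y * norm y"
      using norm_cauchy_schwarz[of "B y" y] mult_right_mono[of "norm (B y)" "norm y" "norm y"] by simp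
    then have le: "inner (B y) y \<le> inner y y" by (simp add: power2_eq_square flip: power2_norm_eq_inner)
    consider "r = 1" | "r = ?X" | "r = ?Y" | "r = ?X * ?Y"
      unfolding r_def using mod_less_divisor[of 2 k] mod_less_divisor[of 2 m]
      by (cases "k mod 2 = 0"; cases "m mod 2 = 0") (auto simp: mod2_eq_if split: if_splits)
    then show ?thesis
    proof cases
      case 4
      then show ?thesis using norm_B_sq_le[of y]
        by (simp add: B.zero B.diff B.add B.scaleR inner_diff_left B_sym power2_norm_eq_inner inner_add_left B_minus)
    qed (use pos le in \<open>simp_all add: B.zero B_minus inner_diff_left inner_add_left\<close>)
  qed
  ultimately show ?thesis by simp
qed

definition moment_measure :: "'a \<Rightarrow> real measure" where
  "moment_measure x = (SOME M. finite_measure M \<and> sets M = sets borel \<and> (AE l in M. l \<in> {0..1}) \<and>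
     (\<forall>p. inner (op_poly p x) x = integral\<^sup>L M (poly p)))"

lemma moment_measure:
  shows finite_moment_measure: "finite_measure (moment_measure x)"
    and sets_moment_measure: "sets (moment_measure x) = sets borel"
    and AE_moment_measure: "AE l in moment_measure x. l \<in> {0..1}"
    and moments: "inner (op_poly p x) x = integral\<^sup>L (moment_measure x) (poly p)"
proof -
  interpret moment_functional "\<lambda>p. inner (op_poly p x) x"
    by standard (simp_all add: op_poly_add op_poly_smult inner_add_left op_poly_Bernstein_nonneg)
  have "\<exists>M. finite_measure M \<and> sets M = sets borel \<and> (AE l in M. l \<in> {0..1}) \<and>
     (\<forall>p. inner (op_poly p x) x = integral\<^sup>L M (poly p))"
    using Hausdorff by metis
  from someI_ex[OF this, folded moment_measure_def] 
  show "finite_measure (moment_measure x)" "sets (moment_measure x) = sets borel"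
    "AE l in moment_measure x. l \<in> {0..1}" 
    "inner (op_poly p x) x = integral\<^sup>L (moment_measure x) (poly p)"
    by auto
qed

text \<open>Polynomials are clamped to \<open>[0, 1]\<close>, where the measures live, so as to be bounded.\<close>
definition clamped_poly :: "real poly \<Rightarrow> real \<Rightarrow> real" where
  "clamped_poly p l = poly p (max 0 (min 1 l))"

lemma clamped_poly_eq: "l \<in> {0..1} \<Longrightarrow> clamped_poly p l = poly p l"
  by (simp add: clamped_poly_def)

lemma bdd_borel_clamped_poly: "bdd_borel (clamped_poly p)"
proof -
  obtain K where "\<And>l. \<bar>clamped_poly p l\<bar> \<le> K"
    using bounded_poly_clamp[of p] by (auto simp: clamped_poly_def)
  moreover have "clamped_poly p \<in> borel_measurable borel" unfolding clamped_poly_def by measurable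
  ultimately show ?thesis by (intro bdd_borelI)
qed

lemma integral_clamped_poly:
  assumes w: "w \<in> borel_measurable borel"
  shows "(\<integral>l. w l * clamped_poly p l \<partial>moment_measure x) = (\<integral>l. w l * poly p l \<partial>moment_measure x)"
proof (rule integral_cong_AE)
  have [measurable]: "clamped_poly p \<in> borel_measurable borel"
    using bdd_borel_clamped_poly by (rule bdd_borel_measurable)
  show "(\<lambda>l. w l * clamped_poly p l) \<in> borel_measurable (moment_measure x)"
    "(\<lambda>l. w l * poly p l) \<in> borel_measurable (moment_measure x)"
    unfolding measurable_cong_sets[OF sets_moment_measure refl] using w by measurable
  show "AE l in moment_measure x. w l * clamped_poly p l = w l * poly p l"
    using AE_moment_measure by eventually_elim (simp add: clamped_poly_eq)
qed

text \<open>Second instance of the calculus: the tests are polynomials with operators p(B), and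
  determinacy is that of the moment problem. It makes the arbitrarily chosen moment measures depend
  quadratically on the vector.\<close>

sublocale moment: spectral_form moment_measure clamped_poly op_poly UNIV
proof (rule spectral_form.intro)
  show "\<And>x. finite_measure (moment_measure x)" by (rule finite_moment_measure)
  show "\<And>x. sets (moment_measure x) = sets borel" by (rule sets_moment_measure)
  show "\<And>p. bdd_borel (clamped_poly p)" by (rule bdd_borel_clamped_poly)
  show "\<And>p. bounded_linear (op_poly p)" by (rule bounded_linear_op_poly)
  show "\<And>p x y. inner (op_poly p x) y = inner x (op_poly p y)" by (rule op_poly_sym)
  show "\<And>p x. integral\<^sup>L (moment_measure x) (clamped_poly p) = inner (op_poly p x) x"
    using integral_clamped_poly[of "\<lambda>_. 1"] moments by simp
  show "\<And>p q. \<exists>k\<in>UNIV. clamped_poly k = (\<lambda>l. clamped_poly p l * clamped_poly q l) \<and>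
      op_poly k = (\<lambda>x. op_poly p (op_poly q x))"
    subgoal for p q
      by (intro bexI[of _ "p * q"]) (auto simp: fun_eq_iff clamped_poly_def op_poly_mult)
    done
  show "\<exists>p\<in>UNIV. clamped_poly p = (\<lambda>l. 1) \<and> op_poly p = (\<lambda>x. x)"
    by (intro bexI[of _ 1]) (auto simp: fun_eq_iff clamped_poly_def)
next
  fix L :: "(real measure \<times> (real \<Rightarrow> real)) list" and f
  assume L: "weighted_measures L" "fst ` set L \<subseteq> range moment_measure"
    and 0: "\<And>p. p \<in> UNIV \<Longrightarrow> weighted_integral L (clamped_poly p) = 0" and f: "bdd_borel f"
  have M: "\<exists>x. M = moment_measure x" if "(M, w) \<in> set L" for M w
    using L(2) that by force
  show "weighted_integral L f = 0"
  proof (rule weighted_integral_eq_0_if_poly[OF L(1) _ _ f])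
    show "AE x in M. x \<in> {0..1}" if "(M, w) \<in> set L" for M w
      using M[OF that] AE_moment_measure by auto
    have "(\<integral>l. w l * clamped_poly p l \<partial>M) = (\<integral>l. w l * poly p l \<partial>M)" if "(M, w) \<in> set L" for M w p
      using M[OF that] L(1) that integral_clamped_poly
      by (force simp: weighted_measures_def bdd_borel_def)
    then have "weighted_integral L (clamped_poly p) = weighted_integral L (poly p)" for p
      unfolding weighted_integral_def by (intro arg_cong[of _ _ sum_list] map_cong) auto
    then show "weighted_integral L (poly p) = 0" for p using 0 by simp
  qed
qed

definition contraction_pvm :: "real set \<Rightarrow> 'a \<Rightarrow> 'a" where
  "contraction_pvm S = moment.bfun (indicator S)"

lemma proj_valued_contraction_pvm: "proj_valued_measure contraction_pvm"
  unfolding proj_valued_measure_def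
proof (intro conjI ballI allI impI)
  fix S S' :: "real set" and x y assume S: "S \<in> sets borel" and S': "S' \<in> sets borel"
  show "bounded_linear (contraction_pvm S)"
    using S unfolding contraction_pvm_def by (intro moment.bounded_linear_bfun) auto
  have int: "(\<lambda>l. indicator S l * indicator S' l) = (indicator (S \<inter> S') :: real \<Rightarrow> real)" for S S' :: "real set"
    by (auto simp: indicator_def)
  show "contraction_pvm S (contraction_pvm S x) = contraction_pvm S x"
    using S by (simp add: contraction_pvm_def moment.bfun_bfun int)
  show "inner (contraction_pvm S x) y = inner x (contraction_pvm S y)"
    using S unfolding contraction_pvm_def by (intro moment.bfun_sym) auto
  show "contraction_pvm (S \<inter> S') x = contraction_pvm S (contraction_pvm S' x)"
    using S S' by (simp add: contraction_pvm_def moment.bfun_bfun int)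
next
  show "contraction_pvm UNIV x = x" for x by (simp add: contraction_pvm_def indicator_def)
next
  fix F :: "nat \<Rightarrow> real set" and x assume F: "range F \<subseteq> sets borel" "disjoint_family F"
  have Fb: "F i \<in> sets borel" for i using F by auto
  have sum: "(\<Sum>i<n. contraction_pvm (F i) x) = moment.bfun (indicator (\<Union>i<n. F i)) x" for n
  proof (induction n)
    case 0
    have "moment.bfun (\<lambda>l. 0 * 0) x = 0 *\<^sub>R moment.bfun (\<lambda>l. 0) x" by (rule moment.bfun_cmult) auto
    then show ?case by (simp add: indicator_def)
  next
    case (Suc n)
    have "moment.bfun (\<lambda>l. indicator (\<Union>i<n. F i) l + indicator (F n) l) x
        = moment.bfun (indicator (\<Union>i<n. F i)) x + moment.bfun (indicator (F n)) x"
      using Fb by (intro moment.bfun_add) auto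
    then show ?case using Suc
      unfolding indicator_UN_Suc[OF F(2)] by (simp add: contraction_pvm_def)
  qed
  show "(\<lambda>i. contraction_pvm (F i) x) sums contraction_pvm (\<Union>i. F i) x"
    unfolding sums_def sum unfolding contraction_pvm_def
  proof (rule moment.bfun_tendsto[where K = 1])
    show "(\<lambda>n. indicator (\<Union>i<n. F i) l :: real) \<longlonglongrightarrow> indicator (\<Union>i. F i) l" for l
      by (rule LIMSEQ_indicator_UN)
    show "\<bar>indicator (\<Union>i<n. F i) l :: real\<bar> \<le> 1" for n l by (simp add: indicator_def)
    show "indicator (\<Union>i<n. F i) \<in> borel_measurable borel" for n using Fb by measurable
    show "indicator (\<Union>i. F i) \<in> borel_measurable borel" using Fb by measurable
  qed
qed

sublocale pvm contraction_pvm by standard (rule proj_valued_contraction_pvm)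

text \<open>Two calculi now coexist, \<open>moment.bfun\<close> and the one of
  \<open>contraction_pvm\<close>; equality of the measures identifies them.\<close>

lemma \<mu>_contraction_pvm: "\<mu> x = moment_measure x"
proof (rule measure_eqI)
  show "sets (\<mu> x) = sets (moment_measure x)" by (simp add: sets_moment_measure)
  fix S assume "S \<in> sets (\<mu> x)"
  then have S: "S \<in> sets borel" by simp
  interpret finite_measure "moment_measure x" by (rule finite_moment_measure)
  have "(norm (contraction_pvm S x))\<^sup>2 = inner (moment.bfun (indicator S) x) x"
    using inner_E[OF S, of x] by (simp add: contraction_pvm_def inner_commute)
  also have "\<dots> = measure (moment_measure x) S"
    using S by (simp add: moment.inner_bfun_self)
  finally show "emeasure (\<mu> x) S = emeasure (moment_measure x) S"
    using S by (simp add: emeasure_\<mu> emeasure_eq_measure)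
qed

lemma contraction_pvm_support: "contraction_pvm {0..1} x = x"
proof -
  have "emeasure (moment_measure x) (- {0..1}) = 0"
    using AE_moment_measure[of x] by (subst (asm) AE_iff_measurable[OF _ refl]) (auto simp: Compl_eq sets_moment_measure)
  then have "contraction_pvm (- {0..1}) x = 0" by (simp add: emeasure_\<mu> flip: \<mu>_contraction_pvm)
  then show ?thesis by (simp add: E_Compl)
qed

lemma bfun_clamp: "bfun (\<lambda>l. max 0 (min 1 l)) x = B x"
proof -
  have t: "(\<lambda>l. max 0 (min 1 l)) = clamped_poly [:0, 1:]" by (auto simp: clamped_poly_def)
  have "moment.polar = polar" by (intro ext) (simp add: moment.polar_def polar_def \<mu>_contraction_pvm)
  then have eq: "inner (bfun (clamped_poly [:0, 1:]) x) y = inner (op_poly [:0, 1:] x) y" for y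
    by (simp add: inner_bfun bdd_borel_clamped_poly moment.polar_test[symmetric] del: op_poly_pCons)
  show ?thesis unfolding t by (rule eq_if_inner_eq) (simp add: eq B.zero)
qed

end


section \<open>Reduction of a self-adjoint operator to its resolvent\<close>

lemma dense_inner_eq:
  fixes u v :: "'a::real_inner"
  assumes "closure D = UNIV" "\<And>x. x \<in> D \<Longrightarrow> inner x u = inner x v"
  shows "u = v"
proof -
  have "closed {x. inner x u = inner x v}" by (intro closed_Collect_eq continuous_intros)
  then have "closure D \<subseteq> {x. inner x u = inner x v}"
    using assms(2) by (intro closure_minimal) auto
  then have "inner x u = inner x v" for x using assms(1) by auto
  then show ?thesis by (metis eq_if_inner_eq inner_commute)
qed

locale nonneg_selfadjoint =
  fixes A :: "'a::{real_inner, complete_space} \<rightharpoonup> 'a"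
  assumes selfadjoint: "selfadjoint_op A" and nonneg: "nonneg_op A"
begin

abbreviation D :: "'a set" where "D \<equiv> dom A"
abbreviation op :: "'a \<Rightarrow> 'a" where "op \<equiv> op_app A"

lemma subspace_D: "subspace D"
  and op_add: "x \<in> D \<Longrightarrow> y \<in> D \<Longrightarrow> op (x + y) = op x + op y"
  and op_scaleR: "x \<in> D \<Longrightarrow> op (c *\<^sub>R x) = c *\<^sub>R op x"
  and dense_D: "closure D = UNIV" and adjoint_A: "adjoint_op A = A"
  using selfadjoint unfolding selfadjoint_op_def linear_op_def by auto

lemma op_nonneg: "x \<in> D \<Longrightarrow> 0 \<le> inner x (op x)"
  using nonneg by (auto simp: nonneg_op_def)

lemma op_0: "0 \<in> D" "op 0 = 0"
  using subspace_0[OF subspace_D] op_scaleR[of 0 0] by auto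

lemma op_diff: assumes "x \<in> D" "y \<in> D" shows "x - y \<in> D" "op (x - y) = op x - op y"
proof -
  have "-1 *\<^sub>R y \<in> D" using assms subspace_scale[OF subspace_D] by blast
  then show "x - y \<in> D" "op (x - y) = op x - op y"
    using op_add[of x "-1 *\<^sub>R y"] op_scaleR[of y "-1"] assms subspace_diff[OF subspace_D] by simp_all
qed

lemma A_Some: "x \<in> D \<Longrightarrow> A x = Some (op x)"
  by (auto simp: op_app_def dom_def)

text \<open>Self-adjointness as a membership test: whatever acts like a value of the adjoint already
  is a value of \<open>A\<close>. Closedness of \<open>A\<close> is obtained through this as
  well.\<close>

lemma in_domI:
  assumes z: "\<And>x. x \<in> D \<Longrightarrow> inner (op x) y = inner x z"
  shows "y \<in> D" "op y = z"
proof -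
  have "(THE z. \<forall>x\<in>D. inner (op x) y = inner x z) = z"
  proof (rule the_equality)
    fix z' assume "\<forall>x\<in>D. inner (op x) y = inner x z'"
    then show "z' = z" using z by (intro dense_inner_eq[OF dense_D]) auto
  qed (use z in blast)
  then have "adjoint_op A y = Some z" using z by (auto simp: adjoint_op_def)
  then show "y \<in> D" "op y = z" by (auto simp: adjoint_A op_app_def)
qed

lemma op_sym: assumes "x \<in> D" "y \<in> D" shows "inner (op x) y = inner x (op y)"
proof -
  have "adjoint_op A y \<noteq> None" using assms(2) by (auto simp: adjoint_A)
  then obtain z where z: "\<forall>x\<in>D. inner (op x) y = inner x z"
    by (auto simp: adjoint_op_def split: if_splits)
  then have "op y = z" by (intro in_domI) auto
  then show ?thesis using z assms by simp
qed

lemma norm_le_norm_resolvent: assumes "x \<in> D" shows "norm x \<le> norm (x + op x)"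
proof -
  have "(norm x)\<^sup>2 \<le> (norm x)\<^sup>2 + 2 * inner x (op x) + (norm (op x))\<^sup>2" using op_nonneg[OF assms] by simp
  also have "\<dots> = (norm (x + op x))\<^sup>2"
    by (simp add: power2_norm_eq_inner inner_add_left inner_add_right inner_commute)
  finally show ?thesis by (rule power2_le_imp_le) simp
qed

text \<open>The range of 1 + A is closed, because 1 + A is bounded below and \<open>A\<close> is
  closed. A vector \<open>v\<close> orthogonal to it satisfies A v = - v, which nonnegativity allows
  only for v = 0.\<close>

lemma surj_resolvent: "\<exists>x\<in>D. x + op x = y"
proof -
  define R where "R = (\<lambda>x. x + op x) ` D"
  have "subspace R"
    unfolding subspace_def R_def
  proof (intro conjI ballI allI)
    show "0 \<in> (\<lambda>x. x + op x) ` D" using op_0 by (intro image_eqI[of _ _ 0]) auto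
  next
    fix u v assume "u \<in> (\<lambda>x. x + op x) ` D" "v \<in> (\<lambda>x. x + op x) ` D"
    then obtain a b where "u = a + op a" "v = b + op b" "a \<in> D" "b \<in> D" by blast
    then show "u + v \<in> (\<lambda>x. x + op x) ` D"
      using subspace_add[OF subspace_D] by (intro image_eqI[of _ _ "a + b"]) (auto simp: op_add)
  next
    fix c u assume "u \<in> (\<lambda>x. x + op x) ` D"
    then obtain a where "u = a + op a" "a \<in> D" by blast
    then show "c *\<^sub>R u \<in> (\<lambda>x. x + op x) ` D"
      using subspace_scale[OF subspace_D]
      by (intro image_eqI[of _ _ "c *\<^sub>R a"]) (auto simp: op_scaleR scaleR_right_distrib)
  qed
  moreover have "closed R"
    unfolding closed_sequential_limits
  proof (intro allI impI)
    fix r y assume "(\<forall>n. r n \<in> R) \<and> r \<longlonglongrightarrow> y"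
    then have r: "\<And>n. r n \<in> R" and lim: "r \<longlonglongrightarrow> y" by auto
    obtain x where x: "\<And>n. x n \<in> D" "\<And>n. r n = x n + op (x n)" using r unfolding R_def by (auto simp: image_iff) metis
    have "Cauchy x"
    proof (rule metric_CauchyI)
      fix e :: real assume "0 < e"
      then obtain N where N: "\<And>m n. N \<le> m \<Longrightarrow> N \<le> n \<Longrightarrow> dist (r m) (r n) < e"
        using metric_CauchyD[OF LIMSEQ_imp_Cauchy[OF lim]] by blast
      have "dist (x m) (x n) \<le> dist (r m) (r n)" for m n
        using norm_le_norm_resolvent[OF op_diff(1)[OF x(1) x(1)], of m n] x op_diff(2)[OF x(1) x(1), of m n]
        by (simp add: dist_norm algebra_simps)
      then show "\<exists>M. \<forall>m\<ge>M. \<forall>n\<ge>M. dist (x m) (x n) < e" using N le_less_trans by blast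
    qed
    then obtain l where l: "x \<longlonglongrightarrow> l" using Cauchy_convergent_iff convergent_def by blast
    have opx: "op (x n) = r n - x n" for n using x(2) by simp
    have "inner (op w) l = inner w (y - l)" if w: "w \<in> D" for w
    proof (rule LIMSEQ_unique)
      show "(\<lambda>n. inner (op w) (x n)) \<longlonglongrightarrow> inner (op w) l" by (intro tendsto_intros l)
      show "(\<lambda>n. inner (op w) (x n)) \<longlonglongrightarrow> inner w (y - l)"
        unfolding op_sym[OF w x(1)] opx by (intro tendsto_intros l lim)
    qed
    then have "l \<in> D" "op l = y - l" using in_domI[of l "y - l"] by blast+
    then show "y \<in> R" unfolding R_def by (intro image_eqI[of _ _ l]) auto
  qed
  ultimately obtain z where z: "z \<in> R" "\<And>s. s \<in> R \<Longrightarrow> inner (y - z) s = 0"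
    using closed_subspace_projection by blast
  define v where "v = y - z"
  have "inner (op x) v = inner x (- v)" if x: "x \<in> D" for x
  proof -
    have "inner v (x + op x) = 0" unfolding v_def by (rule z(2)) (use x in \<open>auto simp: R_def\<close>)
    then show ?thesis by (simp add: inner_add_right inner_commute)
  qed
  then have "v \<in> D" "op v = - v" using in_domI[of v "- v"] by blast+
  then have "inner v v \<le> 0" using op_nonneg[of v] by simp
  then have "v = 0" using inner_ge_zero[of v] by (metis antisym inner_eq_zero_iff)
  then show ?thesis using z(1) by (auto simp: v_def R_def)
qed

definition resolvent :: "'a \<Rightarrow> 'a" where
  "resolvent y = (SOME x. x \<in> D \<and> x + op x = y)"

lemma resolvent: "resolvent y \<in> D" "resolvent y + op (resolvent y) = y"
proof -
  have "\<exists>x. x \<in> D \<and> x + op x = y" using surj_resolvent by blast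
  from someI_ex[OF this] show "resolvent y \<in> D" "resolvent y + op (resolvent y) = y"
    unfolding resolvent_def by auto
qed

lemma resolvent_unique: assumes "x \<in> D" "x + op x = y" shows "resolvent y = x"
proof -
  let ?d = "resolvent y - x"
  have "?d + op ?d = 0" using resolvent[of y] assms by (simp add: op_diff algebra_simps)
  then have "norm ?d \<le> 0"
    using norm_le_norm_resolvent[OF op_diff(1)[OF resolvent(1) assms(1)], of y] by simp
  then show ?thesis by simp
qed

text \<open>With x = (1 + A)^-1 u one has <x, u> = |x|^2 + <x, A x>, so the contraction inequality
  is nonnegativity of \<open>A\<close>.\<close>

sublocale positive_contraction resolvent
proof
  show add: "resolvent (u + v) = resolvent u + resolvent v" for u v
    using resolvent[of u] resolvent[of v] 
    by (intro resolvent_unique subspace_add[OF subspace_D]) (auto simp: op_add algebra_simps)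
  show scale: "resolvent (c *\<^sub>R u) = c *\<^sub>R resolvent u" for c u
    using resolvent[of u]
    by (intro resolvent_unique subspace_scale[OF subspace_D]) (auto simp: op_scaleR simp flip: scaleR_right_distrib)
  have "norm (resolvent u) \<le> norm u * 1" for u
    using norm_le_norm_resolvent[OF resolvent(1)[of u]] by (simp add: resolvent(2))
  then show "\<exists>K. \<forall>u. norm (resolvent u) \<le> norm u * K" by blast
  show "inner (resolvent u) v = inner u (resolvent v)" for u v
  proof -
    have "inner (resolvent u) (resolvent v + op (resolvent v)) = inner (resolvent u + op (resolvent u)) (resolvent v)"
      by (simp add: inner_add_left inner_add_right op_sym resolvent(1))
    then show ?thesis by (simp only: resolvent(2))
  qed
  show "(norm (resolvent u))\<^sup>2 \<le> inner (resolvent u) u" for u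
  proof -
    have "inner (resolvent u) u = inner (resolvent u) (resolvent u + op (resolvent u))" by (simp only: resolvent(2))
    then show ?thesis
      using op_nonneg[OF resolvent(1)[of u]] by (simp add: inner_add_right power2_norm_eq_inner)
  qed
qed

text \<open>The spectral measure of \<open>A = B\<^sup>-\<^sup>1 - 1\<close> with \<open>B = (1 + A)\<^sup>-\<^sup>1\<close> is the push-forward of that of \<open>B\<close>.\<close>
definition inv_map :: "real \<Rightarrow> real" where "inv_map b = 1 / b - 1"

lemma inv_map_measurable [measurable]: "inv_map \<in> borel_measurable borel"
  unfolding inv_map_def by measurable

text \<open>The resolvent is injective, so 0 is not an atom. This removes the point where
  \<open>inv_map\<close> takes the conventional value -1.\<close>

lemma AE_pos: "AE b in \<mu> x. b \<in> {0<..1}"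
proof -
  have "bfun (\<lambda>l. max 0 (min 1 l) * indicator {0} l) x = bfun (\<lambda>l. 0) x"
    by (rule arg_cong[of _ _ "\<lambda>f. bfun f x"]) (auto simp: indicator_def fun_eq_iff)
  moreover have "bfun (\<lambda>l. 0) x = 0"
    using bfun_cmult[of "\<lambda>l. 0" 0 x] by simp
  moreover have c: "bdd_borel (\<lambda>l. max 0 (min 1 l))" by (rule bdd_borelI[of _ 1]) auto
  ultimately have "resolvent (contraction_pvm {0} x) = 0"
    using bfun_bfun[OF c, of "indicator {0}" x] by (simp add: bfun_indicator bfun_clamp)
  then have "contraction_pvm {0} x = 0"
    using resolvent(2)[of "contraction_pvm {0} x"] by (simp add: op_0)
  then have "AE b in \<mu> x. b \<in> - {0}" by (intro AE_\<mu>_in) (auto simp: E_Compl)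
  moreover have "AE b in \<mu> x. b \<in> {0..1}" by (intro AE_\<mu>_in contraction_pvm_support) auto
  ultimately show ?thesis by eventually_elim auto
qed

text \<open>Multiplication by b tames \<open>inv_map\<close>: b (1/b - 1) = 1 - b on (0, 1]. Hence
  every B y lies in the spectral domain, with value y - B y, and conversely every x there equals B
  applied to x plus its value.\<close>

lemma spectral_integral_inv_map: "spectral_integral contraction_pvm inv_map = A"
proof -
  let ?c = "\<lambda>l::real. max 0 (min 1 l)"
  have c: "bdd_borel ?c" by (rule bdd_borelI[of _ 1]) auto
  have cg: "bdd_borel (\<lambda>l. ?c l * inv_map l)"
  proof (rule bdd_borelI)
    show "\<bar>?c l * inv_map l\<bar> \<le> 1" for l
      by (cases "l \<le> 0"; cases "l \<le> 1") (auto simp: inv_map_def max_def min_def field_simps abs_le_iff)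
  qed measurable
  have c1: "bdd_borel (\<lambda>l. 1 - ?c l)" using c by auto
  have eq: "bfun (\<lambda>l. ?c l * inv_map l) x = x - resolvent x" for x
  proof -
    have "bfun (\<lambda>l. ?c l * inv_map l) x = bfun (\<lambda>l. 1 - ?c l) x"
      by (rule bfun_cong_AE[OF cg c1]) (use AE_pos in eventually_elim, auto simp: inv_map_def field_simps)
    also have "\<dots> = bfun (\<lambda>l. 1) x - bfun ?c x" by (rule bfun_diff[OF _ c]) simp
    finally show ?thesis by (simp add: bfun_clamp)
  qed
  have 1: "spectral_integral contraction_pvm inv_map x = A x" if x: "x \<in> D" for x
  proof -
    define y where "y = x + op x"
    have r: "resolvent y = x" using resolvent_unique[OF x] by (simp add: y_def)
    have "x \<in> sdom inv_map" "ufun inv_map x = op x"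
      using bfun_in_sdom[OF inv_map_measurable c cg, of y] unfolding eq bfun_clamp r
      by (simp_all add: y_def)
    then show ?thesis using x by (simp add: spectral_integral_eq A_Some)
  qed
  have 2: "x \<in> D" if x: "x \<in> sdom inv_map" for x
  proof -
    have "bfun ?c (x + ufun inv_map x) = bfun ?c x + bfun (\<lambda>l. ?c l * inv_map l) x"
      by (simp add: bfun_vadd[OF c] bfun_ufun[OF inv_map_measurable x c cg])
    also have "\<dots> = x" by (simp add: eq bfun_clamp)
    finally have "resolvent (x + ufun inv_map x) = x" by (simp add: bfun_clamp)
    then show ?thesis using resolvent(1) by metis
  qed
  show ?thesis
  proof
    fix x
    show "spectral_integral contraction_pvm inv_map x = A x"
    proof (cases "x \<in> D")
      case False
      then have "x \<notin> sdom inv_map" using 2 by blast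
      then show ?thesis using False by (simp add: spectral_integral_def domIff)
    qed (rule 1)
  qed
qed

definition pushed_pvm :: "real set \<Rightarrow> 'a \<Rightarrow> 'a" where
  "pushed_pvm S = contraction_pvm (inv_map -` S)"

lemma inv_map_vimage: "S \<in> sets borel \<Longrightarrow> inv_map -` S \<in> sets borel"
  using measurable_sets_borel[OF inv_map_measurable] by simp

lemma proj_valued_pushed_pvm: "proj_valued_measure pushed_pvm"
  unfolding proj_valued_measure_def
proof (intro conjI ballI allI impI)
  fix S S' :: "real set" and x y assume S: "S \<in> sets borel" and S': "S' \<in> sets borel"
  note V = inv_map_vimage[OF S] inv_map_vimage[OF S']
  show "bounded_linear (pushed_pvm S)" "pushed_pvm S (pushed_pvm S x) = pushed_pvm S x"
    "inner (pushed_pvm S x) y = inner x (pushed_pvm S y)"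
    "pushed_pvm (S \<inter> S') x = pushed_pvm S (pushed_pvm S' x)"
    using V unfolding pushed_pvm_def by (auto simp: bounded_linear_E E_idem E_sym E_Int)
next
  show "pushed_pvm UNIV x = x" for x by (simp add: pushed_pvm_def)
next
  fix F :: "nat \<Rightarrow> real set" and x assume F: "range F \<subseteq> sets borel" "disjoint_family F"
  show "(\<lambda>i. pushed_pvm (F i) x) sums pushed_pvm (\<Union>i. F i) x"
    unfolding pushed_pvm_def vimage_UN
    by (rule E_sums) (use F inv_map_vimage in \<open>auto simp: disjoint_family_on_def\<close>)
qed

lemma spectral_theorem: "\<exists>E. proj_valued_measure E \<and> spectral_integral E (\<lambda>l. l) = A"
proof (intro exI conjI)
  show "proj_valued_measure pushed_pvm" by (rule proj_valued_pushed_pvm)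
  interpret P: pvm pushed_pvm by standard (rule proj_valued_pushed_pvm)
  have \<mu>P: "scalar_measure pushed_pvm x = distr (\<mu> x) borel inv_map" for x
  proof (rule measure_eqI)
    fix S assume "S \<in> sets (scalar_measure pushed_pvm x)"
    then have S: "S \<in> sets borel" by simp
    show "emeasure (scalar_measure pushed_pvm x) S = emeasure (distr (\<mu> x) borel inv_map) S"
      using S inv_map_vimage[OF S]
      by (simp add: P.emeasure_\<mu> emeasure_distr emeasure_\<mu> pushed_pvm_def)
  qed simp
  have "spectral_dom pushed_pvm (\<lambda>l. l) = sdom inv_map"
    unfolding spectral_dom_def \<mu>P by (simp add: integrable_distr_eq)
  moreover have "integral\<^sup>L (scalar_measure pushed_pvm x) (\<lambda>l. l) = integral\<^sup>L (\<mu> x) inv_map" for x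
    unfolding \<mu>P by (subst integral_distr) auto
  ultimately have "spectral_integral pushed_pvm (\<lambda>l. l) = spectral_integral contraction_pvm inv_map"
    unfolding spectral_integral_def by (simp cong: if_cong)
  then show "spectral_integral pushed_pvm (\<lambda>l. l) = A" by (simp add: spectral_integral_inv_map)
qed

end

subsection \<open>Functional calculus of the operator \<open>A\<close>\<close>

text \<open>The bridge to \<open>C1_Hs\<close>, which is phrased with difference quotients.\<close>

lemma has_vector_derivative_iff_tendsto:
  fixes f :: "real \<Rightarrow> 'a::real_normed_vector"
  shows "(f has_vector_derivative D) (at t) \<longleftrightarrow> ((\<lambda>\<tau>. (f \<tau> - f t) /\<^sub>R (\<tau> - t)) \<longlongrightarrow> D) (at t)"
proof -
  have "\<forall>\<^sub>F y in at t. norm ((1 / norm (y - t)) *\<^sub>R (f y - (f t + (y - t) *\<^sub>R D))) = norm ((f y - f t) /\<^sub>R (y - t) - D)"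
    unfolding eventually_at_filter
  proof (intro always_eventually allI impI)
    fix y assume "y \<noteq> t"
    then have "f y - (f t + (y - t) *\<^sub>R D) = (y - t) *\<^sub>R ((f y - f t) /\<^sub>R (y - t) - D)"
      by (simp add: scaleR_diff_right)
    then show "norm ((1 / norm (y - t)) *\<^sub>R (f y - (f t + (y - t) *\<^sub>R D))) = norm ((f y - f t) /\<^sub>R (y - t) - D)"
      using \<open>y \<noteq> t\<close> by simp
  qed
  then have "((\<lambda>y. norm ((1 / norm (y - t)) *\<^sub>R (f y - (f t + (y - t) *\<^sub>R D)))) \<longlongrightarrow> 0) (at t)
      \<longleftrightarrow> ((\<lambda>y. norm ((f y - f t) /\<^sub>R (y - t) - D)) \<longlongrightarrow> 0) (at t)"
    by (rule tendsto_cong)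
  then show ?thesis
    unfolding has_vector_derivative_def has_derivative_within tendsto_norm_zero_iff LIM_zero_iff
    by (simp only: bounded_linear_scaleR_left simp_thms)
qed

lemma ennreal_power2_leD: "ennreal (a\<^sup>2) \<le> ennreal (b\<^sup>2) \<Longrightarrow> 0 \<le> b \<Longrightarrow> a \<le> b"
  by (metis ennreal_le_iff power2_le_imp_le zero_le_power2)

lemma ennreal_power2_eqD: "ennreal (a\<^sup>2) = ennreal (b\<^sup>2) \<Longrightarrow> 0 \<le> a \<Longrightarrow> 0 \<le> b \<Longrightarrow> a = b"
  by (metis antisym ennreal_power2_leD order_refl)

locale nonneg_spectral = pvm E
  for E :: "real set \<Rightarrow> 'a::{real_inner, complete_space} \<Rightarrow> 'a" +
  fixes A :: "'a \<rightharpoonup> 'a"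
  assumes spectral_integral_A: "spectral_integral E (\<lambda>l. l) = A" and nonneg: "nonneg_op A"
    and spectral_measure_A: "spectral_measure A = E"
begin

lemma dom_A: "dom A = sdom (\<lambda>l. l)"
  using dom_spectral_integral[of "\<lambda>l. l"] by (simp add: spectral_integral_A)

lemma op_app_A: "x \<in> dom A \<Longrightarrow> op_app A x = ufun (\<lambda>l. l) x"
  using op_app_spectral_integral[of "\<lambda>l. l" x] by (simp add: spectral_integral_A dom_A)

lemma bfun_op_app:
  assumes x: "x \<in> dom A" and h: "bdd_borel h" "bdd_borel (\<lambda>l. h l * l)"
  shows "bfun h (op_app A x) = bfun (\<lambda>l. h l * l) x"
proof -
  have "(\<lambda>l::real. l) \<in> borel_measurable borel" by measurable
  moreover have "x \<in> sdom (\<lambda>l. l)" using x by (simp only: dom_A)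
  ultimately show ?thesis unfolding op_app_A[OF x] by (rule bfun_ufun[OF _ _ h])
qed

lemma fun_op_eq: "fun_op A f = spectral_integral E f"
  by (simp add: fun_op_def spectral_measure_A)

text \<open>Projecting to the band from -n to 0 gives a vector in \<open>dom A\<close> whose form is
  the integral of a nonpositive function; nonnegativity of \<open>A\<close> forces this integral to
  vanish.\<close>

lemma AE_nonneg: "AE l in \<mu> x. 0 \<le> l"
proof -
  have "AE l in \<mu> x. l \<notin> {- real n..<0}" for n
  proof -
    let ?S = "{- real n..<0}"
    have h: "bdd_borel (indicator ?S)" by auto
    have hl: "bdd_borel (\<lambda>l. indicator ?S l * l)"
    proof (rule bdd_borelI)
      show "\<bar>indicator ?S l * l\<bar> \<le> real n" for l by (auto simp: indicator_def)
    qed measurable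
    have "bfun (indicator ?S) x \<in> dom A" 
      and "op_app A (bfun (indicator ?S) x) = bfun (\<lambda>l. indicator ?S l * l) x"
      using bfun_in_sdom[of "\<lambda>l. l", OF _ h hl, of x] by (simp_all add: dom_A op_app_A)
    then have "0 \<le> inner (bfun (indicator ?S) x) (bfun (\<lambda>l. indicator ?S l * l) x)"
      using nonneg unfolding nonneg_op_def by metis
    also have "\<dots> = inner (bfun (\<lambda>l. indicator ?S l * (indicator ?S l * l)) x) x"
      unfolding bfun_sym[OF h] bfun_bfun[OF h hl] by (rule inner_commute)
    also have "(\<lambda>l. indicator ?S l * (indicator ?S l * l)) = (\<lambda>l. indicator ?S l * l :: real)"
      by (auto simp: indicator_def)
    finally have "0 \<le> (\<integral>l. indicator ?S l * l \<partial>\<mu> x)" by (simp add: inner_bfun_self[OF hl])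
    moreover have "0 \<le> (\<integral>l. - (indicator ?S l * l) \<partial>\<mu> x)"
      by (rule Bochner_Integration.integral_nonneg) (auto simp: indicator_def)
    ultimately have "(\<integral>l. - (indicator ?S l * l) \<partial>\<mu> x) = 0" by simp
    moreover have "integrable (\<mu> x) (\<lambda>l. - (indicator ?S l * l))" using integrable_\<mu>[OF hl] by simp
    ultimately have "AE l in \<mu> x. - (indicator ?S l * l) = 0"
      by (subst (asm) integral_nonneg_eq_0_iff_AE) (auto simp: indicator_def)
    then show ?thesis by eventually_elim (auto simp: indicator_def)
  qed
  then have "AE l in \<mu> x. \<forall>n. l \<notin> {- real n..<0}" unfolding AE_all_countable by blast
  then show ?thesis
  proof eventually_elim
    case (elim l)
    obtain n where "- l \<le> real n" using real_arch_simple by blast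
    then show ?case using elim[rule_format, of n] by auto
  qed
qed

lemma sdom_le:
  assumes f: "f \<in> borel_measurable borel" and g: "g \<in> borel_measurable borel" and x: "x \<in> sdom f"
    and le: "\<And>l. 0 \<le> l \<Longrightarrow> (g l)\<^sup>2 \<le> (f l)\<^sup>2"
  shows "x \<in> sdom g" "norm (ufun g x) \<le> norm (ufun f x)"
proof -
  have *: "(\<integral>\<^sup>+ l. ennreal ((g l)\<^sup>2) \<partial>\<mu> x) \<le> (\<integral>\<^sup>+ l. ennreal ((f l)\<^sup>2) \<partial>\<mu> x)"
    by (rule nn_integral_mono_AE) (use AE_nonneg[of x] in eventually_elim, auto intro: ennreal_leI le)
  then show xg: "x \<in> sdom g" using x by (simp add: sdom_iff f g)
  from * have "ennreal ((norm (ufun g x))\<^sup>2) \<le> ennreal ((norm (ufun f x))\<^sup>2)"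
    by (simp only: norm_ufun_sq[OF f x] norm_ufun_sq[OF g xg])
  then show "norm (ufun g x) \<le> norm (ufun f x)" by (rule ennreal_power2_leD) simp
qed

lemma sdom_ufun_iff:
  assumes f: "f \<in> borel_measurable borel" and g: "g \<in> borel_measurable borel" and x: "x \<in> sdom f"
  shows "ufun f x \<in> sdom g \<longleftrightarrow> x \<in> sdom (\<lambda>l. g l * f l)"
    and "ufun f x \<in> sdom g \<Longrightarrow> norm (ufun g (ufun f x)) = norm (ufun (\<lambda>l. g l * f l) x)"
proof -
  have gf: "(\<lambda>l. g l * f l) \<in> borel_measurable borel" using f g by simp
  have *: "(\<integral>\<^sup>+ l. ennreal ((g l)\<^sup>2) \<partial>\<mu> (ufun f x)) = (\<integral>\<^sup>+ l. ennreal ((g l * f l)\<^sup>2) \<partial>\<mu> x)"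
    unfolding \<mu>_ufun[OF f x] using f g
    by (subst nn_integral_density) (auto simp: power_mult_distrib ennreal_mult mult.commute)
  then show iff: "ufun f x \<in> sdom g \<longleftrightarrow> x \<in> sdom (\<lambda>l. g l * f l)" by (simp add: sdom_iff g gf)
  assume "ufun f x \<in> sdom g"
  then have "ennreal ((norm (ufun g (ufun f x)))\<^sup>2) = ennreal ((norm (ufun (\<lambda>l. g l * f l) x))\<^sup>2)"
    using * iff norm_ufun_sq[OF g] norm_ufun_sq[OF gf] by simp
  then show "norm (ufun g (ufun f x)) = norm (ufun (\<lambda>l. g l * f l) x)"
    by (rule ennreal_power2_eqD) auto
qed

abbreviation bessel :: "real \<Rightarrow> real \<Rightarrow> real" where
  "bessel r \<equiv> (\<lambda>l. (1 + l) powr (r / 2))"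

lemma Hs_eq: "Hs A r = sdom (bessel r)"
  unfolding Hs_def bessel_op_def fun_op_eq dom_spectral_integral ..

lemma Hs_norm_eq: "x \<in> Hs A r \<Longrightarrow> Hs_norm A r x = norm (ufun (bessel r) x)"
  by (simp add: Hs_norm_def bessel_op_def fun_op_eq op_app_spectral_integral Hs_eq)

lemma Hs_norm_0: "x \<in> Hs A 0" "Hs_norm A 0 x = norm x"
proof -
  have *: "(\<integral>\<^sup>+ l. ennreal ((bessel 0 l)\<^sup>2) \<partial>\<mu> x) = ennreal ((norm x)\<^sup>2)"
  proof -
    have "(\<integral>\<^sup>+ l. ennreal ((bessel 0 l)\<^sup>2) \<partial>\<mu> x) = (\<integral>\<^sup>+ l. 1 \<partial>\<mu> x)"
      \<comment> \<open>At \<open>l = -1\<close> the function takes the value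
        \<open>0 powr 0\<close>, which is 0 by convention, so equality with 1 holds only almost
        everywhere.\<close>
      by (rule nn_integral_cong_AE) (use AE_nonneg[of x] in eventually_elim, simp)
    then show ?thesis by (simp add: norm_sq_eq_emeasure)
  qed
  then show x: "x \<in> Hs A 0" by (simp add: Hs_eq sdom_iff)
  have m: "bessel 0 \<in> borel_measurable borel" by measurable
  have "ennreal ((norm (ufun (bessel 0) x))\<^sup>2) = ennreal ((norm x)\<^sup>2)"
    using * norm_ufun_sq[OF m, of x] x by (simp only: Hs_eq)
  then have "norm (ufun (bessel 0) x) = norm x" by (rule ennreal_power2_eqD) auto
  then show "Hs_norm A 0 x = norm x" by (simp only: Hs_norm_eq[OF x])
qed

lemma dom_sqrt_op: "dom (sqrt_op A) = sdom sqrt"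
  by (simp add: sqrt_op_def fun_op_eq dom_spectral_integral)

lemma op_app_sqrt_op: "x \<in> sdom sqrt \<Longrightarrow> op_app (sqrt_op A) x = ufun sqrt x"
  by (simp add: sqrt_op_def fun_op_eq op_app_spectral_integral)

lemma sdom_sqrt: assumes "x \<in> dom A" shows "x \<in> sdom sqrt"
proof -
  have "(\<integral>\<^sup>+ l. ennreal ((sqrt l)\<^sup>2) \<partial>\<mu> x) \<le> (\<integral>\<^sup>+ l. ennreal (1 + l\<^sup>2) \<partial>\<mu> x)"
  proof (rule nn_integral_mono_AE)
    have le: "l \<le> 1 + l\<^sup>2" if "0 \<le> l" for l :: real
      using zero_le_power2[of "l - 1"] that by (simp add: power2_diff)
    show "AE l in \<mu> x. ennreal ((sqrt l)\<^sup>2) \<le> ennreal (1 + l\<^sup>2)"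
      using AE_nonneg[of x] by eventually_elim (intro ennreal_leI, simp add: le)
  qed
  also have "\<dots> = (\<integral>\<^sup>+ l. 1 \<partial>\<mu> x) + (\<integral>\<^sup>+ l. ennreal (l\<^sup>2) \<partial>\<mu> x)"
    by (subst nn_integral_add[symmetric]) (auto simp: ennreal_plus)
  also have "\<dots> < \<infinity>"
  proof -
    have "(\<integral>\<^sup>+ l. ennreal (l\<^sup>2) \<partial>\<mu> x) < \<infinity>" using assms by (simp add: dom_A sdom_iff)
    then show ?thesis by (simp add: emeasure_\<mu> ennreal_add_eq_top less_top)
  qed
  finally show ?thesis by (simp add: sdom_iff)
qed

lemma
  assumes x: "x \<in> dom A"
  shows integrable_A: "integrable (\<mu> x) (\<lambda>l. l)"
    and inner_A_self: "inner (op_app A x) x = (\<integral>l. l \<partial>\<mu> x)"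
proof -
  have m: "(\<lambda>l::real. l) \<in> borel_measurable borel" by measurable
  have xs: "x \<in> sdom (\<lambda>l. l)" using x by (simp only: dom_A)
  show "integrable (\<mu> x) (\<lambda>l. l)" by (rule inner_ufun_self(1)[OF m xs])
  show "inner (op_app A x) x = (\<integral>l. l \<partial>\<mu> x)"
    unfolding op_app_A[OF x] by (rule inner_ufun_self(2)[OF m xs])
qed

lemma qform_eq: assumes x: "x \<in> dom A" shows "qform A x = inner (op_app A x) x"
proof -
  have "ennreal (qform A x) = (\<integral>\<^sup>+ l. ennreal ((sqrt l)\<^sup>2) \<partial>\<mu> x)"
    using norm_ufun_sq[OF _ sdom_sqrt[OF x]]
    by (simp add: qform_def op_app_sqrt_op sdom_sqrt[OF x])
  also have "\<dots> = (\<integral>\<^sup>+ l. ennreal l \<partial>\<mu> x)"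
    by (rule nn_integral_cong_AE) (use AE_nonneg[of x] in eventually_elim, simp)
  also have "\<dots> = ennreal (\<integral>l. l \<partial>\<mu> x)"
    by (rule nn_integral_eq_integral[OF integrable_A[OF x] AE_nonneg])
  finally have "ennreal (qform A x) = ennreal (inner (op_app A x) x)" by (simp add: inner_A_self[OF x])
  moreover have "0 \<le> inner (op_app A x) x"
    unfolding inner_A_self[OF x] by (rule integral_nonneg_AE[OF AE_nonneg])
  ultimately show ?thesis by (simp add: qform_def)
qed

text \<open>At s = 2 the weight is l (1 + l), which dominates l^2. Applied to differences in time,
  the norm bound yields continuity of A q in X.\<close>

lemma calH_2_dom:
  assumes "(q, p) \<in> calH A 2"
  shows "q \<in> dom A"
    and "norm (op_app A q) \<le> Hs_norm A 1 (op_app (sqrt_op A) q)"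
proof -
  have q: "q \<in> sdom sqrt" "ufun sqrt q \<in> sdom (bessel 1)"
    using assms by (auto simp: calH_def dom_sqrt_op op_app_sqrt_op Hs_eq)
  have m: "bessel 1 \<in> borel_measurable borel" "sqrt \<in> borel_measurable borel" by measurable
  have q': "q \<in> sdom (\<lambda>l. bessel 1 l * sqrt l)" using sdom_ufun_iff(1)[OF m(2,1) q(1)] q(2) by simp
  have le: "l\<^sup>2 \<le> (bessel 1 l * sqrt l)\<^sup>2" if "0 \<le> l" for l
  proof -
    have "(bessel 1 l * sqrt l)\<^sup>2 = (1 + l) * l"
      using that by (simp add: power_mult_distrib powr_half_sqrt)
    then show ?thesis using that by (simp add: power2_eq_square algebra_simps)
  qed
  have q'': "q \<in> sdom (\<lambda>l. l)" and n: "norm (ufun (\<lambda>l. l) q) \<le> norm (ufun (\<lambda>l. bessel 1 l * sqrt l) q)"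
    by (rule sdom_le[of "\<lambda>l. bessel 1 l * sqrt l"]; use q' le in \<open>auto\<close>)+
  then show "q \<in> dom A" by (simp add: dom_A)
  then show "norm (op_app A q) \<le> Hs_norm A 1 (op_app (sqrt_op A) q)"
    using n sdom_ufun_iff(2)[OF m(2,1) q] q
    by (simp add: op_app_A op_app_sqrt_op Hs_norm_eq Hs_eq)
qed

lemma indicator_atMost_tendsto: "(\<lambda>n. bfun (indicator {..real n}) x) \<longlonglongrightarrow> x"
proof -
  have "(\<lambda>n. bfun (indicator {..real n}) x) \<longlonglongrightarrow> bfun (\<lambda>l. 1) x"
  proof (rule bfun_tendsto[where K = 1])
    fix l :: real
    obtain N where N: "l \<le> real N" using real_arch_simple by blast
    then have "\<forall>\<^sub>F n in sequentially. indicator {..real n} l = (1 :: real)"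
      unfolding eventually_sequentially by (intro exI[of _ N]) auto
    then show "(\<lambda>n. indicator {..real n} l :: real) \<longlonglongrightarrow> 1" by (rule tendsto_eventually)
  qed (auto simp: indicator_def)
  then show ?thesis by simp
qed

lemma bfun_cong_nonneg:
  assumes "bdd_borel f" "bdd_borel g" "\<And>l. 0 \<le> l \<Longrightarrow> f l = g l"
  shows "bfun f x = bfun g x"
  by (rule bfun_cong_AE[OF assms(1,2)], rule eventually_mono[OF AE_nonneg]) (rule assms(3))

lemma ufun_E_commute:
  assumes f: "f \<in> borel_measurable borel" and x: "x \<in> sdom f" and S: "S \<in> sets borel"
  shows "E S x \<in> sdom f" "ufun f (E S x) = E S (ufun f x)"
proof -
  have iS: "bdd_borel (indicator S)" using S by auto
  note bb = bdd_borel_truncate[OF f]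
  note bi = bdd_borel_cutoff[OF f]
  have "bfun (trunc f n) (E S x) = bfun (cutoff f n) (E S (ufun f x))" for n
  proof -
    have "bfun (trunc f n) (E S x) = bfun (indicator S) (bfun (trunc f n) x)"
      using bfun_bfun[OF bb iS] bfun_bfun[OF iS bb] S by (simp add: bfun_indicator[symmetric] mult.commute)
    also have "\<dots> = bfun (indicator S) (bfun (cutoff f n) (ufun f x))"
      by (simp add: bfun_truncate[OF f x])
    also have "\<dots> = bfun (cutoff f n) (E S (ufun f x))"
      using bfun_bfun[OF bi iS] bfun_bfun[OF iS bi] S by (simp add: bfun_indicator[symmetric] mult.commute)
    finally show ?thesis .
  qed
  then show "E S x \<in> sdom f" "ufun f (E S x) = E S (ufun f x)" using sdom_ufunI[OF f] by blast+
qed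

text \<open>On \<open>dom A\<close> the Cauchy sequence standing for A q in the completion has an
  honest limit, which turns the equation in the completed space into one in X.\<close>

lemma ext_op_tendsto:
  assumes x: "x \<in> dom A" shows "ext_op A x \<longlonglongrightarrow> op_app A x"
proof -
  have "ext_op A x n = bfun (indicator {..real n}) (op_app A x)" for n
  proof -
    have i: "bdd_borel (indicator {..real n})" by auto
    have "x \<in> sdom (indicator {..real n})" "ufun (indicator {..real n}) x = E {..real n} x" 
      using bfun_in_sdom[of "indicator {..real n}" "\<lambda>l. 1" x] i by (auto simp: bfun_indicator)
    then have "ext_op A x n = op_app A (E {..real n} x)"
      by (simp add: ext_op_def fun_op_eq op_app_spectral_integral)
    also have "\<dots> = E {..real n} (op_app A x)"
      using ufun_E_commute[of "\<lambda>l. l" x "{..real n}"] x by (simp add: op_app_A dom_A)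
    finally show ?thesis by (simp add: bfun_indicator)
  qed
  then have "ext_op A x = (\<lambda>n. bfun (indicator {..real n}) (op_app A x))" by (rule ext)
  then show ?thesis using indicator_atMost_tendsto[of "op_app A x"] by simp
qed

lemma proj_ge_eq: "proj_ge A \<kappa> x = E {\<kappa>\<^sup>2..} x"
proof -
  have i: "bdd_borel (indicator {\<kappa>\<^sup>2..})" by auto
  have "x \<in> sdom (indicator {\<kappa>\<^sup>2..})" "ufun (indicator {\<kappa>\<^sup>2..}) x = E {\<kappa>\<^sup>2..} x" 
    using bfun_in_sdom[of "indicator {\<kappa>\<^sup>2..}" "\<lambda>l. 1" x] i by (auto simp: bfun_indicator)
  then show ?thesis by (simp add: proj_ge_def fun_op_eq op_app_spectral_integral)
qed

lemma nn_integral_\<mu>_E: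
  assumes S: "S \<in> sets borel" and f: "f \<in> borel_measurable borel"
  shows "(\<integral>\<^sup>+ l. f l \<partial>\<mu> (E S x)) = (\<integral>\<^sup>+ l. indicator S l * f l \<partial>\<mu> x)"
proof -
  have "\<mu> (E S x) = density (\<mu> x) (indicator S)"
  proof (rule measure_eqI)
    fix T assume "T \<in> sets (\<mu> (E S x))"
    then have T: "T \<in> sets borel" by simp
    then show "emeasure (\<mu> (E S x)) T = emeasure (density (\<mu> x) (indicator S)) T"
      using S E_Int[OF T S, of x] by (simp add: emeasure_restricted emeasure_\<mu> Int_commute)
  qed simp
  then show ?thesis using S f by (simp add: nn_integral_density)
qed

text \<open>The square of \<open>calH_norm\<close> restricted to the spectral set \<open>S\<close>,
  with extended values so that no integrability has to be carried along.\<close>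

definition energy :: "real \<Rightarrow> real set \<Rightarrow> 'a \<times> 'a \<Rightarrow> ennreal" where
  "energy s S z = (\<integral>\<^sup>+ l. indicator S l * ennreal ((1 + l) powr (s - 1) * l) \<partial>\<mu> (fst z)) +
     (\<integral>\<^sup>+ l. indicator S l * ennreal ((1 + l) powr (s - 1)) \<partial>\<mu> (snd z))"

lemma calH_norm_sq:
  assumes z: "(q, p) \<in> calH A s" and S: "S \<in> sets borel"
  shows "ennreal ((calH_norm A s (E S q, E S p))\<^sup>2) = energy s S (q, p)"
proof -
  have q: "q \<in> sdom sqrt" "ufun sqrt q \<in> Hs A (s - 1)" and p: "p \<in> Hs A (s - 1)"
    using z by (auto simp: calH_def dom_sqrt_op op_app_sqrt_op)
  have m: "bessel (s - 1) \<in> borel_measurable borel" "sqrt \<in> borel_measurable borel" by measurable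
  have sq: "(bessel r l)\<^sup>2 = (1 + l) powr r" if "0 \<le> l" for r l
    using that by (simp add: power2_eq_square powr_add[symmetric])
  have Sq: "E S q \<in> sdom sqrt" "ufun sqrt (E S q) = E S (ufun sqrt q)" and
    Sqq: "E S (ufun sqrt q) \<in> Hs A (s - 1)" and Sp: "E S p \<in> Hs A (s - 1)"
    using ufun_E_commute[OF m(2) q(1) S] ufun_E_commute(1)[OF m(1) _ S] q(2) p by (auto simp: Hs_eq)
  have "ennreal ((Hs_norm A (s - 1) (op_app (sqrt_op A) (E S q)))\<^sup>2)
      = (\<integral>\<^sup>+ l. ennreal ((bessel (s - 1) l)\<^sup>2) \<partial>\<mu> (ufun sqrt (E S q)))"
    using norm_ufun_sq[OF m(1)] Sq Sqq by (simp add: op_app_sqrt_op Hs_norm_eq Hs_eq)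
  also have "\<dots> = (\<integral>\<^sup>+ l. ennreal ((sqrt l)\<^sup>2) * ennreal ((bessel (s - 1) l)\<^sup>2) \<partial>\<mu> (E S q))"
    unfolding \<mu>_ufun[OF m(2) Sq(1)] by (rule nn_integral_density) measurable
  also have "\<dots> = (\<integral>\<^sup>+ l. indicator S l * (ennreal ((sqrt l)\<^sup>2) * ennreal ((bessel (s - 1) l)\<^sup>2)) \<partial>\<mu> q)"
    by (rule nn_integral_\<mu>_E[OF S]) measurable
  also have "\<dots> = (\<integral>\<^sup>+ l. indicator S l * ennreal ((1 + l) powr (s - 1) * l) \<partial>\<mu> q)"
    by (rule nn_integral_cong_AE, use AE_nonneg[of q] in eventually_elim)
      (simp add: sq mult.commute flip: ennreal_mult)
  finally have 1: "ennreal ((Hs_norm A (s - 1) (op_app (sqrt_op A) (E S q)))\<^sup>2) = \<dots>" .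
  have "ennreal ((Hs_norm A (s - 1) (E S p))\<^sup>2) = (\<integral>\<^sup>+ l. ennreal ((bessel (s - 1) l)\<^sup>2) \<partial>\<mu> (E S p))"
    using norm_ufun_sq[OF m(1)] Sp by (simp add: Hs_norm_eq Hs_eq)
  also have "\<dots> = (\<integral>\<^sup>+ l. indicator S l * ennreal ((bessel (s - 1) l)\<^sup>2) \<partial>\<mu> p)"
    by (rule nn_integral_\<mu>_E[OF S]) measurable
  also have "\<dots> = (\<integral>\<^sup>+ l. indicator S l * ennreal ((1 + l) powr (s - 1)) \<partial>\<mu> p)"
    by (rule nn_integral_cong_AE, use AE_nonneg[of p] in eventually_elim) (simp add: sq)
  finally have 2: "ennreal ((Hs_norm A (s - 1) (E S p))\<^sup>2) = \<dots>" .
  show ?thesis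
    unfolding energy_def fst_conv snd_conv 1[symmetric] 2[symmetric] calH_norm_def
    by (simp)
qed

end

subsection \<open>Conserved quantities\<close>

lemma has_real_derivative_inner:
  assumes "(f has_vector_derivative f') (at t)" "(g has_vector_derivative g') (at t)"
  shows "((\<lambda>t. inner (f t) (g t)) has_real_derivative inner (f t) g' + inner f' (g t)) (at t)"
  using bounded_bilinear.has_vector_derivative[OF bounded_bilinear_inner assms]
  by (simp add: has_real_derivative_iff_has_vector_derivative)

text \<open>What a solution at s = 2 provides in the norm of X itself.\<close>

locale kirchhoff = nonneg_spectral +
  fixes q p :: "real \<Rightarrow> 'a"
  assumes q_dom: "q t \<in> dom A"
    and q_deriv: "(q has_vector_derivative p t) (at t)"
    and p_deriv: "(p has_vector_derivative - ((c_minus A (q t))\<^sup>2 *\<^sub>R op_app A (q t))) (at t)"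
    and Aq_cont: "isCont (\<lambda>t. op_app A (q t)) t"
    and qform_less_1: "qform A (q t) < 1"
begin

abbreviation u :: "real \<Rightarrow> real" where "u t \<equiv> qform A (q t)"
abbreviation c :: "real \<Rightarrow> real" where "c t \<equiv> c_minus A (q t)"
abbreviation Aq :: "real \<Rightarrow> 'a" where "Aq t \<equiv> op_app A (q t)"
abbreviation m :: "real \<Rightarrow> real" where "m t \<equiv> inner (Aq t) (p t)"

abbreviation weight_energy :: "(real \<Rightarrow> real) \<Rightarrow> real \<Rightarrow> ennreal" where
  "weight_energy g t \<equiv>
    (\<integral>\<^sup>+ l. ennreal (g l) \<partial>\<mu> (p t)) + (\<integral>\<^sup>+ l. ennreal (g l * l) \<partial>\<mu> (q t))"

lemma u_nonneg: "0 \<le> u t" by (simp add: qform_def)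

lemma c_ge_1: "1 \<le> c t" and c_mult_u: "c t * u t = c t - 1" and c_mult: "c t * (1 - u t) = 1"
  using qform_less_1[of t] u_nonneg[of t] by (simp_all add: c_minus_def field_simps)

lemma A_sym: "x \<in> dom A \<Longrightarrow> y \<in> dom A \<Longrightarrow> inner (op_app A x) y = inner x (op_app A y)"
proof -
  assume x: "x \<in> dom A" and y: "y \<in> dom A"
  have m: "(\<lambda>l::real. l) \<in> borel_measurable borel" by measurable
  show ?thesis unfolding op_app_A[OF x] op_app_A[OF y]
    by (rule ufun_sym[OF m]) (use x y in \<open>simp_all only: dom_A\<close>)
qed

lemma u_deriv: "(u has_real_derivative 2 * m t) (at t)"
proof -
  have "(u \<tau> - u t) / (\<tau> - t) = inner ((q \<tau> - q t) /\<^sub>R (\<tau> - t)) (Aq \<tau> + Aq t)" for \<tau>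
  proof -
    have "inner (q \<tau>) (Aq t) = inner (q t) (Aq \<tau>)"
      using A_sym[OF q_dom q_dom, of t \<tau>] by (simp add: inner_commute)
    then have "u \<tau> - u t = inner (q \<tau> - q t) (Aq \<tau> + Aq t)"
      by (simp add: qform_eq[OF q_dom] inner_diff_left inner_add_right inner_commute[of "Aq _"])
    then show ?thesis by (simp add: divide_inverse)
  qed
  moreover have "((\<lambda>\<tau>. inner ((q \<tau> - q t) /\<^sub>R (\<tau> - t)) (Aq \<tau> + Aq t)) \<longlongrightarrow> inner (p t) (Aq t + Aq t)) (at t)"
    using q_deriv[of t] Aq_cont[of t] unfolding has_vector_derivative_iff_tendsto isCont_def
    by (intro tendsto_intros)
  ultimately show ?thesis
    by (simp add: has_field_derivative_iff inner_add_right inner_commute)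
qed

lemma c_deriv: "(c has_real_derivative 2 * m t * (c t)\<^sup>2) (at t)"
proof -
  have "((\<lambda>t. 1 / (1 - u t)) has_real_derivative 2 * m t * (1 / (1 - u t))\<^sup>2) (at t)"
    using qform_less_1[of t]
    by (auto intro!: derivative_eq_intros u_deriv simp: power2_eq_square field_simps)
  then show ?thesis by (simp add: c_minus_def[abs_def])
qed

lemma bfun_deriv:
  assumes h: "bdd_borel h"
  shows "((\<lambda>t. bfun h (q t)) has_vector_derivative bfun h (p t)) (at t)"
    and "((\<lambda>t. bfun h (p t)) has_vector_derivative - ((c t)\<^sup>2 *\<^sub>R bfun h (Aq t))) (at t)"
proof -
  note bl = bounded_linear_bfun[OF h]
  show "((\<lambda>t. bfun h (q t)) has_vector_derivative bfun h (p t)) (at t)"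
    by (rule bounded_linear.has_vector_derivative[OF bl q_deriv])
  have "bfun h (- ((c t)\<^sup>2 *\<^sub>R Aq t)) = - ((c t)\<^sup>2 *\<^sub>R bfun h (Aq t))"
    using bfun_scaleR[OF h, of "- (c t)\<^sup>2" "Aq t"] by simp
  then show "((\<lambda>t. bfun h (p t)) has_vector_derivative - ((c t)\<^sup>2 *\<^sub>R bfun h (Aq t))) (at t)"
    using bounded_linear.has_vector_derivative[OF bl p_deriv[of t]] by simp
qed

lemma pp_deriv:
  assumes h: "bdd_borel h"
  shows "((\<lambda>t. inner (p t) (bfun h (p t))) has_real_derivative - 2 * (c t)\<^sup>2 * inner (p t) (bfun h (Aq t))) (at t)"
  using has_real_derivative_inner[OF p_deriv[of t] bfun_deriv(2)[OF h, of t]] bfun_sym[OF h, of "Aq t" "p t"]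
  by (simp add: inner_commute mult.assoc)

lemma qq_deriv:
  assumes h: "bdd_borel h"
  shows "((\<lambda>t. inner (q t) (bfun h (q t))) has_real_derivative 2 * inner (q t) (bfun h (p t))) (at t)"
  using has_real_derivative_inner[OF q_deriv[of t] bfun_deriv(1)[OF h, of t]] bfun_sym[OF h, of "q t" "p t"]
  by (simp add: inner_commute)

lemma qp_deriv:
  assumes h: "bdd_borel h"
  shows "((\<lambda>t. inner (q t) (bfun h (p t))) has_real_derivative
    inner (p t) (bfun h (p t)) - (c t)\<^sup>2 * inner (q t) (bfun h (Aq t))) (at t)"
  using has_real_derivative_inner[OF q_deriv[of t] bfun_deriv(2)[OF h, of t]]
  by simp

text \<open>Since u / (1 - u) = c - 1, conservation of energy bounds \<open>c\<close>
  directly.\<close>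

lemma H_minus_eq: "H_minus A (q t, p t) = (inner (p t) (p t) + (c t - 1)) / 2"
  using qform_less_1[of t] by (simp add: H_minus_def c_minus_def field_simps)

lemma H_minus_const: "H_minus A (q t, p t) = H_minus A (q 0, p 0)"
proof -
  have "((\<lambda>t. inner (p t) (p t) + (c t - 1)) has_real_derivative 0) (at t)" for t
    using pp_deriv[of "\<lambda>l. 1" t] c_deriv[of t]
    by (auto intro!: derivative_eq_intros simp: inner_commute)
  then show ?thesis unfolding H_minus_eq
    using DERIV_isconst_all[of "\<lambda>t. inner (p t) (p t) + (c t - 1)" t 0] by simp
qed

lemma c_le: "c t \<le> 1 + 2 * H_minus A (q 0, p 0)"
proof -
  have "c t \<le> 1 + 2 * H_minus A (q t, p t)"
    using inner_ge_zero[of "p t"] by (simp add: H_minus_eq field_simps)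
  then show ?thesis by (simp only: H_minus_const[of t])
qed

text \<open>The symbol of A (A + \<kappa>^2)^-1; the indicator keeps it bounded on the whole line,
  away from the pole at -\<kappa>^2. On nonnegative \<open>l\<close>, \<open>res'\<close> is its
  complement to 1.\<close>

definition res :: "real \<Rightarrow> real \<Rightarrow> real" where
  "res \<kappa> l = indicator {0..} l * (l / (l + \<kappa>\<^sup>2))"

definition res' :: "real \<Rightarrow> real \<Rightarrow> real" where
  "res' \<kappa> l = indicator {0..} l * (\<kappa>\<^sup>2 / (l + \<kappa>\<^sup>2))"

context
  fixes \<kappa> :: real assumes \<kappa>: "0 < \<kappa>"
begin

lemma res_bounds: "0 \<le> res \<kappa> l" "res \<kappa> l \<le> 1" "0 \<le> l \<Longrightarrow> \<kappa>\<^sup>2 * res \<kappa> l \<le> l"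
  "0 \<le> l \<Longrightarrow> l - \<kappa>\<^sup>2 * res \<kappa> l = res \<kappa> l * l"
proof -
  have k: "0 < \<kappa>\<^sup>2" using \<kappa> by simp
  have pos: "0 < l + \<kappa>\<^sup>2" if "0 \<le> l" using that k by linarith
  show "0 \<le> res \<kappa> l" using divide_nonneg_pos[OF _ pos] by (auto simp: res_def indicator_def)
  show "res \<kappa> l \<le> 1"
  proof (cases "0 \<le> l")
    case True
    have "l / (l + \<kappa>\<^sup>2) \<le> (l + \<kappa>\<^sup>2) / (l + \<kappa>\<^sup>2)"
      by (rule divide_right_mono) (use pos[OF True] k in auto)
    then show ?thesis using True pos[OF True] by (simp add: res_def)
  qed (simp add: res_def)
  show 1: "l - \<kappa>\<^sup>2 * res \<kappa> l = res \<kappa> l * l" if "0 \<le> l"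
  proof -
    have "l + \<kappa>\<^sup>2 \<noteq> 0" using pos[OF that] by simp
    then show ?thesis using that by (simp add: res_def field_simps)
  qed
  show "\<kappa>\<^sup>2 * res \<kappa> l \<le> l" if l: "0 \<le> l"
  proof -
    have "0 \<le> res \<kappa> l * l" using l pos by (simp add: res_def)
    then show ?thesis using 1[OF l] by linarith
  qed
qed

lemma bdd_borel_res: "bdd_borel (res \<kappa>)"
proof (rule bdd_borelI)
  show "res \<kappa> \<in> borel_measurable borel" unfolding res_def[abs_def] by measurable
  show "\<bar>res \<kappa> l\<bar> \<le> 1" for l using res_bounds(1,2)[of l] by simp
qed

text \<open>\<open>res \<kappa> l * l\<close> is unbounded, so \<open>bfun_op_app\<close> does not
  apply to it. The complement does qualify, as \<open>res' \<kappa> l * l\<close> equals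
  \<open>\<kappa>\<^sup>2 * res \<kappa> l\<close>.\<close>

lemma bfun_res_Aq: "bfun (res \<kappa>) (Aq t) = Aq t - \<kappa>\<^sup>2 *\<^sub>R bfun (res \<kappa>) (q t)"
proof -
  have k: "0 < \<kappa>\<^sup>2" using \<kappa> by simp
  have b: "bdd_borel (res' \<kappa>)"
  proof (rule bdd_borelI)
    show "res' \<kappa> \<in> borel_measurable borel" unfolding res'_def[abs_def] by measurable
    show "\<bar>res' \<kappa> l\<bar> \<le> 1" for l
    proof (cases "0 \<le> l")
      case True
      then have "0 < l + \<kappa>\<^sup>2" using k by linarith
      then show ?thesis using True by (simp add: res'_def divide_le_eq_1_pos)
    qed (simp add: res'_def)
  qed
  have bl: "(\<lambda>l. res' \<kappa> l * l) = (\<lambda>l. \<kappa>\<^sup>2 * res \<kappa> l)"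
    by (auto simp: res_def res'_def)
  have "bdd_borel (\<lambda>l. res' \<kappa> l * l)"
    unfolding bl by (intro bdd_borel_mult bdd_borel_const bdd_borel_res)
  then have "bfun (res' \<kappa>) (Aq t) = bfun (\<lambda>l. res' \<kappa> l * l) (q t)"
    by (rule bfun_op_app[OF q_dom b])
  also have "\<dots> = \<kappa>\<^sup>2 *\<^sub>R bfun (res \<kappa>) (q t)" unfolding bl by (rule bfun_cmult[OF bdd_borel_res])
  finally have 1: "bfun (res' \<kappa>) (Aq t) = \<kappa>\<^sup>2 *\<^sub>R bfun (res \<kappa>) (q t)" .
  have "bfun (\<lambda>l. res \<kappa> l + res' \<kappa> l) (Aq t) = bfun (\<lambda>l. 1) (Aq t)"
  proof (rule bfun_cong_nonneg)
    show "bdd_borel (\<lambda>l. res \<kappa> l + res' \<kappa> l)" by (intro bdd_borel_add bdd_borel_res b)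
    show "res \<kappa> l + res' \<kappa> l = 1" if "0 \<le> l" for l
    proof -
      have "l + \<kappa>\<^sup>2 \<noteq> 0" using that k by linarith
      then show ?thesis using that by (simp add: res_def res'_def flip: add_divide_distrib)
    qed
  qed simp
  then show ?thesis using 1 by (simp add: bfun_add[OF bdd_borel_res b] algebra_simps)
qed

abbreviation \<alpha> :: "real \<Rightarrow> real" where "\<alpha> t \<equiv> inner (p t) (bfun (res \<kappa>) (p t))"
abbreviation \<beta> :: "real \<Rightarrow> real" where "\<beta> t \<equiv> inner (q t) (bfun (res \<kappa>) (q t))"
abbreviation \<gamma> :: "real \<Rightarrow> real" where "\<gamma> t \<equiv> inner (q t) (bfun (res \<kappa>) (p t))"

text \<open>\<open>u t - \<kappa>\<^sup>2 * \<beta> t\<close> is the form <q, A a q> of the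
  overview, written with bounded operators only.\<close>

definition invariant :: "real \<Rightarrow> real" where
  "invariant t = \<alpha> t + c t * (u t - \<kappa>\<^sup>2 * \<beta> t) - \<kappa>\<^sup>2 * (\<alpha> t * \<beta> t - \<gamma> t * \<gamma> t)"

lemma invariant_const: "invariant t = invariant 0"
proof -
  have "(invariant has_real_derivative 0) (at t)" for t
  proof -
    have pA: "inner (p t) (bfun (res \<kappa>) (Aq t)) = m t - \<kappa>\<^sup>2 * \<gamma> t"
      using bfun_sym[OF bdd_borel_res, of "p t" "q t"]
      by (simp add: bfun_res_Aq inner_diff_right inner_commute)
    have qA: "inner (q t) (bfun (res \<kappa>) (Aq t)) = u t - \<kappa>\<^sup>2 * \<beta> t"
      by (simp add: bfun_res_Aq inner_diff_right qform_eq[OF q_dom] inner_commute)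
    note d = pp_deriv[OF bdd_borel_res, of t, unfolded pA] qq_deriv[OF bdd_borel_res, of t]
      qp_deriv[OF bdd_borel_res, of t, unfolded qA] u_deriv[of t] c_deriv[of t]
    let ?D = "- 2 * (c t)\<^sup>2 * (m t - \<kappa>\<^sup>2 * \<gamma> t)
        + (2 * m t * (c t)\<^sup>2 * (u t - \<kappa>\<^sup>2 * \<beta> t) + c t * (2 * m t - \<kappa>\<^sup>2 * (2 * \<gamma> t)))
        - \<kappa>\<^sup>2 * (- 2 * (c t)\<^sup>2 * (m t - \<kappa>\<^sup>2 * \<gamma> t) * \<beta> t + \<alpha> t * (2 * \<gamma> t)
            - 2 * \<gamma> t * (\<alpha> t - (c t)\<^sup>2 * (u t - \<kappa>\<^sup>2 * \<beta> t)))"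
    have D: "(invariant has_real_derivative ?D) (at t)"
      unfolding invariant_def[abs_def]
      by (rule derivative_eq_intros d refl)+ (simp add: algebra_simps)
    \<comment> \<open>All terms collect into a multiple of c u - (c - 1), which is 0 for this
      particular \<open>c\<close>.\<close>
    have "?D = 2 * c t * (m t - \<kappa>\<^sup>2 * \<gamma> t) * (c t * u t - (c t - 1))"
      by (simp add: algebra_simps power2_eq_square)
    also have "\<dots> = 0" by (simp add: c_mult_u)
    finally show ?thesis using D by simp
  qed
  then show ?thesis using DERIV_isconst_all[of invariant t 0] by simp
qed

lemma \<alpha>_nonneg: "0 \<le> \<alpha> t" and \<beta>_bound: "\<kappa>\<^sup>2 * \<beta> t \<le> u t"
proof -
  have *: "inner x (bfun (res \<kappa>) x) = integral\<^sup>L (\<mu> x) (res \<kappa>)" for x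
    using inner_bfun_self[OF bdd_borel_res, of x] by (simp add: inner_commute)
  show "0 \<le> \<alpha> t" unfolding * by (rule Bochner_Integration.integral_nonneg) (rule res_bounds)
  have "(\<integral>l. \<kappa>\<^sup>2 * res \<kappa> l \<partial>\<mu> (q t)) \<le> (\<integral>l. l \<partial>\<mu> (q t))"
  proof (rule integral_mono_AE)
    show "integrable (\<mu> (q t)) (\<lambda>l. \<kappa>\<^sup>2 * res \<kappa> l)"
      by (intro integrable_\<mu> bdd_borel_mult bdd_borel_const bdd_borel_res)
    show "AE l in \<mu> (q t). \<kappa>\<^sup>2 * res \<kappa> l \<le> l" using AE_nonneg by eventually_elim (rule res_bounds)
  qed (rule integrable_A[OF q_dom])
  then show "\<kappa>\<^sup>2 * \<beta> t \<le> u t"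
    by (simp add: * qform_eq[OF q_dom] inner_A_self[OF q_dom])
qed

text \<open>Cauchy-Schwarz for the nonnegative form of \<open>res \<kappa>\<close>, through the
  square root of that operator.\<close>

lemma \<gamma>_sq_le: "\<gamma> t * \<gamma> t \<le> \<alpha> t * \<beta> t"
proof -
  let ?r = "\<lambda>l. sqrt (res \<kappa> l)"
  have r: "bdd_borel ?r"
  proof (rule bdd_borelI)
    show "?r \<in> borel_measurable borel" using bdd_borel_measurable[OF bdd_borel_res] by measurable
    show "\<bar>?r l\<bar> \<le> 1" for l using res_bounds(1,2)[of l] by simp
  qed
  have "(\<lambda>l. ?r l * ?r l) = res \<kappa>" using res_bounds(1) by auto
  then have *: "inner x (bfun (res \<kappa>) y) = inner (bfun ?r x) (bfun ?r y)" for x y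
    using bfun_bfun[OF r r, of y] bfun_sym[OF r, of x "bfun ?r y"] by simp
  show ?thesis
    using Cauchy_Schwarz_ineq[of "bfun ?r (q t)" "bfun ?r (p t)"]
    by (simp add: * power2_eq_square mult.commute)
qed

text \<open>From below, dropping the square of \<gamma> and using \<kappa>^2 \<beta> \<le> u leaves
  the fraction 1 - u = 1/c of \<alpha>. From above, the quartic term is nonpositive by
  Cauchy-Schwarz. Each side costs one factor \<open>C\<close>.\<close>

lemma resolvent_estimate:
  assumes C: "\<And>t. c t \<le> C"
  shows "\<alpha> t + (u t - \<kappa>\<^sup>2 * \<beta> t) \<le> C\<^sup>2 * (\<alpha> 0 + (u 0 - \<kappa>\<^sup>2 * \<beta> 0))"
proof -
  have C1: "1 \<le> C" using c_ge_1[of 0] C[of 0] by linarith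
  define w where "w t = u t - \<kappa>\<^sup>2 * \<beta> t" for t
  have w0: "0 \<le> w t" for t using \<beta>_bound[of t] by (simp add: w_def)
  have "\<alpha> t + C * w t \<le> C * invariant t"
  proof -
    have "(1 - u t) * \<alpha> t + c t * w t \<le> invariant t"
    proof -
      have "invariant t = (1 - \<kappa>\<^sup>2 * \<beta> t) * \<alpha> t + c t * w t + \<kappa>\<^sup>2 * (\<gamma> t * \<gamma> t)"
        by (simp add: invariant_def w_def algebra_simps)
      moreover have "(1 - u t) * \<alpha> t \<le> (1 - \<kappa>\<^sup>2 * \<beta> t) * \<alpha> t"
        by (rule mult_right_mono[OF _ \<alpha>_nonneg]) (use \<beta>_bound[of t] in simp)
      moreover have "0 \<le> \<kappa>\<^sup>2 * (\<gamma> t * \<gamma> t)" by simp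
      ultimately show ?thesis by linarith
    qed
    moreover have "\<alpha> t \<le> C * ((1 - u t) * \<alpha> t)"
    proof -
      have "1 = c t * (1 - u t)" by (simp add: c_mult)
      also have "\<dots> \<le> C * (1 - u t)" by (rule mult_right_mono[OF C]) (use qform_less_1[of t] in simp)
      finally show ?thesis using mult_right_mono[OF _ \<alpha>_nonneg[of t], of 1 "C * (1 - u t)"] by (simp add: mult.assoc)
    qed
    moreover have "w t \<le> c t * w t" using mult_right_mono[OF c_ge_1 w0, of t t] by simp
    ultimately have "\<alpha> t \<le> C * ((1 - u t) * \<alpha> t)" "(1 - u t) * \<alpha> t + w t \<le> invariant t" by linarith+
    moreover from this(2) have "C * ((1 - u t) * \<alpha> t + w t) \<le> C * invariant t"
      using C1 by (intro mult_left_mono) auto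
    ultimately show ?thesis by (simp add: distrib_left)
  qed
  moreover have "invariant 0 \<le> \<alpha> 0 + c 0 * w 0"
    using \<gamma>_sq_le[of 0] by (simp add: invariant_def w_def mult_left_mono)
  moreover have "c 0 * w 0 \<le> C * w 0" by (rule mult_right_mono[OF C w0])
  moreover have "\<alpha> 0 \<le> C * \<alpha> 0" using mult_right_mono[OF C1 \<alpha>_nonneg] by simp
  ultimately have "\<alpha> t + C * w t \<le> C * invariant t" "invariant 0 \<le> C * (\<alpha> 0 + w 0)"
    by (simp_all add: distrib_left)
  moreover have "C * invariant t \<le> C * (C * (\<alpha> 0 + w 0))"
    using calculation(2) C1 invariant_const[of t] by (intro mult_left_mono) auto
  moreover have "w t \<le> C * w t" using mult_right_mono[OF C1 w0] by simp
  ultimately show ?thesis by (simp add: w_def power2_eq_square mult.assoc)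
qed

lemma resolvent_estimate_nn:
  assumes C: "\<And>t. c t \<le> C"
  shows "weight_energy (res \<kappa>) t
    \<le> ennreal (C\<^sup>2) * weight_energy (res \<kappa>) 0"
proof -
  have eq: "weight_energy (res \<kappa>) t
      = ennreal (\<alpha> t + (u t - \<kappa>\<^sup>2 * \<beta> t))" for t
  proof -
    have *: "inner x (bfun (res \<kappa>) x) = integral\<^sup>L (\<mu> x) (res \<kappa>)" for x
      using inner_bfun_self[OF bdd_borel_res, of x] by (simp add: inner_commute)
    have "(\<integral>\<^sup>+ l. ennreal (res \<kappa> l) \<partial>\<mu> (p t)) = ennreal (\<alpha> t)"
      unfolding * by (rule nn_integral_eq_integral[OF integrable_\<mu>[OF bdd_borel_res]]) (simp add: res_bounds)
    moreover have "(\<integral>\<^sup>+ l. ennreal (res \<kappa> l * l) \<partial>\<mu> (q t)) = ennreal (u t - \<kappa>\<^sup>2 * \<beta> t)"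
    proof -
      have int: "integrable (\<mu> (q t)) (\<lambda>l. l - \<kappa>\<^sup>2 * res \<kappa> l)"
        by (intro Bochner_Integration.integrable_diff integrable_A[OF q_dom] integrable_mult_right
            integrable_\<mu>[OF bdd_borel_res])
      have "(\<integral>\<^sup>+ l. ennreal (res \<kappa> l * l) \<partial>\<mu> (q t)) = (\<integral>\<^sup>+ l. ennreal (l - \<kappa>\<^sup>2 * res \<kappa> l) \<partial>\<mu> (q t))"
        by (rule nn_integral_cong_AE) (use AE_nonneg[of "q t"] in eventually_elim, simp add: res_bounds)
      also have "\<dots> = ennreal (\<integral>l. l - \<kappa>\<^sup>2 * res \<kappa> l \<partial>\<mu> (q t))"
        by (rule nn_integral_eq_integral[OF int])
          (use AE_nonneg[of "q t"] in eventually_elim, simp add: res_bounds)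
      also have "(\<integral>l. l - \<kappa>\<^sup>2 * res \<kappa> l \<partial>\<mu> (q t)) = u t - \<kappa>\<^sup>2 * \<beta> t"
        using integrable_A[OF q_dom] integrable_\<mu>[OF bdd_borel_res]
        by (simp add: * qform_eq[OF q_dom] inner_A_self[OF q_dom])
      finally show ?thesis .
    qed
    ultimately show ?thesis using \<alpha>_nonneg[of t] \<beta>_bound[of t] by simp
  qed
  show ?thesis unfolding eq using resolvent_estimate[OF C, of t] \<alpha>_nonneg[of 0] \<beta>_bound[of 0]
    by (simp add: ennreal_mult[symmetric] ennreal_leI del: ennreal_plus)
qed

end

end

section \<open>Integration over the resolvent parameter and growth estimates\<close>

lemma nn_integral_lorentzian: "(\<integral>\<^sup>+ x. indicator {0<..} x * ennreal (1 / (1 + x\<^sup>2)) \<partial>lborel) = ennreal (pi / 2)"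
proof -
  have "(\<integral>\<^sup>+ x. indicator {0<..} x * ennreal (1 / (1 + x\<^sup>2)) \<partial>lborel)
      = (\<integral>\<^sup>+ x. ennreal (1 / (1 + x\<^sup>2)) * indicator {0..} x \<partial>lborel)"
    by (rule nn_integral_cong_AE)
      (use AE_lborel_singleton[of "0::real"] in eventually_elim, auto simp: indicator_def)
  also have "\<dots> = ennreal (pi / 2 - arctan 0)"
  proof (rule nn_integral_FTC_atLeast)
    show "DERIV arctan x :> 1 / (1 + x\<^sup>2)" for x :: real
      using DERIV_arctan[of x] by (simp add: inverse_eq_divide)
  qed (auto intro: tendsto_arctan_at_top)
  finally show ?thesis by simp
qed

text \<open>The hypothesis on the absolute value is invariant under time reversal, so negative times
  follow by applying the forward estimate to the reflected function.\<close>

lemma exp_growth_bound: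
  fixes G G' :: "real \<Rightarrow> real"
  assumes deriv: "\<And>t. (G has_real_derivative G' t) (at t)" and le: "\<And>t. \<bar>G' t\<bar> \<le> L * G t"
  shows "G t \<le> exp (L * \<bar>t\<bar>) * G 0"
proof -
  have pos: "F t \<le> exp (L * t) * F 0"
    if F: "\<And>t. (F has_real_derivative F' t) (at t)" "\<And>t. F' t \<le> L * F t" and t: "0 \<le> t"
    for F F' :: "real \<Rightarrow> real" and t
  proof -
    have "F t * exp (- L * t) \<le> F 0 * exp (- L * 0)"
    proof (rule DERIV_nonpos_imp_nonincreasing[OF t])
      fix x :: real
      have "((\<lambda>t. F t * exp (- L * t)) has_real_derivative (F' x - L * F x) * exp (- L * x)) (at x)"
        by (rule derivative_eq_intros F refl)+ (simp add: algebra_simps)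
      moreover have "(F' x - L * F x) * exp (- L * x) \<le> 0"
        using F(2)[of x] by (intro mult_nonpos_nonneg) auto
      ultimately show "\<exists>y. ((\<lambda>t. F t * exp (- L * t)) has_real_derivative y) (at x) \<and> y \<le> 0" by blast
    qed
    then have "F t * exp (- L * t) * exp (L * t) \<le> F 0 * exp (L * t)" by (intro mult_right_mono) auto
    also have "F t * exp (- L * t) * exp (L * t) = F t" by (simp add: mult.assoc flip: exp_add)
    finally show ?thesis by (simp add: mult.commute)
  qed
  have le': "G' t \<le> L * G t" "- G' t \<le> L * G t" for t using le[of t] by linarith+
  have "((\<lambda>t. G (- t)) has_real_derivative - G' (- t)) (at t)" for t
  proof -
    have "(uminus has_real_derivative -1) (at t)" by (auto intro!: derivative_eq_intros)
    then show ?thesis using DERIV_chain2[OF deriv, of uminus "-1" t] by simp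
  qed
  with pos[OF deriv le'(1), of t] pos[of "\<lambda>t. G (- t)" "\<lambda>t. - G' (- t)" "- t"] le'(2)
  show ?thesis by (cases "0 \<le> t") auto
qed

context kirchhoff
begin

text \<open>The substitution \<kappa> = sqrt l * x extracts the factor sqrt l and leaves the
  integral of 1 / (1 + x^2).\<close>

lemma nn_integral_res:
  assumes l: "0 \<le> l"
  shows "(\<integral>\<^sup>+ \<kappa>. indicator {0<..} \<kappa> * ennreal (res \<kappa> l) \<partial>lborel) = ennreal (pi / 2) * ennreal (sqrt l)"
proof (cases "l = 0")
  case False
  with l have l: "0 < l" by simp
  have "(\<integral>\<^sup>+ \<kappa>. indicator {0<..} \<kappa> * ennreal (res \<kappa> l) \<partial>lborel)
      = ennreal \<bar>sqrt l\<bar> * (\<integral>\<^sup>+ x. indicator {0<..} (0 + sqrt l * x) * ennreal (res (0 + sqrt l * x) l) \<partial>lborel)"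
    by (rule nn_integral_real_affine) (use l in \<open>simp_all add: res_def\<close>)
  also have "(\<lambda>x. indicator {0<..} (0 + sqrt l * x) * ennreal (res (0 + sqrt l * x) l))
      = (\<lambda>x. indicator {0<..} x * ennreal (1 / (1 + x\<^sup>2)))"
  proof
    fix x :: real
    have "l / (l + (sqrt l * x)\<^sup>2) = 1 / (1 + x\<^sup>2)"
    proof -
      have "l + (sqrt l * x)\<^sup>2 = l * (1 + x\<^sup>2)" using l by (simp add: power_mult_distrib distrib_left)
      then show ?thesis using l by simp
    qed
    moreover have "indicator {0<..} (0 + sqrt l * x) = (indicator {0<..} x :: ennreal)"
      using l by (auto simp: indicator_def zero_less_mult_iff)
    ultimately show "indicator {0<..} (0 + sqrt l * x) * ennreal (res (0 + sqrt l * x) l)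
      = indicator {0<..} x * ennreal (1 / (1 + x\<^sup>2))" using l by (simp add: res_def)
  qed
  finally show ?thesis using l by (simp add: nn_integral_lorentzian mult.commute)
qed (simp add: res_def)

lemma Tonelli_res:
  assumes g: "g \<in> borel_measurable borel" and g0: "\<And>l. 0 \<le> l \<Longrightarrow> 0 \<le> g l"
  shows "(\<integral>\<^sup>+ \<kappa>. indicator {0<..} \<kappa> * (\<integral>\<^sup>+ l. ennreal (res \<kappa> l * g l) \<partial>\<mu> x) \<partial>lborel)
    = ennreal (pi / 2) * (\<integral>\<^sup>+ l. ennreal (sqrt l * g l) \<partial>\<mu> x)"
proof -
  interpret finite_measure "\<mu> x" by (rule finite_measure_\<mu>)
  interpret P: pair_sigma_finite "\<mu> x" lborel ..
  note [measurable] = g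
  let ?f = "\<lambda>l \<kappa>. indicator {0<..} \<kappa> * ennreal (res \<kappa> l * g l)"
  have "(\<integral>\<^sup>+ \<kappa>. indicator {0<..} \<kappa> * (\<integral>\<^sup>+ l. ennreal (res \<kappa> l * g l) \<partial>\<mu> x) \<partial>lborel)
      = (\<integral>\<^sup>+ \<kappa>. (\<integral>\<^sup>+ l. ?f l \<kappa> \<partial>\<mu> x) \<partial>lborel)"
    by (intro nn_integral_cong nn_integral_cmult[symmetric]) (simp add: res_def)
  also have "\<dots> = (\<integral>\<^sup>+ l. (\<integral>\<^sup>+ \<kappa>. ?f l \<kappa> \<partial>lborel) \<partial>\<mu> x)"
    by (rule P.Fubini') (unfold res_def, measurable)
  also have "\<dots> = (\<integral>\<^sup>+ l. ennreal (pi / 2) * ennreal (sqrt l * g l) \<partial>\<mu> x)"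
  proof (rule nn_integral_cong_AE, use AE_nonneg[of x] in eventually_elim)
    fix l :: real assume l: "0 \<le> l"
    have "(\<integral>\<^sup>+ \<kappa>. ?f l \<kappa> \<partial>lborel)
        = (\<integral>\<^sup>+ \<kappa>. (indicator {0<..} \<kappa> * ennreal (res \<kappa> l)) * ennreal (g l) \<partial>lborel)"
    proof (rule nn_integral_cong)
      fix \<kappa> :: real
      show "?f l \<kappa> = (indicator {0<..} \<kappa> * ennreal (res \<kappa> l)) * ennreal (g l)"
        using res_bounds(1)[of \<kappa> l] g0[OF l] by (cases "0 < \<kappa>") (simp_all add: ennreal_mult)
    qed
    also have "\<dots> = (\<integral>\<^sup>+ \<kappa>. indicator {0<..} \<kappa> * ennreal (res \<kappa> l) \<partial>lborel) * ennreal (g l)"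
      by (rule nn_integral_multc) (unfold res_def, measurable)
    also have "\<dots> = ennreal (pi / 2) * ennreal (sqrt l * g l)"
      unfolding nn_integral_res[OF l] using l g0[OF l] by (simp add: ennreal_mult mult.assoc)
    finally show "(\<integral>\<^sup>+ \<kappa>. ?f l \<kappa> \<partial>lborel) = ennreal (pi / 2) * ennreal (sqrt l * g l)" .
  qed
  also have "\<dots> = ennreal (pi / 2) * (\<integral>\<^sup>+ l. ennreal (sqrt l * g l) \<partial>\<mu> x)"
    by (rule nn_integral_cmult) simp
  finally show ?thesis .
qed

text \<open>Integrating the resolvent estimate over \<open>\<kappa>\<close> turns \<open>A (A + \<kappa>\<^sup>2)\<^sup>-\<^sup>1\<close> into a multiple of \<open>A\<^bsup>1/2\<^esup>\<close>.\<close>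
lemma sqrt_estimate:
  assumes C: "\<And>t. c t \<le> C"
  shows "weight_energy sqrt t
    \<le> ennreal (C\<^sup>2) * weight_energy sqrt 0"
proof -
  define F where "F t \<kappa> = weight_energy (res \<kappa>) t" for t \<kappa>
  define J where "J t = weight_energy sqrt t" for t
  have meas: "(\<lambda>\<kappa>. \<integral>\<^sup>+ l. ennreal (res \<kappa> l * g l) \<partial>\<mu> x) \<in> borel_measurable lborel"
    if [measurable]: "g \<in> borel_measurable borel" for g x
  proof -
    interpret finite_measure "\<mu> x" by (rule finite_measure_\<mu>)
    show ?thesis unfolding res_def by measurable
  qed
  have m1: "(\<lambda>\<kappa>. \<integral>\<^sup>+ l. ennreal (res \<kappa> l) \<partial>\<mu> x) \<in> borel_measurable lborel" for x
    using meas[of "\<lambda>_. 1" x] by simp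
  have m2: "(\<lambda>\<kappa>. \<integral>\<^sup>+ l. ennreal (res \<kappa> l * l) \<partial>\<mu> x) \<in> borel_measurable lborel" for x
    by (rule meas) measurable
  have Fm [measurable]: "F t \<in> borel_measurable lborel" for t
    unfolding F_def using m1 m2 by (rule borel_measurable_add)
  have FJ: "(\<integral>\<^sup>+ \<kappa>. indicator {0<..} \<kappa> * F t \<kappa> \<partial>lborel) = ennreal (pi / 2) * J t" for t
  proof -
    have "(\<integral>\<^sup>+ \<kappa>. indicator {0<..} \<kappa> * F t \<kappa> \<partial>lborel)
        = (\<integral>\<^sup>+ \<kappa>. indicator {0<..} \<kappa> * (\<integral>\<^sup>+ l. ennreal (res \<kappa> l * 1) \<partial>\<mu> (p t))
          + indicator {0<..} \<kappa> * (\<integral>\<^sup>+ l. ennreal (res \<kappa> l * l) \<partial>\<mu> (q t)) \<partial>lborel)"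
      by (simp add: F_def distrib_left)
    also have "\<dots> = (\<integral>\<^sup>+ \<kappa>. indicator {0<..} \<kappa> * (\<integral>\<^sup>+ l. ennreal (res \<kappa> l * 1) \<partial>\<mu> (p t)) \<partial>lborel)
        + (\<integral>\<^sup>+ \<kappa>. indicator {0<..} \<kappa> * (\<integral>\<^sup>+ l. ennreal (res \<kappa> l * l) \<partial>\<mu> (q t)) \<partial>lborel)"
      using m1 m2 by (intro nn_integral_add borel_measurable_times) simp_all
    also have "\<dots> = ennreal (pi / 2) * (\<integral>\<^sup>+ l. ennreal (sqrt l * 1) \<partial>\<mu> (p t))
        + ennreal (pi / 2) * (\<integral>\<^sup>+ l. ennreal (sqrt l * l) \<partial>\<mu> (q t))"
      by (intro arg_cong2[where f = "(+)"] Tonelli_res) auto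
    finally show ?thesis by (simp add: J_def distrib_left)
  qed
  have "ennreal (pi / 2) * J t \<le> (\<integral>\<^sup>+ \<kappa>. ennreal (C\<^sup>2) * (indicator {0<..} \<kappa> * F 0 \<kappa>) \<partial>lborel)"
    unfolding FJ[symmetric]
  proof (rule nn_integral_mono)
    fix \<kappa> :: real
    show "indicator {0<..} \<kappa> * F t \<kappa> \<le> ennreal (C\<^sup>2) * (indicator {0<..} \<kappa> * F 0 \<kappa>)"
      using resolvent_estimate_nn[OF _ C, of \<kappa> t] by (cases "0 < \<kappa>") (simp_all add: F_def)
  qed
  also have "\<dots> = ennreal (C\<^sup>2) * (\<integral>\<^sup>+ \<kappa>. indicator {0<..} \<kappa> * F 0 \<kappa> \<partial>lborel)"
    by (rule nn_integral_cmult) measurable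
  also have "\<dots> = ennreal (pi / 2) * (ennreal (C\<^sup>2) * J 0)" unfolding FJ by (rule mult.left_commute)
  finally have "J t \<le> ennreal (C\<^sup>2) * J 0"
    by (subst (asm) ennreal_mult_le_mult_iff) auto
  then show ?thesis by (simp add: J_def)
qed

lemma nn_integral_bfun_sq: "bdd_borel f \<Longrightarrow> ennreal ((norm (bfun f x))\<^sup>2) = (\<integral>\<^sup>+ l. ennreal ((f l)\<^sup>2) \<partial>\<mu> x)"
  by (simp add: norm_bfun_sq nn_integral_eq_integral integrable_\<mu> bdd_borel_power2)

text \<open><A q, p> is split as <A^(3/4) q, A^(1/4) p>, and the squares of both factors are
  controlled by \<open>sqrt_estimate\<close>. Restricting to the band from 0 to \<open>n\<close>
  makes all the functions bounded; the bound survives the limit.\<close>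

lemma m_bound:
  assumes C: "\<And>t. c t \<le> C" and s: "3 / 2 \<le> s" and R: "energy s UNIV (q 0, p 0) \<le> ennreal R" "0 \<le> R"
  shows "\<bar>m t\<bar> \<le> C\<^sup>2 * R"
proof -
  \<comment> \<open>The threshold for \<open>s\<close>: this comparison uses s - 1 \<ge>
    1/2.\<close>
  have powr: "sqrt l \<le> (1 + l) powr (s - 1)" if "0 \<le> l" for l
  proof -
    have "sqrt l \<le> (1 + l) powr (1 / 2)" using that by (simp add: powr_half_sqrt)
    also have "\<dots> \<le> (1 + l) powr (s - 1)" using that s by (intro powr_mono) auto
    finally show ?thesis .
  qed
  have "weight_energy sqrt 0 \<le> energy s UNIV (q 0, p 0)"
    unfolding energy_def fst_conv snd_conv
    by (subst add.commute, intro add_mono nn_integral_mono_AE;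
      rule eventually_mono[OF AE_nonneg]; auto intro!: ennreal_leI mult_right_mono powr)
  then have "weight_energy sqrt t \<le> ennreal (C\<^sup>2) * ennreal R"
    using R(1) by (intro order_trans[OF sqrt_estimate[OF C, where t = t]] mult_left_mono order_trans[OF _ R(1)]) auto
  then have J: "weight_energy sqrt t \<le> ennreal (C\<^sup>2 * R)"
    using R(2) by (simp add: ennreal_mult)
  define f where "f n l = indicator {0..real n} l * l powr (3 / 4)" for n l
  define g where "g n l = indicator {0..real n} l * l powr (1 / 4)" for n l
  have bb: "bdd_borel (\<lambda>l. indicator {0..real n} l * l powr a)" if "0 \<le> a" for n a
  proof (rule bdd_borelI)
    show "\<bar>indicator {0..real n} l * l powr a\<bar> \<le> real n powr a" for l
      using that by (auto simp: indicator_def intro: powr_mono2)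
  qed measurable
  have f: "bdd_borel (f n)" and g: "bdd_borel (g n)" for n
    unfolding f_def g_def by (rule bb, simp)+
  have fg: "(\<lambda>l. f n l * g n l) = (\<lambda>l. indicator {0..real n} l * l)" for n
    by (auto simp: f_def g_def indicator_def powr_add[symmetric])
  have bd: "\<bar>inner (bfun (indicator {..real n}) (Aq t)) (p t)\<bar> \<le> C\<^sup>2 * R" for n
  proof -
    have b0: "bdd_borel (indicator {0..real n})" by auto
    have "bfun (indicator {..real n}) (Aq t) = bfun (indicator {0..real n}) (Aq t)"
      by (rule bfun_cong_nonneg) (auto simp: indicator_def)
    also have "\<dots> = bfun (\<lambda>l. f n l * g n l) (q t)"
      unfolding fg by (rule bfun_op_app[OF q_dom b0]) (use bdd_borel_mult[OF f g, of n n] in \<open>simp add: fg\<close>)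
    also have "(\<lambda>l. f n l * g n l) = (\<lambda>l. g n l * f n l)" by (simp add: mult.commute)
    also have "bfun (\<lambda>l. g n l * f n l) (q t) = bfun (g n) (bfun (f n) (q t))" by (rule bfun_bfun[OF g f, symmetric])
    finally have "inner (bfun (indicator {..real n}) (Aq t)) (p t) = inner (bfun (f n) (q t)) (bfun (g n) (p t))"
      by (simp add: bfun_sym[OF g])
    moreover have "\<bar>inner (bfun (f n) (q t)) (bfun (g n) (p t))\<bar> \<le> (norm (bfun (g n) (p t)))\<^sup>2 + (norm (bfun (f n) (q t)))\<^sup>2"
    proof -
      have "\<bar>inner x y\<bar> \<le> (norm y)\<^sup>2 + (norm x)\<^sup>2" for x y :: 'a
      proof -
        have "\<bar>inner x y\<bar> \<le> norm x * norm y" by (rule Cauchy_Schwarz_ineq2)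
        also have "\<dots> \<le> (norm y)\<^sup>2 + (norm x)\<^sup>2"
          using sum_squares_bound[of "norm x" "norm y"] mult_nonneg_nonneg[OF norm_ge_zero norm_ge_zero, of x y]
          by linarith
        finally show ?thesis .
      qed
      then show ?thesis .
    qed
    moreover have "ennreal ((norm (bfun (g n) (p t)))\<^sup>2 + (norm (bfun (f n) (q t)))\<^sup>2) \<le> ennreal (C\<^sup>2 * R)"
    proof -
      have p32: "l powr (3 / 2) = sqrt l * l" if "0 \<le> l" for l :: real
      proof (cases "l = 0")
        case False
        then show ?thesis using powr_add[of l "1 / 2" 1] that by (simp add: powr_half_sqrt)
      qed simp
      have g2: "(g n l)\<^sup>2 \<le> sqrt l" and f2: "(f n l)\<^sup>2 \<le> sqrt l * l" if "0 \<le> l" for l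
        using that by (auto simp: f_def g_def indicator_def power2_eq_square powr_add[symmetric]
            powr_half_sqrt p32)
      have "ennreal ((norm (bfun (g n) (p t)))\<^sup>2 + (norm (bfun (f n) (q t)))\<^sup>2)
        = (\<integral>\<^sup>+ l. ennreal ((g n l)\<^sup>2) \<partial>\<mu> (p t)) + (\<integral>\<^sup>+ l. ennreal ((f n l)\<^sup>2) \<partial>\<mu> (q t))"
        using nn_integral_bfun_sq[OF f] nn_integral_bfun_sq[OF g] by simp
      also have "\<dots> \<le> weight_energy sqrt t"
        by (intro add_mono nn_integral_mono_AE; rule eventually_mono[OF AE_nonneg]; auto intro!: ennreal_leI g2 f2)
      finally show ?thesis using J by (rule order_trans)
    qed
    then have "(norm (bfun (g n) (p t)))\<^sup>2 + (norm (bfun (f n) (q t)))\<^sup>2 \<le> C\<^sup>2 * R"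
      using R(2) by (subst (asm) ennreal_le_iff) auto
    ultimately show ?thesis by linarith
  qed
  have "(\<lambda>n. \<bar>inner (bfun (indicator {..real n}) (Aq t)) (p t)\<bar>) \<longlonglongrightarrow> \<bar>m t\<bar>"
    by (intro tendsto_intros indicator_atMost_tendsto)
  then show ?thesis by (rule LIMSEQ_le_const2) (use bd in auto)
qed

text \<open>With the factor c^2 on the potential part the cross terms <q, A h(A) p> cancel in the
  derivative. What remains is at most 4 C M times the functional, and \<open>h\<close> does not
  enter the constant. Comparing the functional with the unweighted sum costs \<open>C^2\<close> at
  time 0 and nothing at time t, as c \<ge> 1.\<close>

lemma Gronwall:
  assumes C: "\<And>t. c t \<le> C" and M: "\<And>t. \<bar>m t\<bar> \<le> M"
    and h: "bdd_borel h" "\<And>l. 0 \<le> h l" and hl: "bdd_borel (\<lambda>l. h l * l)" "\<And>l. 0 \<le> h l * l"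
  shows "weight_energy h t
    \<le> ennreal (C\<^sup>2 * exp (4 * C * M * \<bar>t\<bar>)) *
      weight_energy h 0"
proof -
  have C1: "1 \<le> C" using c_ge_1[of 0] C[of 0] by linarith
  have M0: "0 \<le> M" using M[of 0] by linarith
  define L where "L = 4 * C * M"
  define P where "P t = inner (p t) (bfun h (p t))" for t
  define Q where "Q t = inner (q t) (bfun (\<lambda>l. h l * l) (q t))" for t
  define G where "G t = P t + (c t)\<^sup>2 * Q t" for t
  have PI: "P t = (\<integral>l. h l \<partial>\<mu> (p t))" and QI: "Q t = (\<integral>l. h l * l \<partial>\<mu> (q t))" for t
    unfolding P_def Q_def inner_bfun_self[OF h(1), symmetric] inner_bfun_self[OF hl(1), symmetric]
    by (rule inner_commute)+
  have P0: "0 \<le> P t" and Q0: "0 \<le> Q t" for t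
    unfolding PI QI by (auto intro!: Bochner_Integration.integral_nonneg h hl)
  note hA = bfun_op_app[OF q_dom h(1) hl(1)]
  \<comment> \<open>The surviving term (c^2)' Q = 2 c c' Q with c' = 2 m c^2.\<close>
  define G' where "G' t = 4 * c t * m t * ((c t)\<^sup>2 * Q t)" for t
  have G: "(G has_real_derivative G' t) (at t)" for t
  proof -
    let ?X = "inner (q t) (bfun (\<lambda>l. h l * l) (p t))"
    have X: "inner (p t) (bfun (\<lambda>l. h l * l) (q t)) = ?X"
      using bfun_sym[OF hl(1), of "p t" "q t"] by (simp add: inner_commute)
    have P': "(P has_real_derivative - 2 * (c t)\<^sup>2 * ?X) (at t)"
      using pp_deriv[OF h(1), of t] unfolding P_def hA X .
    have Q': "(Q has_real_derivative 2 * ?X) (at t)"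
      using qq_deriv[OF hl(1), of t] unfolding Q_def .
    show ?thesis
      unfolding G_def[abs_def]
      by (rule derivative_eq_intros P' Q' c_deriv refl)+
        (simp add: G'_def algebra_simps power2_eq_square)
  qed
  have G'_le: "\<bar>G' t\<bar> \<le> L * G t" for t
  proof -
    have "\<bar>4 * c t * m t\<bar> \<le> L"
      unfolding L_def abs_mult using c_ge_1[of t] C[of t] M[of t] M0 by (intro mult_mono) auto
    then have "\<bar>4 * c t * m t\<bar> * ((c t)\<^sup>2 * Q t) \<le> L * ((c t)\<^sup>2 * Q t)"
      using Q0[of t] by (intro mult_right_mono) auto
    also have "\<dots> \<le> L * G t"
      using P0[of t] C1 M0 by (intro mult_left_mono) (auto simp: G_def L_def)
    finally show ?thesis using Q0[of t] by (simp add: G'_def abs_mult)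
  qed
  note Gt = exp_growth_bound[OF G G'_le, of t]
  have c2: "1 \<le> (c t)\<^sup>2" "(c t)\<^sup>2 \<le> C\<^sup>2" for t
    using c_ge_1[of t] C[of t] power_mono[of 1 "c t" 2] power_mono[of "c t" C 2] by auto
  have "P t + Q t \<le> G t"
    using mult_right_mono[OF c2(1)[of t] Q0[of t]] by (simp add: G_def)
  also note Gt
  also have "G 0 \<le> C\<^sup>2 * (P 0 + Q 0)"
    using mult_right_mono[OF c2(2)[of 0] Q0[of 0]]
      mult_right_mono[OF order_trans[OF c2(1)[of 0] c2(2)[of 0]] P0[of 0]]
    by (simp add: G_def distrib_left)
  finally have le: "P t + Q t \<le> C\<^sup>2 * exp (L * \<bar>t\<bar>) * (P 0 + Q 0)"
    by (simp add: mult_left_mono mult_ac)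
  have "weight_energy h t = ennreal (P t + Q t)" for t
    using P0[of t] Q0[of t] h hl by (simp add: PI QI nn_integral_eq_integral integrable_\<mu>)
  then show ?thesis using le P0[of 0] Q0[of 0]
    by (simp add: L_def ennreal_mult[symmetric] ennreal_leI del: ennreal_plus)
qed

text \<open>\<open>Gronwall\<close> is stated for bounded weights, while (1 + l)^(s - 1) is
  unbounded in general. The constant does not see the truncation at \<open>n\<close>, so monotone
  convergence removes it.\<close>

lemma energy_estimate:
  assumes C: "\<And>t. c t \<le> C" and M: "\<And>t. \<bar>m t\<bar> \<le> M" and s: "1 \<le> s" and S: "S \<in> sets borel"
  shows "energy s S (q t, p t) \<le> ennreal (C\<^sup>2 * exp (4 * C * M * \<bar>t\<bar>)) * energy s S (q 0, p 0)"
proof -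
  \<comment> \<open>Cutting at 0 keeps both \<open>h n l\<close> and \<open>h n l * l\<close>
    nonnegative on the whole line; the spectral measures do not charge the negative part.\<close>
  define h where "h n l = indicator (S \<inter> {0..real n}) l * (1 + l) powr (s - 1)" for n :: nat and l
  have S0: "S \<inter> {0..real n} \<in> sets borel" for n using S by simp
  have hm [measurable]: "h n \<in> borel_measurable borel" for n unfolding h_def using S0 by measurable
  have h0: "0 \<le> h n l" "0 \<le> h n l * l" for n l by (auto simp: h_def indicator_def)
  have hb: "h n l \<le> (1 + real n) powr (s - 1)" for n l
    using s by (auto simp: h_def indicator_def intro: powr_mono2)
  have h: "bdd_borel (h n)" for n
    by (rule bdd_borelI[OF hm]) (use hb h0(1) in auto)
  have hl: "bdd_borel (\<lambda>l. h n l * l)" for n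
  proof (rule bdd_borelI)
    show "\<bar>h n l * l\<bar> \<le> (1 + real n) powr (s - 1) * real n" for l
    proof (cases "l \<in> {0..real n}")
      case True
      then show ?thesis using h0[of n l] hb[of n l] by (auto intro!: mult_mono)
    qed (simp add: h_def)
  qed measurable
  define F where "F n t = (\<integral>\<^sup>+ l. ennreal (h n l * l) \<partial>\<mu> (q t)) + (\<integral>\<^sup>+ l. ennreal (h n l) \<partial>\<mu> (p t))" for n t
  have le: "F n t \<le> energy s S (q t, p t)" for n t
    unfolding F_def energy_def fst_conv snd_conv
    by (intro add_mono nn_integral_mono) (auto simp: h_def indicator_def)
  have lim: "(\<lambda>n. F n t) \<longlonglongrightarrow> energy s S (q t, p t)" for t
  proof -
    have ev: "\<forall>\<^sub>F n in sequentially. h n l = indicator (S \<inter> {0..}) l * (1 + l) powr (s - 1)" for l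
    proof -
      obtain N where N: "l \<le> real N" using real_arch_simple by blast
      then show ?thesis unfolding eventually_sequentially
        by (intro exI[of _ N]) (auto simp: h_def indicator_def)
    qed
    have inc: "h i l \<le> h j l" if "i \<le> j" for i j l using that by (auto simp: h_def indicator_def)
    have "(\<lambda>n. F n t) \<longlonglongrightarrow>
        (\<integral>\<^sup>+ l. ennreal (indicator (S \<inter> {0..}) l * (1 + l) powr (s - 1) * l) \<partial>\<mu> (q t))
        + (\<integral>\<^sup>+ l. ennreal (indicator (S \<inter> {0..}) l * (1 + l) powr (s - 1)) \<partial>\<mu> (p t))"
      unfolding F_def
    proof (intro tendsto_add nn_integral_LIMSEQ)
      show "incseq (\<lambda>n l. ennreal (h n l))"
        by (auto simp: incseq_def le_fun_def intro!: ennreal_leI inc)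
      show "incseq (\<lambda>n l. ennreal (h n l * l))"
        unfolding incseq_def le_fun_def
      proof (intro allI impI ennreal_leI)
        fix i j :: nat and l assume ij: "i \<le> j"
        show "h i l * l \<le> h j l * l"
        proof (cases "0 \<le> l")
          case True
          then show ?thesis by (intro mult_right_mono inc[OF ij])
        qed (simp add: h_def)
      qed
      show "(\<lambda>n. ennreal (h n l)) \<longlonglongrightarrow> ennreal (indicator (S \<inter> {0..}) l * (1 + l) powr (s - 1))" for l
        by (rule tendsto_eventually, use ev[of l] in eventually_elim) simp
      show "(\<lambda>n. ennreal (h n l * l)) \<longlonglongrightarrow> ennreal (indicator (S \<inter> {0..}) l * (1 + l) powr (s - 1) * l)" for l
        by (rule tendsto_eventually, use ev[of l] in eventually_elim) simp
    qed simp_all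
    also have "(\<integral>\<^sup>+ l. ennreal (indicator (S \<inter> {0..}) l * (1 + l) powr (s - 1) * l) \<partial>\<mu> (q t))
        + (\<integral>\<^sup>+ l. ennreal (indicator (S \<inter> {0..}) l * (1 + l) powr (s - 1)) \<partial>\<mu> (p t)) = energy s S (q t, p t)"
      unfolding energy_def fst_conv snd_conv
      by (intro arg_cong2[where f = "(+)"] nn_integral_cong_AE; rule eventually_mono[OF AE_nonneg];
        auto simp: indicator_def)
    finally show ?thesis .
  qed
  show ?thesis
  proof (rule LIMSEQ_le_const2[OF lim], intro exI allI impI)
    fix n :: nat
    have "F n t \<le> ennreal (C\<^sup>2 * exp (4 * C * M * \<bar>t\<bar>)) * F n 0"
      using Gronwall[OF C M h[of n] h0(1)[of n] hl[of n] h0(2)[of n], of t] by (simp add: F_def add.commute)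
    also have "\<dots> \<le> ennreal (C\<^sup>2 * exp (4 * C * M * \<bar>t\<bar>)) * energy s S (q 0, p 0)"
      by (intro mult_left_mono le) simp
    finally show "F n t \<le> ennreal (C\<^sup>2 * exp (4 * C * M * \<bar>t\<bar>)) * energy s S (q 0, p 0)" .
  qed
qed

end

section \<open>Solutions in X and the orbit estimates\<close>

context nonneg_spectral
begin

text \<open>At s = 2 the derivative of \<open>p\<close> is taken in H^0, whose norm is that of X,
  and continuity of the square root of A applied to q in H^1 gives continuity of A q.\<close>

lemma kirchhoff_solution:
  assumes "solution_Km A 2 UNIV q p"
  shows "kirchhoff E A q p"
proof
  fix t
  have calH: "(q t, p t) \<in> calH A 2" for t using assms by (simp add: solution_Km_def)
  note q_dom = calH_2_dom(1)[OF calH]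
  show "q t \<in> dom A" by (rule q_dom)
  show "(q has_vector_derivative p t) (at t)" using assms by (simp add: solution_Km_def)
  show "qform A (q t) < 1" using assms by (simp add: solution_Km_def)
  let ?w = "(c_minus A (q t))\<^sup>2 *\<^sub>R op_app A (q t)"
  \<comment> \<open>The distance in the completion, a limit along representing sequences, becomes a
    norm in X by \<open>ext_op_tendsto\<close>.\<close>
  have dist: "Hs_dist A 0 (\<lambda>n. v) (\<lambda>n. - ((c_minus A (q t))\<^sup>2 *\<^sub>R ext_op A (q t) n)) = norm (v + ?w)" for v
  proof -
    have "(\<lambda>n. norm (v - - ((c_minus A (q t))\<^sup>2 *\<^sub>R ext_op A (q t) n))) \<longlonglongrightarrow> norm (v - - ?w)"
      by (intro tendsto_intros ext_op_tendsto q_dom)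
    then show ?thesis unfolding Hs_dist_def Hs_norm_0 by (simp add: limI)
  qed
  have "((\<lambda>\<tau>. Hs_dist A 0 (\<lambda>n. (p \<tau> - p t) /\<^sub>R (\<tau> - t)) (\<lambda>n. - ((c_minus A (q t))\<^sup>2 *\<^sub>R ext_op A (q t) n))) \<longlongrightarrow> 0) (at t)"
    using assms by (simp add: solution_Km_def C1_Hs_def)
  then have "((\<lambda>\<tau>. norm ((p \<tau> - p t) /\<^sub>R (\<tau> - t) - - ?w)) \<longlongrightarrow> 0) (at t)"
    unfolding dist by simp
  then show "(p has_vector_derivative - ?w) (at t)"
    unfolding has_vector_derivative_iff_tendsto tendsto_norm_zero_iff LIM_zero_iff .
  have qs: "q t \<in> sdom sqrt" for t using calH[of t] by (simp add: calH_def dom_sqrt_op)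
  have id: "(\<lambda>l::real. l) \<in> borel_measurable borel" and sq: "sqrt \<in> borel_measurable borel" by measurable
  have "((\<lambda>\<tau>. Hs_norm A 1 (op_app (sqrt_op A) (q \<tau>) - op_app (sqrt_op A) (q t))) \<longlongrightarrow> 0) (at t)"
    using assms by (simp add: solution_Km_def continuous_Hs_def)
  then have "((\<lambda>\<tau>. op_app A (q \<tau>) - op_app A (q t)) \<longlongrightarrow> 0) (at t)"
  proof (rule Lim_null_comparison[rotated], intro always_eventually allI)
    fix \<tau>
    have qA: "q x \<in> sdom (\<lambda>l. l)" for x using q_dom[of x] by (simp only: dom_A)
    note L = sdom_linear(3,4)[OF sq qs qs, of \<tau> t] and LA = sdom_linear(3,4)[OF id qA qA, of \<tau> t]
    have diff: "op_app (sqrt_op A) (q \<tau>) - op_app (sqrt_op A) (q t) = op_app (sqrt_op A) (q \<tau> - q t)"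
      by (simp only: op_app_sqrt_op[OF qs] op_app_sqrt_op[OF L(1)] L(2))
    have diffA: "op_app A (q \<tau>) - op_app A (q t) = op_app A (q \<tau> - q t)"
    proof -
      have d: "q \<tau> - q t \<in> dom A" using LA(1) by (simp only: dom_A)
      show ?thesis by (simp only: op_app_A[OF d] op_app_A[OF q_dom] LA(2))
    qed
    have b: "bessel 1 \<in> borel_measurable borel" by measurable
    have "ufun sqrt (q x) \<in> sdom (bessel 1)" for x
      using calH[of x] by (simp add: calH_def op_app_sqrt_op qs Hs_eq)
    then have "ufun sqrt (q \<tau> - q t) \<in> sdom (bessel 1)"
      unfolding L(2) by (intro sdom_linear(3) b)
    moreover have "0 \<in> sdom (bessel 1)"
      using sdom_linear(5)[OF b calculation calculation, of 0] by simp
    \<comment> \<open>The zero momentum only completes the difference to a point of phase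
      space.\<close>
    ultimately have "(q \<tau> - q t, 0) \<in> calH A 2"
      using L(1) by (simp add: calH_def dom_sqrt_op op_app_sqrt_op Hs_eq)
    from calH_2_dom(2)[OF this]
    show "norm (op_app A (q \<tau>) - op_app A (q t)) \<le> Hs_norm A 1 (op_app (sqrt_op A) (q \<tau>) - op_app (sqrt_op A) (q t))"
      unfolding diff diffA .
  qed
  then show "isCont (\<lambda>t. op_app A (q t)) t" unfolding isCont_def LIM_zero_iff .
qed

end


theorem corollary4p5:
  fixes A :: "'a::{real_inner, complete_space} \<rightharpoonup> 'a"
    and \<Omega> :: "('a \<times> 'a) set" and s T :: real
  assumes "selfadjoint_op A" and "nonneg_op A"
    and "s \<ge> 3 / 2" and "T > 0"
    and "\<Omega> \<subseteq> calH_inf A"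
    and "\<forall>(q, p)\<in>\<Omega>. qform A q < 1"
    and "bounded_calH A s \<Omega>"
    and "bdd_above (H_minus A ` \<Omega>)"
  shows "bounded_calH A s (orbit_set A \<Omega> T) \<and>
    (equicontinuous_calH A s \<Omega> \<longrightarrow> equicontinuous_calH A s (orbit_set A \<Omega> T))"
proof -
  interpret S: nonneg_selfadjoint A by standard (rule assms)+
  let ?E = "spectral_measure A"
  have E: "proj_valued_measure ?E" "spectral_integral ?E (\<lambda>l. l) = A"
    using someI_ex[OF S.spectral_theorem] unfolding spectral_measure_def by blast+
  interpret nonneg_spectral ?E A by standard (use E assms(2) in auto)
  obtain b where b: "\<And>z. z \<in> \<Omega> \<Longrightarrow> H_minus A z \<le> b"
    using assms(8) by (auto simp: bdd_above_def)
  obtain R where R: "\<And>z. z \<in> \<Omega> \<Longrightarrow> calH_norm A s z \<le> R"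
    using assms(7) by (auto simp: bounded_calH_def)
  define C where "C = 1 + 2 * b"
  \<comment> \<open>The square root passes from energies to norms. \<open>K\<close> depends only on
    the energy bound, the norm bound \<open>R\<close> of \<Omega> and \<open>T\<close>.\<close>
  define K where "K = sqrt (C\<^sup>2 * exp (4 * C * (C\<^sup>2 * R\<^sup>2) * T))"
  have s1: "1 \<le> s" using assms(3) by simp
  have norm0: "0 \<le> calH_norm A s z" for z by (cases z) (simp add: calH_norm_def)
  \<comment> \<open>One constant for all spectral sets: \<open>UNIV\<close> gives boundedness, the
    sets \<open>{\<kappa>\<^sup>2..}\<close> give equicontinuity with the same \<kappa> for data and
    orbits.\<close>
  have orbit: "\<exists>(q0, p0)\<in>\<Omega>. (q, p) \<in> calH A s \<and>
      (\<forall>B\<in>sets borel. calH_norm A s (?E B q, ?E B p) \<le> K * calH_norm A s (?E B q0, ?E B p0))"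
    if orb: "(q, p) \<in> orbit_set A \<Omega> T" for q p
  proof -
    from orb obtain Q P t where t: "q = Q t" "p = P t" "solution_Km_inf A UNIV Q P" "(Q 0, P 0) \<in> \<Omega>" "\<bar>t\<bar> \<le> T"
      by (auto simp: orbit_set_def)
    have sol: "solution_Km A r UNIV Q P" if "1 \<le> r" for r using t(3) that by (simp add: solution_Km_inf_def)
    interpret k: kirchhoff ?E A Q P by (rule kirchhoff_solution[OF sol]) simp
    have calH: "(Q t, P t) \<in> calH A s" for t using sol[OF s1] by (simp add: solution_Km_def)
    have C: "k.c t \<le> C" for t
      using k.c_le[of t] b[OF t(4)] by (simp add: C_def)
    have C1: "1 \<le> C" using k.c_ge_1[of 0] C[of 0] by linarith
    have "energy s UNIV (Q 0, P 0) = ennreal ((calH_norm A s (Q 0, P 0))\<^sup>2)"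
      using calH_norm_sq[OF calH, of UNIV 0] by simp
    also have "\<dots> \<le> ennreal (R\<^sup>2)"
      by (intro ennreal_leI power_mono R t norm0)
    finally have M: "\<bar>k.m t\<bar> \<le> C\<^sup>2 * R\<^sup>2" for t by (intro k.m_bound[OF C assms(3)]) auto
    have "calH_norm A s (?E B (Q t), ?E B (P t)) \<le> K * calH_norm A s (?E B (Q 0), ?E B (P 0))"
      if B: "B \<in> sets borel" for B
    proof -
      have "ennreal ((calH_norm A s (?E B (Q t), ?E B (P t)))\<^sup>2) = energy s B (Q t, P t)"
        by (rule calH_norm_sq[OF calH B])
      also have "\<dots> \<le> ennreal (C\<^sup>2 * exp (4 * C * (C\<^sup>2 * R\<^sup>2) * \<bar>t\<bar>)) * energy s B (Q 0, P 0)"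
        by (rule k.energy_estimate[OF C M s1 B])
      also have "\<dots> \<le> ennreal (K\<^sup>2) * energy s B (Q 0, P 0)"
      proof (intro mult_right_mono ennreal_leI)
        have "C\<^sup>2 * exp (4 * C * (C\<^sup>2 * R\<^sup>2) * \<bar>t\<bar>) \<le> C\<^sup>2 * exp (4 * C * (C\<^sup>2 * R\<^sup>2) * T)"
          using t(5) C1 by (intro mult_left_mono) (auto intro!: mult_left_mono)
        then show "C\<^sup>2 * exp (4 * C * (C\<^sup>2 * R\<^sup>2) * \<bar>t\<bar>) \<le> K\<^sup>2" by (simp add: K_def)
      qed simp
      also have "\<dots> = ennreal ((K * calH_norm A s (?E B (Q 0), ?E B (P 0)))\<^sup>2)"
        unfolding calH_norm_sq[OF calH B, symmetric] by (simp add: power_mult_distrib ennreal_mult)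
      finally show ?thesis
        by (rule ennreal_power2_leD) (simp add: K_def norm0)
    qed
    then show ?thesis using t calH by blast
  qed
  have K0: "0 \<le> K" by (simp add: K_def)
  have bounded: "bounded_calH A s (orbit_set A \<Omega> T)"
    unfolding bounded_calH_def
  proof (intro conjI exI ballI subsetI)
    fix z assume z: "z \<in> orbit_set A \<Omega> T"
    obtain q p where zqp: "z = (q, p)" by (cases z)
    from orbit[OF z[unfolded zqp]] obtain q0 p0 where o: "(q0, p0) \<in> \<Omega>" "(q, p) \<in> calH A s"
      "\<And>B. B \<in> sets borel \<Longrightarrow> calH_norm A s (?E B q, ?E B p) \<le> K * calH_norm A s (?E B q0, ?E B p0)"
      by blast
    show "z \<in> calH A s" using o zqp by simp
    have "calH_norm A s z \<le> K * calH_norm A s (q0, p0)" using o(3)[of UNIV] zqp by simp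
    also have "\<dots> \<le> K * R" by (intro mult_left_mono R o K0)
    finally show "calH_norm A s z \<le> K * R" .
  qed
  moreover have "equicontinuous_calH A s (orbit_set A \<Omega> T)" if eq: "equicontinuous_calH A s \<Omega>"
    unfolding equicontinuous_calH_def
  proof (intro conjI bounded allI impI)
    fix e :: real assume e: "0 < e"
    \<comment> \<open>Only K \<ge> 0 is at hand here: C \<ge> 1 was derived from an orbit, and there
      may be none.\<close>
    then have "0 < e / (K + 1)" using K0 by simp
    then obtain \<kappa> where \<kappa>: "0 < \<kappa>"
      "\<And>q p. (q, p) \<in> \<Omega> \<Longrightarrow> calH_norm A s (proj_ge A \<kappa> q, proj_ge A \<kappa> p) \<le> e / (K + 1)"
      using eq unfolding equicontinuous_calH_def by blast
    have "calH_norm A s (proj_ge A \<kappa> q, proj_ge A \<kappa> p) \<le> e" if z: "(q, p) \<in> orbit_set A \<Omega> T" for q p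
    proof -
      from orbit[OF z] obtain q0 p0 where o: "(q0, p0) \<in> \<Omega>"
        "\<And>B. B \<in> sets borel \<Longrightarrow> calH_norm A s (?E B q, ?E B p) \<le> K * calH_norm A s (?E B q0, ?E B p0)"
        by blast
      have "calH_norm A s (proj_ge A \<kappa> q, proj_ge A \<kappa> p) \<le> K * calH_norm A s (proj_ge A \<kappa> q0, proj_ge A \<kappa> p0)"
        using o(2)[of "{\<kappa>\<^sup>2..}"] by (simp add: proj_ge_eq)
      also have "\<dots> \<le> K * (e / (K + 1))" by (intro mult_left_mono \<kappa> o K0)
      also have "\<dots> \<le> e" using K0 e by (simp add: field_simps)
      finally show ?thesis .
    qed
    then show "\<exists>\<kappa>>0. \<forall>(q, p)\<in>orbit_set A \<Omega> T. calH_norm A s (proj_ge A \<kappa> q, proj_ge A \<kappa> p) \<le> e"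
      using \<kappa>(1) by blast
  qed
  ultimately show ?thesis by blast
qed

end
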